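(* Let $K$ be a field and $R = L_K(\mathcal{T})$. The left $R$-module $$C = Y \oplus \Big(\bigoplus_{f(x)\in\mathcal{F}} U^f\Big)$$ is a minimal injective cogenerator for $R$.
   Context: $R=L_K(\mathcal{T})$ is the Leavitt path algebra over the field $K$ of the graph $\mathcal{T}$ with two vertices $v,w$, a loop $c$ at $v$, and one edge $d$ from $v$ to $w$. That is, $R$ is the unital associative $K$-algebra generated by $v,w,c,d,c^*,d^*$ with relations $v^2=v$, $w^2=w$, $vw=wv=0$, $v+w=1_R$, $c=vc=cv$, $c^*=vc^*=c^*v$, $d=vd=dw$, $d^*=wd^*=d^*v$, $c^*c=v$, $d^*d=w$, $c^*d=d^*c=0$, $cc^*+dd^*=v$. "Module" means left module. For $g(x)=\sum_{i=0}^m k_ix^i\in K[x]$, set $g(c):=k_01_R+k_1c+\cdots+k_mc^m\in R$. $\mathcal{F}$ is the set of polynomials $f(x)\in K[x]$ that are irreducible in $K[x]$ with $f(0)=-1$. $f^n$ denotes the $n$-th power of $f$; $\mathbb N=\{1,2,\dots\}$. For $f\in\mathcal{F}$ and $n\in\mathbb N$, $M_n^f:=R/Rf^n(c)$; for $i\le \ell$, $\psi_{i,\ell}:M_i^f\to M_\ell^f$ is the ($R$-linear, injective) map $1+Rf^i(c)\mapsto f^{\ell-i}(c)+Rf^\ell(c)$; and $U^f:=\varinjlim\{M_i^f,\psi_{i,j}\}_{i\le j}$. $Y$ is the $K$-space of all formal series $y=k_{-1}w+k_0d+k_1cd+\cdots+k_ic^id+\cdots$ with $k_i\in K$ (no finiteness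 condition), made into a left $R$-module by $c\cdot y=k_0cd+k_1c^2d+\cdots+k_ic^{i+1}d+\cdots$; $c^*\cdot y=k_1d+k_2cd+\cdots+k_ic^{i-1}d+\cdots$; $d\cdot y=k_{-1}d$; $d^*\cdot y=k_0w$; $v\cdot y=k_0d+k_1cd+\cdots+k_ic^id+\cdots$; $w\cdot y=k_{-1}w$. A cogenerator for $R$ is a left module $C$ such that every left $R$-module embeds in a direct product of copies of $C$. A minimal injective cogenerator is an injective cogenerator that embeds (hence as a direct summand) in every injective cogenerator; it is unique up to isomorphism. *)

theory Defs
  imports
    "HOL-Library.Poly_Mapping"
    "HOL-Computational_Algebra.Polynomial"
    "HOL-Algebra.Module"
    "HOL-Algebra.QuotRing"
begin

section \<open>Left modules over a ring\<close>

text \<open>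
  The locale \<^locale>\<open>module\<close> asks for commutative scalars; this is the same notion over an arbitrary
  unital ring. The fields \<^const>\<open>mult\<close> and \<^const>\<open>one\<close> of a module record carry no meaning.
\<close>

locale left_module = R?: ring R + M?: abelian_group M for R (structure) and M (structure) +
  assumes smult_closed [simp, intro]:
      "\<lbrakk>a \<in> carrier R; x \<in> carrier M\<rbrakk> \<Longrightarrow> a \<odot>\<^bsub>M\<^esub> x \<in> carrier M"
    and smult_l_distr:
      "\<lbrakk>a \<in> carrier R; b \<in> carrier R; x \<in> carrier M\<rbrakk>
        \<Longrightarrow> (a \<oplus> b) \<odot>\<^bsub>M\<^esub> x = a \<odot>\<^bsub>M\<^esub> x \<oplus>\<^bsub>M\<^esub> b \<odot>\<^bsub>M\<^esub> x"
    and smult_r_distr: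
      "\<lbrakk>a \<in> carrier R; x \<in> carrier M; y \<in> carrier M\<rbrakk>
        \<Longrightarrow> a \<odot>\<^bsub>M\<^esub> (x \<oplus>\<^bsub>M\<^esub> y) = a \<odot>\<^bsub>M\<^esub> x \<oplus>\<^bsub>M\<^esub> a \<odot>\<^bsub>M\<^esub> y"
    and smult_assoc1:
      "\<lbrakk>a \<in> carrier R; b \<in> carrier R; x \<in> carrier M\<rbrakk>
        \<Longrightarrow> (a \<otimes> b) \<odot>\<^bsub>M\<^esub> x = a \<odot>\<^bsub>M\<^esub> (b \<odot>\<^bsub>M\<^esub> x)"
    and smult_one [simp]: "x \<in> carrier M \<Longrightarrow> \<one> \<odot>\<^bsub>M\<^esub> x = x"

definition lmod_hom ::
    "('r, 's) ring_scheme \<Rightarrow> ('r, 'a, 'm) module_scheme \<Rightarrow> ('r, 'b, 'n) module_scheme \<Rightarrow> ('a \<Rightarrow> 'b) set"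
  where "lmod_hom R M N =
    {h \<in> carrier M \<rightarrow> carrier N.
       (\<forall>x\<in>carrier M. \<forall>y\<in>carrier M. h (x \<oplus>\<^bsub>M\<^esub> y) = h x \<oplus>\<^bsub>N\<^esub> h y) \<and>
       (\<forall>r\<in>carrier R. \<forall>x\<in>carrier M. h (r \<odot>\<^bsub>M\<^esub> x) = r \<odot>\<^bsub>N\<^esub> h x)}"

definition lmod_embeds ::
    "('r, 's) ring_scheme \<Rightarrow> ('r, 'a, 'm) module_scheme \<Rightarrow> ('r, 'b, 'n) module_scheme \<Rightarrow> bool"
  where "lmod_embeds R M N \<longleftrightarrow> (\<exists>h \<in> lmod_hom R M N. inj_on h (carrier M))"

definition regular_lmod :: "('r, 's) ring_scheme \<Rightarrow> ('r, 'r) module"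
  where "regular_lmod R =
    \<lparr>carrier = carrier R, mult = undefined, one = undefined,
     zero = \<zero>\<^bsub>R\<^esub>, add = (\<oplus>\<^bsub>R\<^esub>), smult = (\<otimes>\<^bsub>R\<^esub>)\<rparr>"

definition quot_lmod :: "('r, 'a, 'm) module_scheme \<Rightarrow> 'a set \<Rightarrow> ('r, 'a set) module"
  where "quot_lmod M N =
    \<lparr>carrier = a_rcosets\<^bsub>M\<^esub> N, mult = undefined, one = undefined,
     zero = N, add = set_add M, smult = (\<lambda>r X. \<Union>x\<in>X. N +>\<^bsub>M\<^esub> (r \<odot>\<^bsub>M\<^esub> x))\<rparr>"

definition prod_lmod :: "'i set \<Rightarrow> ('i \<Rightarrow> ('r, 'a, 'm) module_scheme) \<Rightarrow> ('r, 'i \<Rightarrow> 'a) module"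
  where "prod_lmod I M =
    \<lparr>carrier = (\<Pi>\<^sub>E i\<in>I. carrier (M i)), mult = undefined, one = undefined,
     zero = (\<lambda>i\<in>I. \<zero>\<^bsub>M i\<^esub>),
     add = (\<lambda>x y. \<lambda>i\<in>I. x i \<oplus>\<^bsub>M i\<^esub> y i),
     smult = (\<lambda>r x. \<lambda>i\<in>I. r \<odot>\<^bsub>M i\<^esub> x i)\<rparr>"

definition sum_lmod :: "'i set \<Rightarrow> ('i \<Rightarrow> ('r, 'a, 'm) module_scheme) \<Rightarrow> ('r, 'i \<Rightarrow> 'a) module"
  where "sum_lmod I M = (prod_lmod I M)
    \<lparr>carrier := {x \<in> \<Pi>\<^sub>E i\<in>I. carrier (M i). finite {i \<in> I. x i \<noteq> \<zero>\<^bsub>M i\<^esub>}}\<rparr>"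

definition sum2_lmod ::
    "('r, 'a, 'm) module_scheme \<Rightarrow> ('r, 'b, 'n) module_scheme \<Rightarrow> ('r, 'a \<times> 'b) module"
  where "sum2_lmod M N =
    \<lparr>carrier = carrier M \<times> carrier N, mult = undefined, one = undefined,
     zero = (\<zero>\<^bsub>M\<^esub>, \<zero>\<^bsub>N\<^esub>),
     add = (\<lambda>(x, y) (x', y'). (x \<oplus>\<^bsub>M\<^esub> x', y \<oplus>\<^bsub>N\<^esub> y')),
     smult = (\<lambda>r (x, y). (r \<odot>\<^bsub>M\<^esub> x, r \<odot>\<^bsub>N\<^esub> y))\<rparr>"

text \<open>
  Direct limit of \<open>(M\<^sub>i, \<psi>\<^sub>i\<^sub>j)\<close> over a linearly ordered index set: the disjoint union of the
  \<open>M\<^sub>i\<close>, with \<open>(i, x)\<close> and \<open>(j, y)\<close> identified when \<open>x\<close> and \<open>y\<close> have the same image in some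
  \<open>M\<^sub>l\<close> with \<open>i, j \<le> l\<close>.
\<close>

definition dirlim_rel ::
    "'i::linorder set \<Rightarrow> ('i \<Rightarrow> ('r, 'a, 'm) module_scheme) \<Rightarrow> ('i \<Rightarrow> 'i \<Rightarrow> 'a \<Rightarrow> 'a)
      \<Rightarrow> (('i \<times> 'a) \<times> ('i \<times> 'a)) set"
  where "dirlim_rel I M \<psi> =
    {((i, x), (j, y)). i \<in> I \<and> j \<in> I \<and> x \<in> carrier (M i) \<and> y \<in> carrier (M j) \<and>
       (\<exists>l\<in>I. i \<le> l \<and> j \<le> l \<and> \<psi> i l x = \<psi> j l y)}"

definition dirlim_lmod ::
    "'i::linorder set \<Rightarrow> ('i \<Rightarrow> ('r, 'a, 'm) module_scheme) \<Rightarrow> ('i \<Rightarrow> 'i \<Rightarrow> 'a \<Rightarrow> 'a)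
      \<Rightarrow> ('r, ('i \<times> 'a) set) module"
  where "dirlim_lmod I M \<psi> =
    \<lparr>carrier = (SIGMA i:I. carrier (M i)) // dirlim_rel I M \<psi>, mult = undefined, one = undefined,
     zero = {(i, x). i \<in> I \<and> x \<in> carrier (M i) \<and> (\<exists>l\<in>I. i \<le> l \<and> \<psi> i l x = \<zero>\<^bsub>M l\<^esub>)},
     add = (\<lambda>A B. \<Union>(i, x)\<in>A. \<Union>(j, y)\<in>B.
       dirlim_rel I M \<psi> `` {(max i j, \<psi> i (max i j) x \<oplus>\<^bsub>M (max i j)\<^esub> \<psi> j (max i j) y)}),
     smult = (\<lambda>r A. \<Union>(i, x)\<in>A. dirlim_rel I M \<psi> `` {(i, r \<odot>\<^bsub>M i\<^esub> x)})\<rparr>"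

section \<open>Injective modules and cogenerators\<close>

text \<open>
  Quantification over the left modules on all types cannot occur inside a HOL formula; it is rendered
  as quantification over all left modules whose carrier is a subset of a type \<open>'u\<close>, passed as an
  argument. A statement with \<open>'u\<close> a free type variable is a statement about all modules.
  For injectivity it is no restriction that source and target have the same carrier type, since two
  types embed in their sum.
\<close>

definition injective_lmod ::
    "'u itself \<Rightarrow> ('r, 's) ring_scheme \<Rightarrow> ('r, 'a, 'm) module_scheme \<Rightarrow> bool"
  where "injective_lmod _ R Q \<longleftrightarrow> left_module R Q \<and>
    (\<forall>(A :: ('r, 'u) module) (B :: ('r, 'u) module) i g.
       left_module R A \<longrightarrow> left_module R B \<longrightarrow>
       i \<in> lmod_hom R A B \<longrightarrow> inj_on i (carrier A) \<longrightarrow> g \<in> lmod_hom R A Q \<longrightarrow>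
       (\<exists>h \<in> lmod_hom R B Q. \<forall>x\<in>carrier A. h (i x) = g x))"

text \<open>
  Index sets of powers of \<open>C\<close> may be taken inside \<open>'u\<close>: if \<open>M\<close> embeds in any power of \<open>C\<close>, then it
  embeds in one indexed by its nonzero elements, keeping for each of them one coordinate where its
  image does not vanish.
\<close>

definition cogenerator_lmod ::
    "'u itself \<Rightarrow> ('r, 's) ring_scheme \<Rightarrow> ('r, 'a, 'm) module_scheme \<Rightarrow> bool"
  where "cogenerator_lmod _ R C \<longleftrightarrow> left_module R C \<and>
    (\<forall>M :: ('r, 'u) module. left_module R M \<longrightarrow>
       (\<exists>I :: 'u set. lmod_embeds R M (prod_lmod I (\<lambda>_. C))))"

text \<open>
  \<open>'u\<close> is the universe in which \<open>C\<close> is tested and \<open>'e\<close> the carrier type of the competing modules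
  \<open>E\<close>. The requirement that \<open>E\<close> be an injective cogenerator is a hypothesis, so its test modules
  must live in some fixed type. This type is \<open>'r set\<close>, which contains copies of \<open>R\<close> and of its
  quotients. A module that is an injective cogenerator in any larger universe satisfies this
  hypothesis, so nothing is lost compared with testing \<open>E\<close> against all modules; by Baer's criterion,
  and because a simple module is a quotient of \<open>R\<close>, nothing is gained either.
\<close>

definition minimal_injective_cogenerator ::
    "'u itself \<Rightarrow> 'e itself \<Rightarrow> ('r, 's) ring_scheme \<Rightarrow> ('r, 'a, 'm) module_scheme \<Rightarrow> bool"
  where "minimal_injective_cogenerator _ _ R C \<longleftrightarrow>
    injective_lmod TYPE('u) R C \<and> cogenerator_lmod TYPE('u) R C \<and>
    (\<forall>E :: ('r, 'e) module.
       injective_lmod TYPE('r set) R E \<longrightarrow> cogenerator_lmod TYPE('r set) R E \<longrightarrow> lmod_embeds R C E)"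

section \<open>The Leavitt path algebra of the Toeplitz graph\<close>

text \<open>Words form a monoid under concatenation, so that \<open>'a list \<Rightarrow>\<^sub>0 'k\<close> is the free unital
  associative \<open>'k\<close>-algebra on \<open>'a\<close>.\<close>

instantiation list :: (type) monoid_add
begin
definition zero_list :: "'a list" where "zero_list = []"
definition plus_list :: "'a list \<Rightarrow> 'a list \<Rightarrow> 'a list" where "plus_list = (@)"
instance by standard (simp_all add: zero_list_def plus_list_def)
end

datatype gen = gen_v | gen_w | gen_c | gen_d | gen_cs | gen_ds

type_synonym 'k free = "gen list \<Rightarrow>\<^sub>0 'k"

definition free_alg :: "'k::field free ring"
  where "free_alg = \<lparr>carrier = UNIV, mult = (*), one = 1, zero = 0, add = (+)\<rparr>"

abbreviation gen :: "gen \<Rightarrow> 'k::field free"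
  where "gen x \<equiv> Poly_Mapping.single [x] 1"

definition toeplitz_rels :: "'k::field free set"
  where "toeplitz_rels = (let
      v = gen gen_v; w = gen gen_w; c = gen gen_c; d = gen gen_d; cs = gen gen_cs; ds = gen gen_ds
    in {v * v - v, w * w - w, v * w, w * v, v + w - 1,
        v * c - c, c * v - c, v * cs - cs, cs * v - cs,
        v * d - d, d * w - d, w * ds - ds, ds * v - ds,
        cs * c - v, ds * d - w, cs * d, ds * c, c * cs + d * ds - v})"

abbreviation toeplitz_ideal :: "'k::field free set"
  where "toeplitz_ideal \<equiv> Idl\<^bsub>free_alg\<^esub> toeplitz_rels"

definition toeplitz_lpa :: "'k::field free set ring"
  where "toeplitz_lpa = free_alg Quot toeplitz_ideal"

definition lpa_class :: "'k::field free \<Rightarrow> 'k free set"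
  where "lpa_class p = toeplitz_ideal +>\<^bsub>free_alg\<^esub> p"

text \<open>\<open>g(c)\<close>; the element \<open>k \<in> K\<close> of the algebra is the class of the constant \<open>single [] k\<close>.\<close>

definition poly_c :: "'k::field poly \<Rightarrow> 'k free set"
  where "poly_c g = (\<Oplus>\<^bsub>toeplitz_lpa\<^esub>i\<in>{..degree g}.
    lpa_class (Poly_Mapping.single [] (coeff g i)) \<otimes>\<^bsub>toeplitz_lpa\<^esub>
    (lpa_class (gen gen_c) [^]\<^bsub>toeplitz_lpa\<^esub> i))"

section \<open>The modules \<open>M\<^sub>n\<^sup>f\<close> and \<open>U\<^sup>f\<close>\<close>

definition irred_polys :: "'k::field poly set"
  where "irred_polys = {f. irreducible f \<and> poly f 0 = -1}"

text \<open>\<^const>\<open>cgenideal\<close> is \<open>Ra = {r \<otimes> a | r \<in> R}\<close> over any ring.\<close>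

definition M_mod :: "'k::field poly \<Rightarrow> nat \<Rightarrow> ('k free set, 'k free set set) module"
  where "M_mod f n = quot_lmod (regular_lmod toeplitz_lpa) (PIdl\<^bsub>toeplitz_lpa\<^esub> (poly_c (f ^ n)))"

text \<open>The linear map with \<open>1 + Rf\<^sup>i(c) \<mapsto> f\<^sup>l\<^sup>-\<^sup>i(c) + Rf\<^sup>l(c)\<close>, i.e.
  \<open>r + Rf\<^sup>i(c) \<mapsto> rf\<^sup>l\<^sup>-\<^sup>i(c) + Rf\<^sup>l(c)\<close>.\<close>

definition M_map :: "'k::field poly \<Rightarrow> nat \<Rightarrow> nat \<Rightarrow> 'k free set set \<Rightarrow> 'k free set set"
  where "M_map f i l X = (\<Union>r\<in>X.
    PIdl\<^bsub>toeplitz_lpa\<^esub> (poly_c (f ^ l)) +>\<^bsub>toeplitz_lpa\<^esub> (r \<otimes>\<^bsub>toeplitz_lpa\<^esub> poly_c (f ^ (l - i))))"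

definition U_mod :: "'k::field poly \<Rightarrow> ('k free set, (nat \<times> 'k free set set) set) module"
  where "U_mod f = dirlim_lmod {1..} (M_mod f) (M_map f)"

section \<open>The module \<open>Y\<close>\<close>

text \<open>A formal series is its coefficient function on the symbols \<open>w\<close> and \<open>c\<^sup>id\<close> (\<open>i \<ge> 0\<close>).\<close>

datatype ysym = Yw | Ycd nat

fun gen_act :: "gen \<Rightarrow> (ysym \<Rightarrow> 'k::field) \<Rightarrow> ysym \<Rightarrow> 'k" where
  "gen_act gen_v y Yw = 0"
| "gen_act gen_v y (Ycd i) = y (Ycd i)"
| "gen_act gen_w y Yw = y Yw"
| "gen_act gen_w y (Ycd i) = 0"
| "gen_act gen_c y Yw = 0"
| "gen_act gen_c y (Ycd 0) = 0"
| "gen_act gen_c y (Ycd (Suc i)) = y (Ycd i)"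
| "gen_act gen_cs y Yw = 0"
| "gen_act gen_cs y (Ycd i) = y (Ycd (Suc i))"
| "gen_act gen_d y Yw = 0"
| "gen_act gen_d y (Ycd 0) = y Yw"
| "gen_act gen_d y (Ycd (Suc i)) = 0"
| "gen_act gen_ds y Yw = y (Ycd 0)"
| "gen_act gen_ds y (Ycd i) = 0"

definition free_act :: "'k::field free \<Rightarrow> (ysym \<Rightarrow> 'k) \<Rightarrow> ysym \<Rightarrow> 'k"
  where "free_act p y s =
    (\<Sum>u\<in>Poly_Mapping.keys p. Poly_Mapping.lookup p u * foldr gen_act u y s)"

text \<open>An element of the quotient algebra acts as any of its representatives; see \<open>Y_mod_smult\<close>.\<close>

definition Y_mod :: "('k::field free set, ysym \<Rightarrow> 'k) module"
  where "Y_mod =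
    \<lparr>carrier = UNIV, mult = undefined, one = undefined,
     zero = (\<lambda>_. 0), add = (\<lambda>x y s. x s + y s),
     smult = (\<lambda>r y. the_elem ((\<lambda>p. free_act p y) ` r))\<rparr>"


subsection \<open>Well-definedness\<close>

lemma ring_free_alg: "ring (free_alg :: 'k::field free ring)"
  by (unfold_locales; (auto simp: free_alg_def Units_def algebra_simps)?)
     (metis add.commute add.right_inverse)

lemma ideal_toeplitz_ideal: "ideal toeplitz_ideal (free_alg :: 'k::field free ring)"
  by (rule ring.genideal_ideal[OF ring_free_alg]) (simp add: free_alg_def)

lemma ring_toeplitz_lpa: "ring (toeplitz_lpa :: 'k::field free set ring)"
  unfolding toeplitz_lpa_def by (rule ideal.quotient_is_ring[OF ideal_toeplitz_ideal])

lemma free_act_superset: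
  assumes "finite A" "Poly_Mapping.keys p \<subseteq> A"
  shows "free_act p y s = (\<Sum>u\<in>A. Poly_Mapping.lookup p u * foldr gen_act u y s)"
  unfolding free_act_def using assms
  by (intro sum.mono_neutral_left) (auto simp: Poly_Mapping.in_keys_iff)

lemma free_act_add: "free_act (p + q) y s = free_act p y s + free_act q y s"
proof -
  let ?A = "Poly_Mapping.keys p \<union> Poly_Mapping.keys q"
  have "Poly_Mapping.keys (p + q) \<subseteq> ?A" by (rule Poly_Mapping.keys_add)
  then show ?thesis
    by (simp add: free_act_superset[of ?A] lookup_add sum.distrib algebra_simps)
qed

lemma free_act_zero: "free_act 0 y s = 0"
  by (simp add: free_act_def)

lemma free_act_uminus: "free_act (- p) y s = - free_act p y s"
  using free_act_add[of p "- p" y s] by (simp add: free_act_zero eq_neg_iff_add_eq_0 add.commute)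

lemma free_act_diff: "free_act (p - q) y s = free_act p y s - free_act q y s"
  using free_act_add[of p "- q" y s] by (simp add: free_act_uminus)

lemma free_act_single: "free_act (Poly_Mapping.single u k) y s = k * foldr gen_act u y s"
  by (simp add: free_act_def)

lemma free_act_one: "free_act 1 y s = y s"
proof -
  have "Poly_Mapping.single [] 1 = (1 :: 'a free)" by (metis single_one zero_list_def)
  then show ?thesis using free_act_single[of "[]" 1 y s] by simp
qed

lemma gen_act_add: "gen_act g (\<lambda>s. x s + y s) = (\<lambda>s. gen_act g x s + gen_act g y s)"
proof
  fix s show "gen_act g (\<lambda>s. x s + y s) s = gen_act g x s + gen_act g y s"
    by (induction g x s rule: gen_act.induct) auto
qed

lemma gen_act_scale: "gen_act g (\<lambda>s. k * y s) = (\<lambda>s. k * gen_act g y s)"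
proof
  fix s show "gen_act g (\<lambda>s. k * y s) s = k * gen_act g y s"
    by (induction g y s rule: gen_act.induct) auto
qed

lemma word_act_add:
  "foldr gen_act u (\<lambda>s. x s + y s) = (\<lambda>s. foldr gen_act u x s + foldr gen_act u y s)"
  by (induction u) (simp_all add: gen_act_add)

lemma word_act_scale: "foldr gen_act u (\<lambda>s. k * y s) = (\<lambda>s. k * foldr gen_act u y s)"
  by (induction u) (simp_all add: gen_act_scale)

lemma word_act_zero: "foldr gen_act u (\<lambda>s. 0) = (\<lambda>s. 0)"
  using word_act_scale[of u 0 "\<lambda>s. 0"] by simp

lemma free_act_add_right: "free_act p (\<lambda>s. x s + y s) s = free_act p x s + free_act p y s"
  by (simp add: free_act_def word_act_add sum.distrib algebra_simps)

lemma free_act_zero_right: "free_act p (\<lambda>s. 0) s = 0"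
  by (simp add: free_act_def word_act_zero)

lemma free_induct [case_names single add]:
  assumes single: "\<And>u k. P (Poly_Mapping.single u k)"
    and add: "\<And>p q. P p \<Longrightarrow> P q \<Longrightarrow> P (p + q)"
  shows "P (p :: 'k::field free)"
proof (induction p rule: Poly_Mapping.update_induct)
  case const
  then show ?case using single[of "[]" 0] by simp
next
  case (update p u k)
  then have "Poly_Mapping.update u k p = p + Poly_Mapping.single u k"
    by (intro poly_mapping_eqI)
       (auto simp: lookup_update lookup_add lookup_single Poly_Mapping.in_keys_iff when_def)
  then show ?case using add single update by metis
qed

lemma free_act_mult: "free_act (p * q) y = free_act p (free_act q y)"
proof -
  have left: "free_act (Poly_Mapping.single u k * q) y s
      = free_act (Poly_Mapping.single u k) (free_act q y) s" for u k s
  proof (induction q arbitrary: s rule: free_induct)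
    case (single u' k')
    have "free_act (Poly_Mapping.single u' k') y = (\<lambda>s. k' * foldr gen_act u' y s)"
      by (rule ext) (rule free_act_single)
    then show ?case
      by (simp add: free_act_single mult_single plus_list_def word_act_scale)
  next
    case (add q1 q2)
    have "free_act (q1 + q2) y = (\<lambda>s. free_act q1 y s + free_act q2 y s)"
      by (rule ext) (rule free_act_add)
    then show ?case
      using add by (simp add: distrib_left free_act_add free_act_add_right)
  qed
  have "free_act (p * q) y s = free_act p (free_act q y) s" for s
    by (induction p rule: free_induct) (simp_all add: left distrib_right free_act_add)
  then show ?thesis by blast
qed

lemma free_act_rels:
  assumes "p \<in> toeplitz_rels" shows "free_act p y s = 0"
proof -
  note simps = toeplitz_rels_def Let_def ball_simps mult_single plus_list_def
    free_act_add free_act_diff free_act_single free_act_one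
  have "\<forall>p\<in>toeplitz_rels. free_act p y s = 0"
  proof (cases s)
    case Yw
    then show ?thesis by (simp add: simps)
  next
    case (Ycd i)
    then show ?thesis by (cases i) (simp_all add: simps)
  qed
  then show ?thesis using assms by blast
qed

lemma free_act_ideal:
  assumes "p \<in> toeplitz_ideal" shows "free_act p y s = 0"
proof -
  let ?I = "{p :: 'a free. \<forall>y s. free_act p y s = 0}"
  interpret ring "free_alg :: 'a free ring" by (rule ring_free_alg)
  have fa: "carrier (free_alg :: 'a free ring) = UNIV" "p \<oplus>\<^bsub>free_alg\<^esub> q = p + q" for p q :: "'a free"
    by (simp_all add: free_alg_def)
  have neg: "\<ominus>\<^bsub>free_alg\<^esub> p = - p" for p :: "'a free"
    by (rule minus_equality) (simp_all add: free_alg_def)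
  have "ideal ?I (free_alg :: 'a free ring)"
  proof (rule idealI[OF ring_free_alg])
    show "subgroup ?I (add_monoid (free_alg :: 'a free ring))"
    proof (rule add.subgroupI)
      have "0 \<in> ?I" by (simp add: free_act_zero)
      then show "?I \<noteq> {}" by blast
    qed (auto simp: fa neg free_act_uminus free_act_add)
  next
    fix a x :: "'a free"
    assume "a \<in> ?I"
    then have "free_act a y = (\<lambda>s. 0)" for y by (auto intro: ext)
    then show "x \<otimes>\<^bsub>free_alg\<^esub> a \<in> ?I" "a \<otimes>\<^bsub>free_alg\<^esub> x \<in> ?I"
      by (auto simp: free_alg_def free_act_mult free_act_zero_right)
  qed
  moreover have "toeplitz_rels \<subseteq> ?I" using free_act_rels by auto
  ultimately have "toeplitz_ideal \<subseteq> ?I" by (rule genideal_minimal)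
  then show ?thesis using assms by auto
qed

lemma Y_mod_smult: "lpa_class p \<odot>\<^bsub>Y_mod\<^esub> y = free_act p y"
proof -
  interpret ideal toeplitz_ideal "free_alg :: 'a free ring" by (rule ideal_toeplitz_ideal)
  have "free_act q y = free_act p y" if "q \<in> lpa_class p" for q
  proof -
    from that obtain h where "h \<in> toeplitz_ideal" "q = h + p"
      by (auto simp: lpa_class_def a_r_coset_def' free_alg_def)
    then show ?thesis by (auto simp: free_act_add free_act_ideal)
  qed
  moreover have "p \<in> lpa_class p"
    unfolding lpa_class_def by (rule a_rcos_self) (simp add: free_alg_def)
  ultimately have "(\<lambda>q. free_act q y) ` lpa_class p = {free_act p y}"
    by (intro equalityI subsetI) (blast, metis image_eqI singletonD)
  then show ?thesis by (simp add: Y_mod_def)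
qed

end

theory Submission
  imports Defs "HOL-Computational_Algebra.Polynomial_Factorial"
begin

text \<open>
  Put \<open>X = c\<^sup>* + d\<^sup>*\<close> and \<open>Y = c + d\<close>. Then \<open>X Y = 1\<close>, \<open>w = 1 - Y X\<close>, and \<open>R\<close> is generated over \<open>K\<close>
  by \<open>X\<close> and \<open>Y\<close>. An element \<open>m\<close> of a left module is of one of two kinds. If \<open>w X\<^sup>j m \<noteq> 0\<close> for some
  \<open>j\<close>, then this multiple generates a copy of the simple left ideal \<open>Rw = K[Y] w\<close>. If
  \<open>w X\<^sup>j m = 0\<close> for all \<open>j\<close>, then \<open>X\<close> and \<open>Y\<close> are inverse to each other on \<open>R m\<close>, which is thus a
  module over \<open>K[x, x\<^sup>-\<^sup>1]\<close> with \<open>x\<close> acting as \<open>Y\<close>; the elements \<open>c\<close> and \<open>Y\<close> act in the same way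
  there. So the simple modules are \<open>Rw\<close> and the \<open>K[x]/(f)\<close> for \<open>f \<in> \<F>\<close>. The former
  is the simple submodule of the module \<open>Y_mod\<close> of series, the latter that of \<open>U\<^sup>f\<close>.

  Injectivity is proved by Baer's criterion. A series is a linear functional on
  \<open>wR = w K[X]\<close>, so a homomorphism from a left ideal to \<open>Y_mod\<close> is a functional on a subspace of \<open>K[X]\<close>,
  and functionals extend (\<open>baer_Y\<close>). On \<open>U\<^sup>f\<close> the elements \<open>w X\<^sup>j\<close> act as zero, and every nonzero polynomial
  in \<open>X\<close> or in \<open>Y\<close> acts surjectively; both properties pass to the direct sum. As each \<open>r \<in> R\<close> has a multiple
  \<open>X\<^sup>n r\<close> in \<open>K[X]\<close>, Baer's criterion for such a module reduces to the principal ideals of \<open>K[x]\<close>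
  (\<open>baer_D\<close>).

  Since every nonzero element of a module has a multiple that maps to a nonzero element of one of
  the simple submodules above, and this map extends by injectivity, the sum is a cogenerator
  (\<open>C_separates\<close>). It is minimal because its simple submodules are essential (\<open>Y_essential\<close>,
  \<open>D_essential\<close>) and pairwise non-isomorphic: an injective cogenerator \<open>E\<close> contains each of them, the
  inclusions extend to a homomorphism to \<open>E\<close>, and this is injective (\<open>C_minimal\<close>).
\<close>

section \<open>Left modules over a ring\<close>

context left_module begin

lemma smult_l_null [simp]: "x \<in> carrier M \<Longrightarrow> \<zero> \<odot>\<^bsub>M\<^esub> x = \<zero>\<^bsub>M\<^esub>"
  using smult_l_distr[of \<zero> \<zero> x] by (simp add: M.add.r_cancel_one')

lemma smult_r_null [simp]: "a \<in> carrier R \<Longrightarrow> a \<odot>\<^bsub>M\<^esub> \<zero>\<^bsub>M\<^esub> = \<zero>\<^bsub>M\<^esub>"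
  using smult_r_distr[of a "\<zero>\<^bsub>M\<^esub>" "\<zero>\<^bsub>M\<^esub>"] by (simp add: M.add.r_cancel_one')

lemma smult_l_minus:
  "\<lbrakk>a \<in> carrier R; x \<in> carrier M\<rbrakk> \<Longrightarrow> (\<ominus> a) \<odot>\<^bsub>M\<^esub> x = \<ominus>\<^bsub>M\<^esub> (a \<odot>\<^bsub>M\<^esub> x)"
  using smult_l_distr[of "\<ominus> a" a x] by (intro M.minus_equality[symmetric]) (simp_all add: R.l_neg)

lemma smult_minus_one: "x \<in> carrier M \<Longrightarrow> (\<ominus> \<one>) \<odot>\<^bsub>M\<^esub> x = \<ominus>\<^bsub>M\<^esub> x"
  by (simp add: smult_l_minus)

lemma submoduleI:
  assumes "H \<subseteq> carrier M" "\<zero>\<^bsub>M\<^esub> \<in> H"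
    and "\<And>x y. \<lbrakk>x \<in> H; y \<in> H\<rbrakk> \<Longrightarrow> x \<oplus>\<^bsub>M\<^esub> y \<in> H"
    and "\<And>a x. \<lbrakk>a \<in> carrier R; x \<in> H\<rbrakk> \<Longrightarrow> a \<odot>\<^bsub>M\<^esub> x \<in> H"
  shows "submodule H R M"
proof -
  have "\<ominus>\<^bsub>M\<^esub> x \<in> H" if "x \<in> H" for x
    using assms(1) assms(4)[of "\<ominus> \<one>" x] that smult_minus_one[of x] by auto
  with assms show ?thesis
    by (intro submodule.intro M.add.subgroupI submodule_axioms.intro) (auto simp: a_inv_def)
qed

lemma submodule_restrict:
  assumes "submodule H R M"
  shows "left_module R (M\<lparr>carrier := H\<rparr>)"
proof -
  have sub: "x \<in> carrier M" if "x \<in> H" for x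
    using subgroup.subset[OF submodule.axioms(1)[OF assms]] that by auto
  note closed = subgroup.m_closed[OF submodule.axioms(1)[OF assms], simplified]
    subgroup.one_closed[OF submodule.axioms(1)[OF assms], simplified]
    submodule.smult_closed[OF assms]
  have "abelian_group (M\<lparr>carrier := H\<rparr>)"
  proof (rule abelian_groupI)
    fix x assume x: "x \<in> carrier (M\<lparr>carrier := H\<rparr>)"
    then have "\<ominus>\<^bsub>M\<^esub> x \<in> H" using closed(3)[of "\<ominus> \<one>" x] sub smult_minus_one by simp
    with x show "\<exists>y\<in>carrier (M\<lparr>carrier := H\<rparr>). y \<oplus>\<^bsub>M\<lparr>carrier := H\<rparr>\<^esub> x = \<zero>\<^bsub>M\<lparr>carrier := H\<rparr>\<^esub>"
      using sub by (auto intro!: bexI[of _ "\<ominus>\<^bsub>M\<^esub> x"] simp: M.l_neg)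
  qed (simp_all add: sub closed M.a_ac)
  then show ?thesis
    by (intro left_module.intro left_module_axioms.intro)
       (simp_all add: R.ring_axioms sub closed smult_l_distr smult_r_distr smult_assoc1)
qed

end

text \<open>
  The negative of \<open>x\<close> is \<open>(- 1) x\<close>, so the rule \<open>0 x = 0\<close> takes the place of the existence of
  negatives.
\<close>

lemma left_moduleI:
  fixes R (structure) and M (structure)
  assumes "ring R"
    and "\<zero>\<^bsub>M\<^esub> \<in> carrier M"
    and "\<And>x y. \<lbrakk>x \<in> carrier M; y \<in> carrier M\<rbrakk> \<Longrightarrow> x \<oplus>\<^bsub>M\<^esub> y \<in> carrier M"
    and "\<And>x y z. \<lbrakk>x \<in> carrier M; y \<in> carrier M; z \<in> carrier M\<rbrakk> \<Longrightarrow> (x \<oplus>\<^bsub>M\<^esub> y) \<oplus>\<^bsub>M\<^esub> z = x \<oplus>\<^bsub>M\<^esub> (y \<oplus>\<^bsub>M\<^esub> z)"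
    and "\<And>x y. \<lbrakk>x \<in> carrier M; y \<in> carrier M\<rbrakk> \<Longrightarrow> x \<oplus>\<^bsub>M\<^esub> y = y \<oplus>\<^bsub>M\<^esub> x"
    and "\<And>x. x \<in> carrier M \<Longrightarrow> \<zero>\<^bsub>M\<^esub> \<oplus>\<^bsub>M\<^esub> x = x"
    and "\<And>a x. \<lbrakk>a \<in> carrier R; x \<in> carrier M\<rbrakk> \<Longrightarrow> a \<odot>\<^bsub>M\<^esub> x \<in> carrier M"
    and "\<And>a b x. \<lbrakk>a \<in> carrier R; b \<in> carrier R; x \<in> carrier M\<rbrakk>
        \<Longrightarrow> (a \<oplus>\<^bsub>R\<^esub> b) \<odot>\<^bsub>M\<^esub> x = a \<odot>\<^bsub>M\<^esub> x \<oplus>\<^bsub>M\<^esub> b \<odot>\<^bsub>M\<^esub> x"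
    and "\<And>a x y. \<lbrakk>a \<in> carrier R; x \<in> carrier M; y \<in> carrier M\<rbrakk>
        \<Longrightarrow> a \<odot>\<^bsub>M\<^esub> (x \<oplus>\<^bsub>M\<^esub> y) = a \<odot>\<^bsub>M\<^esub> x \<oplus>\<^bsub>M\<^esub> a \<odot>\<^bsub>M\<^esub> y"
    and "\<And>a b x. \<lbrakk>a \<in> carrier R; b \<in> carrier R; x \<in> carrier M\<rbrakk>
        \<Longrightarrow> (a \<otimes>\<^bsub>R\<^esub> b) \<odot>\<^bsub>M\<^esub> x = a \<odot>\<^bsub>M\<^esub> (b \<odot>\<^bsub>M\<^esub> x)"
    and "\<And>x. x \<in> carrier M \<Longrightarrow> \<one>\<^bsub>R\<^esub> \<odot>\<^bsub>M\<^esub> x = x"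
    and zero: "\<And>x. x \<in> carrier M \<Longrightarrow> \<zero>\<^bsub>R\<^esub> \<odot>\<^bsub>M\<^esub> x = \<zero>\<^bsub>M\<^esub>"
  shows "left_module R M"
proof -
  interpret R: ring R by fact
  have "abelian_group M"
  proof (rule abelian_groupI)
    fix x assume x: "x \<in> carrier M"
    have "(\<ominus>\<^bsub>R\<^esub> \<one>\<^bsub>R\<^esub>) \<odot>\<^bsub>M\<^esub> x \<oplus>\<^bsub>M\<^esub> x = (\<ominus>\<^bsub>R\<^esub> \<one>\<^bsub>R\<^esub> \<oplus>\<^bsub>R\<^esub> \<one>\<^bsub>R\<^esub>) \<odot>\<^bsub>M\<^esub> x"
      using assms(8)[of "\<ominus>\<^bsub>R\<^esub> \<one>\<^bsub>R\<^esub>" "\<one>\<^bsub>R\<^esub>" x] assms(11)[OF x] x by simp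
    also have "\<dots> = \<zero>\<^bsub>M\<^esub>" using zero[OF x] by (simp add: R.l_neg)
    finally show "\<exists>y\<in>carrier M. y \<oplus>\<^bsub>M\<^esub> x = \<zero>\<^bsub>M\<^esub>" using assms(7) x by blast
  qed (use assms in auto)
  with assms show ?thesis by (intro left_module.intro left_module_axioms.intro) auto
qed

lemma left_module_regular:
  assumes "ring R" shows "left_module R (regular_lmod R)"
proof -
  interpret R: ring R by fact
  show ?thesis
    by (rule left_moduleI)
       (simp_all add: regular_lmod_def R.ring_axioms R.a_ac R.l_distr R.r_distr R.m_assoc)
qed

lemma left_module_sum2:
  assumes "left_module R M" "left_module R N"
  shows "left_module R (sum2_lmod M N)"
proof -
  interpret M: left_module R M by fact
  interpret N: left_module R N by fact
  show ?thesis
    by (rule left_moduleI)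
       (auto simp: sum2_lmod_def M.R.ring_axioms M.M.a_ac N.M.a_ac
         M.smult_l_distr N.smult_l_distr M.smult_r_distr N.smult_r_distr M.smult_assoc1 N.smult_assoc1)
qed

lemma left_module_sum:
  assumes R: "ring R" and "\<And>i. i \<in> I \<Longrightarrow> left_module R (M i)"
  shows "left_module R (sum_lmod I M)"
proof -
  have ab: "abelian_group (M i)" if "i \<in> I" for i
    using assms(2)[OF that] by (rule left_module.axioms(2))
  note ab' = abelian_group.axioms(1)[OF ab]
  note G = abelian_monoid.zero_closed[OF ab'] abelian_monoid.a_closed[OF ab'] abelian_monoid.l_zero[OF ab']
    abelian_monoid.r_zero[OF ab']
  note L = left_module.smult_closed[OF assms(2)] left_module.smult_l_distr[OF assms(2)]
     left_module.smult_r_distr[OF assms(2)] left_module.smult_assoc1[OF assms(2)] left_module.smult_one[OF assms(2)]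
     left_module.smult_l_null[OF assms(2)] left_module.smult_r_null[OF assms(2)]
  have fin: "finite {i \<in> I. x i \<oplus>\<^bsub>M i\<^esub> y i \<noteq> \<zero>\<^bsub>M i\<^esub>}"
    if "finite {i \<in> I. x i \<noteq> \<zero>\<^bsub>M i\<^esub>}" "finite {i \<in> I. y i \<noteq> \<zero>\<^bsub>M i\<^esub>}" for x y
    by (rule finite_subset[OF _ finite_UnI[OF that]]) (auto simp: G)
  have fin': "finite {i \<in> I. r \<odot>\<^bsub>M i\<^esub> x i \<noteq> \<zero>\<^bsub>M i\<^esub>}"
    if "finite {i \<in> I. x i \<noteq> \<zero>\<^bsub>M i\<^esub>}" "r \<in> carrier R" for x r
    by (rule finite_subset[OF _ that(1)]) (auto simp: L that)
  let ?S = "sum_lmod I M"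
  show ?thesis
  proof (rule left_moduleI)
    fix x y assume "x \<in> carrier ?S" "y \<in> carrier ?S"
    then show "x \<oplus>\<^bsub>?S\<^esub> y = y \<oplus>\<^bsub>?S\<^esub> x"
      by (auto simp: sum_lmod_def prod_lmod_def PiE_iff intro!: restrict_ext abelian_monoid.a_comm[OF ab'])
  next
    fix x y z
    assume "x \<in> carrier ?S" "y \<in> carrier ?S" "z \<in> carrier ?S"
    then show "x \<oplus>\<^bsub>?S\<^esub> y \<oplus>\<^bsub>?S\<^esub> z = x \<oplus>\<^bsub>?S\<^esub> (y \<oplus>\<^bsub>?S\<^esub> z)"
      by (auto simp: sum_lmod_def prod_lmod_def PiE_iff intro!: restrict_ext abelian_monoid.a_assoc[OF ab'])
  next
    have eqI: "restrict f I = x" if "x \<in> extensional I" "\<And>i. i \<in> I \<Longrightarrow> f i = x i" for f x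
      using that by (auto simp: restrict_def extensional_def)
    fix x assume "x \<in> carrier ?S"
    then show "\<zero>\<^bsub>?S\<^esub> \<oplus>\<^bsub>?S\<^esub> x = x" "\<one>\<^bsub>R\<^esub> \<odot>\<^bsub>?S\<^esub> x = x"
      by (auto simp: sum_lmod_def prod_lmod_def PiE_iff L G intro!: eqI)
  next
    fix x y assume "x \<in> carrier ?S" "y \<in> carrier ?S"
    then show "x \<oplus>\<^bsub>?S\<^esub> y \<in> carrier ?S"
      using fin[of x y] by (auto simp: sum_lmod_def prod_lmod_def PiE_iff G cong: conj_cong)
  next
    fix r x assume "r \<in> carrier R" "x \<in> carrier ?S"
    then show "r \<odot>\<^bsub>?S\<^esub> x \<in> carrier ?S"
      using fin'[of x r] by (auto simp: sum_lmod_def prod_lmod_def PiE_iff L cong: conj_cong)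
  next
    show "\<zero>\<^bsub>?S\<^esub> \<in> carrier ?S"
      by (auto simp: sum_lmod_def prod_lmod_def PiE_iff G cong: conj_cong)
  next
    fix a b x assume "a \<in> carrier R" "b \<in> carrier R" "x \<in> carrier ?S"
    then show "(a \<oplus>\<^bsub>R\<^esub> b) \<odot>\<^bsub>?S\<^esub> x = a \<odot>\<^bsub>?S\<^esub> x \<oplus>\<^bsub>?S\<^esub> b \<odot>\<^bsub>?S\<^esub> x"
      "(a \<otimes>\<^bsub>R\<^esub> b) \<odot>\<^bsub>?S\<^esub> x = a \<odot>\<^bsub>?S\<^esub> (b \<odot>\<^bsub>?S\<^esub> x)"
      by (auto simp: sum_lmod_def prod_lmod_def PiE_iff L intro!: restrict_ext)
  next
    fix a x y assume "a \<in> carrier R" "x \<in> carrier ?S" "y \<in> carrier ?S"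
    then show "a \<odot>\<^bsub>?S\<^esub> (x \<oplus>\<^bsub>?S\<^esub> y) = a \<odot>\<^bsub>?S\<^esub> x \<oplus>\<^bsub>?S\<^esub> a \<odot>\<^bsub>?S\<^esub> y"
      by (auto simp: sum_lmod_def prod_lmod_def PiE_iff L intro!: restrict_ext)
  next
    fix x assume "x \<in> carrier ?S"
    then show "\<zero>\<^bsub>R\<^esub> \<odot>\<^bsub>?S\<^esub> x = \<zero>\<^bsub>?S\<^esub>"
      by (auto simp: sum_lmod_def prod_lmod_def PiE_iff L intro!: restrict_ext)
  qed (rule R)
qed

lemma lmod_homI:
  assumes "\<And>x. x \<in> carrier M \<Longrightarrow> h x \<in> carrier N"
    and "\<And>x y. \<lbrakk>x \<in> carrier M; y \<in> carrier M\<rbrakk> \<Longrightarrow> h (x \<oplus>\<^bsub>M\<^esub> y) = h x \<oplus>\<^bsub>N\<^esub> h y"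
    and "\<And>r x. \<lbrakk>r \<in> carrier R; x \<in> carrier M\<rbrakk> \<Longrightarrow> h (r \<odot>\<^bsub>M\<^esub> x) = r \<odot>\<^bsub>N\<^esub> h x"
  shows "h \<in> lmod_hom R M N"
  using assms by (auto simp: lmod_hom_def)

lemma lmod_homD:
  assumes "h \<in> lmod_hom R M N"
  shows "x \<in> carrier M \<Longrightarrow> h x \<in> carrier N"
    and "\<lbrakk>x \<in> carrier M; y \<in> carrier M\<rbrakk> \<Longrightarrow> h (x \<oplus>\<^bsub>M\<^esub> y) = h x \<oplus>\<^bsub>N\<^esub> h y"
    and "\<lbrakk>r \<in> carrier R; x \<in> carrier M\<rbrakk> \<Longrightarrow> h (r \<odot>\<^bsub>M\<^esub> x) = r \<odot>\<^bsub>N\<^esub> h x"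
  using assms by (auto simp: lmod_hom_def)

lemma lmod_hom_zero:
  assumes "left_module R M" "left_module R N" "h \<in> lmod_hom R M N"
  shows "h \<zero>\<^bsub>M\<^esub> = \<zero>\<^bsub>N\<^esub>"
proof -
  interpret M: left_module R M by fact
  interpret N: left_module R N by fact
  have "h (\<zero>\<^bsub>R\<^esub> \<odot>\<^bsub>M\<^esub> \<zero>\<^bsub>M\<^esub>) = \<zero>\<^bsub>R\<^esub> \<odot>\<^bsub>N\<^esub> h \<zero>\<^bsub>M\<^esub>" by (rule lmod_homD[OF assms(3)]) auto
  then show ?thesis using lmod_homD(1)[OF assms(3), of "\<zero>\<^bsub>M\<^esub>"] by simp
qed

section \<open>Baer's criterion\<close>

text \<open>
  A submodule of \<open>M \<times> N\<close> that is single-valued at zero is the graph of a homomorphism from some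
  submodule of \<open>M\<close> to \<open>N\<close>. In this form partial homomorphisms are ordered by inclusion, and Zorn's
  lemma applies to them directly.
\<close>

definition linear_graph ::
    "('r, 's) ring_scheme \<Rightarrow> ('r, 'a, 'm) module_scheme \<Rightarrow> ('r, 'b, 'n) module_scheme \<Rightarrow> ('a \<times> 'b) set \<Rightarrow> bool"
  where "linear_graph R M N G \<longleftrightarrow>
    submodule G R (sum2_lmod M N) \<and> (\<forall>y. (\<zero>\<^bsub>M\<^esub>, y) \<in> G \<longrightarrow> y = \<zero>\<^bsub>N\<^esub>)"

text \<open>
  A homomorphism from a left ideal to \<open>N\<close> extends to the whole ring exactly when it is
  \<open>r \<mapsto> r d\<close> for some \<open>d\<close>. Unlike injectivity, the condition does not refer to a universe of test
  modules, and so it carries injectivity from one universe to another.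
\<close>

definition baer :: "('r, 's) ring_scheme \<Rightarrow> ('r, 'b, 'n) module_scheme \<Rightarrow> bool"
  where "baer R N \<longleftrightarrow> (\<forall>I g. submodule I R (regular_lmod R) \<longrightarrow>
    g \<in> lmod_hom R (regular_lmod R\<lparr>carrier := I\<rparr>) N \<longrightarrow>
    (\<exists>d\<in>carrier N. \<forall>r\<in>I. g r = r \<odot>\<^bsub>N\<^esub> d))"

lemma baerE:
  assumes "baer R N" "submodule I R (regular_lmod R)" "g \<in> lmod_hom R (regular_lmod R\<lparr>carrier := I\<rparr>) N"
  obtains d where "d \<in> carrier N" "\<And>r. r \<in> I \<Longrightarrow> g r = r \<odot>\<^bsub>N\<^esub> d"
  using assms unfolding baer_def by blast

lemma linear_graphI:
  assumes "left_module R M" "left_module R N"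
    and "\<And>x y. (x, y) \<in> G \<Longrightarrow> x \<in> carrier M \<and> y \<in> carrier N"
    and "(\<zero>\<^bsub>M\<^esub>, \<zero>\<^bsub>N\<^esub>) \<in> G"
    and "\<And>x y x' y'. \<lbrakk>(x, y) \<in> G; (x', y') \<in> G\<rbrakk> \<Longrightarrow> (x \<oplus>\<^bsub>M\<^esub> x', y \<oplus>\<^bsub>N\<^esub> y') \<in> G"
    and "\<And>r x y. \<lbrakk>r \<in> carrier R; (x, y) \<in> G\<rbrakk> \<Longrightarrow> (r \<odot>\<^bsub>M\<^esub> x, r \<odot>\<^bsub>N\<^esub> y) \<in> G"
    and "\<And>y. (\<zero>\<^bsub>M\<^esub>, y) \<in> G \<Longrightarrow> y = \<zero>\<^bsub>N\<^esub>"
  shows "linear_graph R M N G"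
proof -
  have "submodule G R (sum2_lmod M N)"
    by (rule left_module.submoduleI[OF left_module_sum2[OF assms(1,2)]])
       (use assms(3-6) in \<open>auto simp: sum2_lmod_def\<close>)
  with assms(7) show ?thesis by (simp add: linear_graph_def)
qed

lemma linear_graphD:
  assumes "linear_graph R M N G"
  shows "(x, y) \<in> G \<Longrightarrow> x \<in> carrier M" "(x, y) \<in> G \<Longrightarrow> y \<in> carrier N"
    and "(\<zero>\<^bsub>M\<^esub>, \<zero>\<^bsub>N\<^esub>) \<in> G"
    and "\<lbrakk>(x, y) \<in> G; (x', y') \<in> G\<rbrakk> \<Longrightarrow> (x \<oplus>\<^bsub>M\<^esub> x', y \<oplus>\<^bsub>N\<^esub> y') \<in> G"
    and "\<lbrakk>r \<in> carrier R; (x, y) \<in> G\<rbrakk> \<Longrightarrow> (r \<odot>\<^bsub>M\<^esub> x, r \<odot>\<^bsub>N\<^esub> y) \<in> G"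
    and "(\<zero>\<^bsub>M\<^esub>, y) \<in> G \<Longrightarrow> y = \<zero>\<^bsub>N\<^esub>"
proof -
  have s: "submodule G R (sum2_lmod M N)" using assms by (simp add: linear_graph_def)
  note g = submodule.axioms(1)[OF s]
  show "(x, y) \<in> G \<Longrightarrow> x \<in> carrier M" "(x, y) \<in> G \<Longrightarrow> y \<in> carrier N"
    using subgroup.subset[OF g] by (auto simp: sum2_lmod_def)
  show "(\<zero>\<^bsub>M\<^esub>, \<zero>\<^bsub>N\<^esub>) \<in> G" using subgroup.one_closed[OF g] by (simp add: sum2_lmod_def)
  show "\<lbrakk>(x, y) \<in> G; (x', y') \<in> G\<rbrakk> \<Longrightarrow> (x \<oplus>\<^bsub>M\<^esub> x', y \<oplus>\<^bsub>N\<^esub> y') \<in> G"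
    using subgroup.m_closed[OF g, of "(x, y)" "(x', y')"] by (simp add: sum2_lmod_def)
  show "\<lbrakk>r \<in> carrier R; (x, y) \<in> G\<rbrakk> \<Longrightarrow> (r \<odot>\<^bsub>M\<^esub> x, r \<odot>\<^bsub>N\<^esub> y) \<in> G"
    using submodule.smult_closed[OF s, of r "(x, y)"] by (simp add: sum2_lmod_def)
  show "(\<zero>\<^bsub>M\<^esub>, y) \<in> G \<Longrightarrow> y = \<zero>\<^bsub>N\<^esub>" using assms by (simp add: linear_graph_def)
qed

lemma linear_graph_unique:
  assumes "left_module R M" "left_module R N" "linear_graph R M N G" "(x, y) \<in> G" "(x, z) \<in> G"
  shows "y = z"
proof -
  interpret M: left_module R M by fact
  interpret N: left_module R N by fact
  note G = linear_graphD[OF assms(3)]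
  have x: "x \<in> carrier M" "y \<in> carrier N" "z \<in> carrier N" using G assms by auto
  have "(\<ominus>\<^bsub>M\<^esub> x, \<ominus>\<^bsub>N\<^esub> z) \<in> G"
    using G(5)[OF _ assms(5), of "\<ominus>\<^bsub>R\<^esub> \<one>\<^bsub>R\<^esub>"] x by (simp add: M.smult_minus_one N.smult_minus_one)
  from G(4)[OF assms(4) this] have "y \<oplus>\<^bsub>N\<^esub> \<ominus>\<^bsub>N\<^esub> z = \<zero>\<^bsub>N\<^esub>"
    using x G(6) by (simp add: M.M.r_neg)
  then show ?thesis using x N.M.minus_equality[of y "\<ominus>\<^bsub>N\<^esub> z"] by simp
qed

text \<open>
  One step of Baer's argument: the scalars \<open>r\<close> for which \<open>r b\<close> lies in the domain form a left ideal,
  and an element \<open>d\<close> that represents the partial homomorphism on this ideal is a consistent value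
  at \<open>b\<close>.
\<close>

lemma linear_graph_add_element:
  assumes "left_module R M" "left_module R N" "baer R N" "linear_graph R M N H" "b \<in> carrier M"
  obtains H' d where "linear_graph R M N H'" "H \<subseteq> H'" "(b, d) \<in> H'"
proof -
  interpret M: left_module R M by fact
  interpret N: left_module R N by fact
  note H = linear_graphD[OF assms(4)]
  note b = assms(5)
  define I where "I = {r \<in> carrier R. \<exists>q. (r \<odot>\<^bsub>M\<^esub> b, q) \<in> H}"
  define g where "g r = (THE q. (r \<odot>\<^bsub>M\<^esub> b, q) \<in> H)" for r
  have g: "g r = q" if "(r \<odot>\<^bsub>M\<^esub> b, q) \<in> H" for r q
    unfolding g_def using that linear_graph_unique[OF assms(1,2,4)] by blast
  have gH: "(r \<odot>\<^bsub>M\<^esub> b, g r) \<in> H" if "r \<in> I" for r using that g by (auto simp: I_def)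
  have IR: "r \<in> carrier R" if "r \<in> I" for r using that by (simp add: I_def)
  have "submodule I R (regular_lmod R)"
  proof (rule left_module.submoduleI[OF left_module_regular[OF M.R.ring_axioms]])
    show "I \<subseteq> carrier (regular_lmod R)" by (auto simp: I_def regular_lmod_def)
    show "\<zero>\<^bsub>regular_lmod R\<^esub> \<in> I" using H(3) b by (auto simp: I_def regular_lmod_def)
  next
    fix r s assume "r \<in> I" "s \<in> I"
    then show "r \<oplus>\<^bsub>regular_lmod R\<^esub> s \<in> I"
      using H(4)[OF gH gH, of r s] b by (auto simp: I_def regular_lmod_def M.smult_l_distr)
  next
    fix a r assume "a \<in> carrier R" "r \<in> I"
    then show "a \<odot>\<^bsub>regular_lmod R\<^esub> r \<in> I"
      using H(5)[OF _ gH, of a r] b by (auto simp: I_def regular_lmod_def M.smult_assoc1)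
  qed
  moreover have "g \<in> lmod_hom R (regular_lmod R\<lparr>carrier := I\<rparr>) N"
  proof (rule lmod_homI)
    fix r s assume "r \<in> carrier (regular_lmod R\<lparr>carrier := I\<rparr>)" "s \<in> carrier (regular_lmod R\<lparr>carrier := I\<rparr>)"
    then show "g (r \<oplus>\<^bsub>regular_lmod R\<lparr>carrier := I\<rparr>\<^esub> s) = g r \<oplus>\<^bsub>N\<^esub> g s"
      using H(4)[OF gH gH, of r s] b IR by (intro g) (simp add: regular_lmod_def M.smult_l_distr)
  next
    fix a r assume "a \<in> carrier R" "r \<in> carrier (regular_lmod R\<lparr>carrier := I\<rparr>)"
    then show "g (a \<odot>\<^bsub>regular_lmod R\<lparr>carrier := I\<rparr>\<^esub> r) = a \<odot>\<^bsub>N\<^esub> g r"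
      using H(5)[OF _ gH, of a r] b IR by (intro g) (simp add: regular_lmod_def M.smult_assoc1)
  qed (use H(2) gH in auto)
  ultimately obtain d where d: "d \<in> carrier N" "\<And>r. r \<in> I \<Longrightarrow> g r = r \<odot>\<^bsub>N\<^esub> d"
    by (rule baerE[OF assms(3)]) blast
  define H' where "H' = {(x \<oplus>\<^bsub>M\<^esub> r \<odot>\<^bsub>M\<^esub> b, y \<oplus>\<^bsub>N\<^esub> r \<odot>\<^bsub>N\<^esub> d) | x y r. (x, y) \<in> H \<and> r \<in> carrier R}"
  have H'I: "(x \<oplus>\<^bsub>M\<^esub> r \<odot>\<^bsub>M\<^esub> b, y \<oplus>\<^bsub>N\<^esub> r \<odot>\<^bsub>N\<^esub> d) \<in> H'" if "(x, y) \<in> H" "r \<in> carrier R" for x y r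
    using that by (auto simp: H'_def)
  have H'E: "\<exists>x y r. u = x \<oplus>\<^bsub>M\<^esub> r \<odot>\<^bsub>M\<^esub> b \<and> v = y \<oplus>\<^bsub>N\<^esub> r \<odot>\<^bsub>N\<^esub> d \<and> (x, y) \<in> H \<and> r \<in> carrier R
      \<and> x \<in> carrier M \<and> y \<in> carrier N" if "(u, v) \<in> H'" for u v
  proof -
    from that obtain x y r where "(u, v) = (x \<oplus>\<^bsub>M\<^esub> r \<odot>\<^bsub>M\<^esub> b, y \<oplus>\<^bsub>N\<^esub> r \<odot>\<^bsub>N\<^esub> d)"
      "(x, y) \<in> H" "r \<in> carrier R" unfolding H'_def by blast
    moreover from this(2) H(1,2) have "x \<in> carrier M" "y \<in> carrier N" by blast+
    ultimately show ?thesis by blast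
  qed
  have sub: "H \<subseteq> H'"
  proof safe
    fix x y assume "(x, y) \<in> H"
    with H'I[OF this M.R.zero_closed] H(1,2) b d show "(x, y) \<in> H'" by simp
  qed
  have "linear_graph R M N H'"
  proof (rule linear_graphI[OF assms(1,2)])
    fix u v assume "(u, v) \<in> H'"
    with H'E b d show "u \<in> carrier M \<and> v \<in> carrier N" by fastforce
  next
    show "(\<zero>\<^bsub>M\<^esub>, \<zero>\<^bsub>N\<^esub>) \<in> H'" using sub H(3) by auto
  next
    fix u v u' v' assume "(u, v) \<in> H'" "(u', v') \<in> H'"
    then obtain x y r x' y' r' where *:
      "u = x \<oplus>\<^bsub>M\<^esub> r \<odot>\<^bsub>M\<^esub> b" "v = y \<oplus>\<^bsub>N\<^esub> r \<odot>\<^bsub>N\<^esub> d" "(x, y) \<in> H" "r \<in> carrier R" "x \<in> carrier M" "y \<in> carrier N"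
      "u' = x' \<oplus>\<^bsub>M\<^esub> r' \<odot>\<^bsub>M\<^esub> b" "v' = y' \<oplus>\<^bsub>N\<^esub> r' \<odot>\<^bsub>N\<^esub> d" "(x', y') \<in> H" "r' \<in> carrier R" "x' \<in> carrier M" "y' \<in> carrier N"
      using H'E by meson
    have "u \<oplus>\<^bsub>M\<^esub> u' = (x \<oplus>\<^bsub>M\<^esub> x') \<oplus>\<^bsub>M\<^esub> (r \<oplus>\<^bsub>R\<^esub> r') \<odot>\<^bsub>M\<^esub> b"
      "v \<oplus>\<^bsub>N\<^esub> v' = (y \<oplus>\<^bsub>N\<^esub> y') \<oplus>\<^bsub>N\<^esub> (r \<oplus>\<^bsub>R\<^esub> r') \<odot>\<^bsub>N\<^esub> d"
      using * b d by (simp_all add: M.smult_l_distr N.smult_l_distr M.M.a_ac N.M.a_ac)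
    then show "(u \<oplus>\<^bsub>M\<^esub> u', v \<oplus>\<^bsub>N\<^esub> v') \<in> H'"
      using H'I[OF H(4), of x y x' y' "r \<oplus>\<^bsub>R\<^esub> r'"] * by simp
  next
    fix a u v assume a: "a \<in> carrier R" and "(u, v) \<in> H'"
    then obtain x y r where *:
      "u = x \<oplus>\<^bsub>M\<^esub> r \<odot>\<^bsub>M\<^esub> b" "v = y \<oplus>\<^bsub>N\<^esub> r \<odot>\<^bsub>N\<^esub> d" "(x, y) \<in> H" "r \<in> carrier R" "x \<in> carrier M" "y \<in> carrier N"
      using H'E by meson
    then show "(a \<odot>\<^bsub>M\<^esub> u, a \<odot>\<^bsub>N\<^esub> v) \<in> H'"
      using H'I[OF H(5), of a x y "a \<otimes>\<^bsub>R\<^esub> r"] a b d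
      by (simp add: M.smult_r_distr N.smult_r_distr M.smult_assoc1 N.smult_assoc1)
  next
    fix v assume "(\<zero>\<^bsub>M\<^esub>, v) \<in> H'"
    then obtain x y r where *:
      "\<zero>\<^bsub>M\<^esub> = x \<oplus>\<^bsub>M\<^esub> r \<odot>\<^bsub>M\<^esub> b" "v = y \<oplus>\<^bsub>N\<^esub> r \<odot>\<^bsub>N\<^esub> d" "(x, y) \<in> H" "r \<in> carrier R" "x \<in> carrier M" "y \<in> carrier N"
      using H'E by meson
    \<comment> \<open>\<open>r \<odot> b = - x\<close> lies in the domain of \<open>H\<close>, where \<open>g\<close> is prescribed.\<close>
    have rb: "r \<odot>\<^bsub>M\<^esub> b = \<ominus>\<^bsub>M\<^esub> x"
      using * b M.M.minus_equality[of "r \<odot>\<^bsub>M\<^esub> b" x] by (simp add: M.M.a_comm)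
    have "(\<ominus>\<^bsub>M\<^esub> x, \<ominus>\<^bsub>N\<^esub> y) \<in> H"
      using H(5)[OF _ *(3), of "\<ominus>\<^bsub>R\<^esub> \<one>\<^bsub>R\<^esub>"] * by (simp add: M.smult_minus_one N.smult_minus_one)
    then have "r \<in> I" "g r = \<ominus>\<^bsub>N\<^esub> y" using rb *(4) g by (auto simp: I_def)
    then have "r \<odot>\<^bsub>N\<^esub> d = \<ominus>\<^bsub>N\<^esub> y" using d(2) by simp
    then show "v = \<zero>\<^bsub>N\<^esub>" using * by (simp add: N.M.r_neg)
  qed
  moreover have "(b, d) \<in> H'" using H'I[OF H(3) M.R.one_closed] b d by simp
  ultimately show thesis using that sub by blast
qed

text \<open>
  A maximal graph is total, since otherwise one more element could be added to its domain.
\<close>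

lemma linear_graph_extends:
  assumes "left_module R M" "left_module R N" "baer R N" "linear_graph R M N G"
  obtains h where "h \<in> lmod_hom R M N" "\<And>x y. (x, y) \<in> G \<Longrightarrow> h x = y"
proof -
  let ?A = "{H. linear_graph R M N H \<and> G \<subseteq> H}"
  have "\<exists>H\<in>?A. \<forall>X\<in>?A. H \<subseteq> X \<longrightarrow> X = H"
  proof (rule subset_Zorn_nonempty)
    show "?A \<noteq> {}" using assms by auto
  next
    fix C assume C: "C \<noteq> {}" "subset.chain ?A C"
    then have CA: "\<And>H. H \<in> C \<Longrightarrow> linear_graph R M N H \<and> G \<subseteq> H" and
      ch: "\<And>H H'. \<lbrakk>H \<in> C; H' \<in> C\<rbrakk> \<Longrightarrow> H \<subseteq> H' \<or> H' \<subseteq> H"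
      by (auto simp: subset_chain_def)
    have "linear_graph R M N (\<Union>C)"
    proof (rule linear_graphI[OF assms(1,2)])
      fix x y assume "(x, y) \<in> \<Union>C"
      then obtain H where "H \<in> C" "(x, y) \<in> H" by blast
      then show "x \<in> carrier M \<and> y \<in> carrier N" using CA[of H] linear_graphD(1,2)[of R M N H] by blast
    next
      obtain H where "H \<in> C" using C(1) by blast
      then show "(\<zero>\<^bsub>M\<^esub>, \<zero>\<^bsub>N\<^esub>) \<in> \<Union>C" using CA[of H] linear_graphD(3)[of R M N H] by blast
    next
      fix x y x' y' assume "(x, y) \<in> \<Union>C" "(x', y') \<in> \<Union>C"
      then obtain H where "H \<in> C" "(x, y) \<in> H" "(x', y') \<in> H" using ch by blast
      then show "(x \<oplus>\<^bsub>M\<^esub> x', y \<oplus>\<^bsub>N\<^esub> y') \<in> \<Union>C"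
        using CA[of H] linear_graphD(4)[of R M N H x y x' y'] by blast
    next
      fix r x y assume "r \<in> carrier R" "(x, y) \<in> \<Union>C"
      then obtain H where "H \<in> C" "(r \<odot>\<^bsub>M\<^esub> x, r \<odot>\<^bsub>N\<^esub> y) \<in> H"
        using CA linear_graphD(5)[of R M N _ r x y] by (meson UnionE)
      then show "(r \<odot>\<^bsub>M\<^esub> x, r \<odot>\<^bsub>N\<^esub> y) \<in> \<Union>C" by blast
    next
      fix y assume "(\<zero>\<^bsub>M\<^esub>, y) \<in> \<Union>C"
      then obtain H where "H \<in> C" "(\<zero>\<^bsub>M\<^esub>, y) \<in> H" by blast
      then show "y = \<zero>\<^bsub>N\<^esub>" using CA[of H] linear_graphD(6)[of R M N H y] by blast
    qed
    then show "\<Union>C \<in> ?A" using C(1) CA by blast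
  qed
  then obtain H where H: "linear_graph R M N H" "G \<subseteq> H"
    and "\<forall>X\<in>?A. H \<subseteq> X \<longrightarrow> X = H" by auto
  then have max: "X = H" if "linear_graph R M N X" "H \<subseteq> X" for X
    using that by (metis (mono_tags, lifting) mem_Collect_eq order_trans)
  have total: "\<exists>q. (b, q) \<in> H" if "b \<in> carrier M" for b
    using linear_graph_add_element[OF assms(1-3) H(1) that] max by metis
  define h where "h b = (THE q. (b, q) \<in> H)" for b
  have h: "h b = q" if "(b, q) \<in> H" for b q
    unfolding h_def using that linear_graph_unique[OF assms(1,2) H(1)] by blast
  have hH: "(b, h b) \<in> H" if "b \<in> carrier M" for b using total[OF that] h by auto
  note HD = linear_graphD[OF H(1)]
  have "h \<in> lmod_hom R M N"
    by (rule lmod_homI) (blast intro: HD hH h)+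
  then show thesis using that h H(2) by blast
qed

lemma baer_imp_injective:
  assumes "left_module R N" "baer R N"
  shows "injective_lmod TYPE('u) R N"
  unfolding injective_lmod_def
proof (intro conjI allI impI)
  fix A B :: "('a, 'u) module" and i g
  assume A: "left_module R A" and B: "left_module R B" and i: "i \<in> lmod_hom R A B"
    and inj: "inj_on i (carrier A)" and g: "g \<in> lmod_hom R A N"
  interpret A: left_module R A by fact
  note iD = lmod_homD[OF i] and gD = lmod_homD[OF g]
  have i0: "i \<zero>\<^bsub>A\<^esub> = \<zero>\<^bsub>B\<^esub>" and g0: "g \<zero>\<^bsub>A\<^esub> = \<zero>\<^bsub>N\<^esub>"
    using lmod_hom_zero A B assms i g by blast+
  let ?G = "(\<lambda>x. (i x, g x)) ` carrier A"
  have "linear_graph R B N ?G"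
  proof (rule linear_graphI[OF B assms(1)])
    show "(\<zero>\<^bsub>B\<^esub>, \<zero>\<^bsub>N\<^esub>) \<in> ?G" using i0 g0 by (intro image_eqI[of _ _ "\<zero>\<^bsub>A\<^esub>"]) auto
  next
    fix x y x' y' assume "(x, y) \<in> ?G" "(x', y') \<in> ?G"
    then obtain a a' where "a \<in> carrier A" "a' \<in> carrier A" "x = i a" "y = g a" "x' = i a'" "y' = g a'" by auto
    then show "(x \<oplus>\<^bsub>B\<^esub> x', y \<oplus>\<^bsub>N\<^esub> y') \<in> ?G" by (intro image_eqI[of _ _ "a \<oplus>\<^bsub>A\<^esub> a'"]) (simp_all add: iD gD)
  next
    fix r x y assume r: "r \<in> carrier R" and "(x, y) \<in> ?G"
    then obtain a where "a \<in> carrier A" "x = i a" "y = g a" by auto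
    then show "(r \<odot>\<^bsub>B\<^esub> x, r \<odot>\<^bsub>N\<^esub> y) \<in> ?G" using r by (intro image_eqI[of _ _ "r \<odot>\<^bsub>A\<^esub> a"]) (simp_all add: iD gD)
  next
    fix y assume "(\<zero>\<^bsub>B\<^esub>, y) \<in> ?G"
    then obtain a where "a \<in> carrier A" "i a = i \<zero>\<^bsub>A\<^esub>" "y = g a" using i0 by auto
    then show "y = \<zero>\<^bsub>N\<^esub>" using inj g0 by (auto dest: inj_onD)
  qed (auto simp: iD gD)
  then obtain h where "h \<in> lmod_hom R B N" "\<And>x y. (x, y) \<in> ?G \<Longrightarrow> h x = y"
    using linear_graph_extends[OF B assms] by blast
  then show "\<exists>h\<in>lmod_hom R B N. \<forall>x\<in>carrier A. h (i x) = g x" by blast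
qed (rule assms)

text \<open>
  The assignment \<open>r m \<mapsto> r n\<close> is well defined on the cyclic submodule generated by \<open>m\<close>, and it
  extends. A comparison of annihilators is thus all that is needed to map \<open>m\<close> to \<open>n\<close>.
\<close>

lemma baer_hom_through:
  assumes "left_module R M" "left_module R N" "baer R N" "m \<in> carrier M" "n \<in> carrier N"
    and ann: "\<And>r. \<lbrakk>r \<in> carrier R; r \<odot>\<^bsub>M\<^esub> m = \<zero>\<^bsub>M\<^esub>\<rbrakk> \<Longrightarrow> r \<odot>\<^bsub>N\<^esub> n = \<zero>\<^bsub>N\<^esub>"
  obtains h where "h \<in> lmod_hom R M N" "h m = n"
proof -
  interpret M: left_module R M by fact
  interpret N: left_module R N by fact
  let ?G = "(\<lambda>r. (r \<odot>\<^bsub>M\<^esub> m, r \<odot>\<^bsub>N\<^esub> n)) ` carrier R"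
  have "linear_graph R M N ?G"
  proof (rule linear_graphI[OF assms(1,2)])
    show "(\<zero>\<^bsub>M\<^esub>, \<zero>\<^bsub>N\<^esub>) \<in> ?G" using assms by (intro image_eqI[of _ _ "\<zero>\<^bsub>R\<^esub>"]) auto
  next
    fix x y x' y' assume "(x, y) \<in> ?G" "(x', y') \<in> ?G"
    then obtain a a' where "a \<in> carrier R" "a' \<in> carrier R" "x = a \<odot>\<^bsub>M\<^esub> m" "y = a \<odot>\<^bsub>N\<^esub> n" "x' = a' \<odot>\<^bsub>M\<^esub> m" "y' = a' \<odot>\<^bsub>N\<^esub> n" by auto
    then show "(x \<oplus>\<^bsub>M\<^esub> x', y \<oplus>\<^bsub>N\<^esub> y') \<in> ?G" using assms
      by (intro image_eqI[of _ _ "a \<oplus>\<^bsub>R\<^esub> a'"]) (simp_all add: M.smult_l_distr N.smult_l_distr)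
  next
    fix r x y assume r: "r \<in> carrier R" and "(x, y) \<in> ?G"
    then obtain a where "a \<in> carrier R" "x = a \<odot>\<^bsub>M\<^esub> m" "y = a \<odot>\<^bsub>N\<^esub> n" by auto
    then show "(r \<odot>\<^bsub>M\<^esub> x, r \<odot>\<^bsub>N\<^esub> y) \<in> ?G" using r assms
      by (intro image_eqI[of _ _ "r \<otimes>\<^bsub>R\<^esub> a"]) (simp_all add: M.smult_assoc1 N.smult_assoc1)
  next
    fix y assume "(\<zero>\<^bsub>M\<^esub>, y) \<in> ?G"
    then obtain a where "a \<in> carrier R" "\<zero>\<^bsub>M\<^esub> = a \<odot>\<^bsub>M\<^esub> m" "y = a \<odot>\<^bsub>N\<^esub> n" by auto
    then show "y = \<zero>\<^bsub>N\<^esub>" using ann[of a] by simp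
  qed (use assms in auto)
  then obtain h where h: "h \<in> lmod_hom R M N" "\<And>x y. (x, y) \<in> ?G \<Longrightarrow> h x = y"
    using linear_graph_extends[OF assms(1-3)] by blast
  have "(m, n) \<in> ?G" using assms by (intro image_eqI[of _ _ "\<one>\<^bsub>R\<^esub>"]) auto
  then show thesis using that h by blast
qed

text \<open>
  The two coordinates of a homomorphism into the sum are represented separately.
\<close>

lemma baer_sum2:
  assumes "baer R M" "baer R N"
  shows "baer R (sum2_lmod M N)"
  unfolding baer_def
proof (intro allI impI)
  fix I g
  let ?I = "regular_lmod R\<lparr>carrier := I\<rparr>"
  assume I: "submodule I R (regular_lmod R)" and g: "g \<in> lmod_hom R ?I (sum2_lmod M N)"
  have "(\<lambda>r. fst (g r)) \<in> lmod_hom R ?I M" "(\<lambda>r. snd (g r)) \<in> lmod_hom R ?I N"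
    using lmod_homD[OF g] by (auto intro!: lmod_homI simp: sum2_lmod_def split_beta mem_Times_iff)
  with assms I obtain d e where "d \<in> carrier M" "\<forall>r\<in>I. fst (g r) = r \<odot>\<^bsub>M\<^esub> d"
      "e \<in> carrier N" "\<forall>r\<in>I. snd (g r) = r \<odot>\<^bsub>N\<^esub> e"
    unfolding baer_def by blast
  then show "\<exists>d\<in>carrier (sum2_lmod M N). \<forall>r\<in>I. g r = r \<odot>\<^bsub>sum2_lmod M N\<^esub> d"
    by (intro bexI[of _ "(d, e)"]) (auto simp: sum2_lmod_def prod_eq_iff)
qed

section \<open>Quotient modules\<close>

lemma submodule_abelian_subgroup:
  assumes "left_module R M" "submodule N R M"
  shows "abelian_subgroup N M"
  using assms by (intro abelian_subgroupI3 additive_subgroup.intro)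
    (auto intro: submodule.axioms left_module.axioms)

lemma quot_lmod_carrier: "carrier (quot_lmod M N) = (\<lambda>x. N +>\<^bsub>M\<^esub> x) ` carrier M"
  by (auto simp: quot_lmod_def A_RCOSETS_def')

lemma quot_lmod_add:
  assumes "left_module R M" "submodule N R M" "x \<in> carrier M" "y \<in> carrier M"
  shows "(N +>\<^bsub>M\<^esub> x) \<oplus>\<^bsub>quot_lmod M N\<^esub> (N +>\<^bsub>M\<^esub> y) = N +>\<^bsub>M\<^esub> (x \<oplus>\<^bsub>M\<^esub> y)"
  using abelian_subgroup.a_rcos_sum[OF submodule_abelian_subgroup[OF assms(1,2)] assms(3,4)]
  by (simp add: quot_lmod_def)

lemma coset_eq_iff:
  assumes "left_module R M" "submodule N R M" "x \<in> carrier M" "y \<in> carrier M"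
  shows "N +>\<^bsub>M\<^esub> x = N +>\<^bsub>M\<^esub> y \<longleftrightarrow> x \<ominus>\<^bsub>M\<^esub> y \<in> N"
proof -
  interpret abelian_subgroup N M by (rule submodule_abelian_subgroup[OF assms(1,2)])
  have "x \<ominus>\<^bsub>M\<^esub> y \<in> N \<longleftrightarrow> x \<in> N +>\<^bsub>M\<^esub> y"
    using a_rcos_module[of y x] assms by (simp add: a_minus_def)
  also have "\<dots> \<longleftrightarrow> N +>\<^bsub>M\<^esub> x = N +>\<^bsub>M\<^esub> y"
    using a_repr_independence'[of x y] a_repr_independenceD[of x y] assms a_rcos_self[of x] by blast
  finally show ?thesis by simp
qed

lemma quot_lmod_smult:
  assumes "left_module R M" "submodule N R M" "x \<in> carrier M" "r \<in> carrier R"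
  shows "r \<odot>\<^bsub>quot_lmod M N\<^esub> (N +>\<^bsub>M\<^esub> x) = N +>\<^bsub>M\<^esub> (r \<odot>\<^bsub>M\<^esub> x)"
proof -
  interpret M: left_module R M by fact
  interpret abelian_subgroup N M by (rule submodule_abelian_subgroup[OF assms(1,2)])
  have "N +>\<^bsub>M\<^esub> (r \<odot>\<^bsub>M\<^esub> z) = N +>\<^bsub>M\<^esub> (r \<odot>\<^bsub>M\<^esub> x)" if "z \<in> N +>\<^bsub>M\<^esub> x" for z
  proof -
    obtain n where n: "n \<in> N" "z = n \<oplus>\<^bsub>M\<^esub> x" using \<open>z \<in> N +>\<^bsub>M\<^esub> x\<close> by (auto simp: a_r_coset_def')
    have nc: "n \<in> carrier M" using n a_subset by auto
    have "r \<odot>\<^bsub>M\<^esub> z = r \<odot>\<^bsub>M\<^esub> n \<oplus>\<^bsub>M\<^esub> r \<odot>\<^bsub>M\<^esub> x" using n nc assms by (simp add: M.smult_r_distr)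
    moreover have "r \<odot>\<^bsub>M\<^esub> n \<in> N" using submodule.smult_closed[OF assms(2)] n assms by blast
    ultimately have "r \<odot>\<^bsub>M\<^esub> z \<in> N +>\<^bsub>M\<^esub> (r \<odot>\<^bsub>M\<^esub> x)" by (auto simp: a_r_coset_def')
    then show ?thesis using a_repr_independence'[of "r \<odot>\<^bsub>M\<^esub> z" "r \<odot>\<^bsub>M\<^esub> x"] assms M.smult_closed by auto
  qed
  moreover have "x \<in> N +>\<^bsub>M\<^esub> x" using a_rcos_self assms by blast
  ultimately have "(\<Union>z\<in>N +>\<^bsub>M\<^esub> x. N +>\<^bsub>M\<^esub> (r \<odot>\<^bsub>M\<^esub> z)) = N +>\<^bsub>M\<^esub> (r \<odot>\<^bsub>M\<^esub> x)"
    by (intro SUP_eq_const) blast+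
  then show ?thesis by (simp add: quot_lmod_def)
qed

lemma left_module_quot:
  assumes "left_module R M" "submodule N R M"
  shows "left_module R (quot_lmod M N)"
proof -
  interpret M: left_module R M by fact
  note simps = quot_lmod_add[OF assms] quot_lmod_smult[OF assms]
  have z: "\<zero>\<^bsub>quot_lmod M N\<^esub> = N +>\<^bsub>M\<^esub> \<zero>\<^bsub>M\<^esub>"
    using abelian_subgroup.a_coset_eq[OF submodule_abelian_subgroup[OF assms]]
      M.M.a_coset_add_zero[of N] subgroup.subset[OF submodule.axioms(1)[OF assms(2)]]
    by (simp add: quot_lmod_def)
  let ?Q = "quot_lmod M N"
  show ?thesis
  proof (rule left_moduleI[OF M.R.ring_axioms], unfold z quot_lmod_carrier)
    show "N +>\<^bsub>M\<^esub> \<zero>\<^bsub>M\<^esub> \<in> (+>\<^bsub>M\<^esub>) N ` carrier M" by blast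
  next
    fix u v assume "u \<in> (+>\<^bsub>M\<^esub>) N ` carrier M" "v \<in> (+>\<^bsub>M\<^esub>) N ` carrier M"
    then obtain x y where *: "u = N +>\<^bsub>M\<^esub> x" "v = N +>\<^bsub>M\<^esub> y" "x \<in> carrier M" "y \<in> carrier M" by blast
    then show "u \<oplus>\<^bsub>?Q\<^esub> v \<in> (+>\<^bsub>M\<^esub>) N ` carrier M"
      "u \<oplus>\<^bsub>?Q\<^esub> v = v \<oplus>\<^bsub>?Q\<^esub> u" by (simp_all add: simps M.M.a_comm)
    fix a assume "a \<in> carrier R"
    with * show "a \<odot>\<^bsub>?Q\<^esub> (u \<oplus>\<^bsub>?Q\<^esub> v)
      = a \<odot>\<^bsub>?Q\<^esub> u \<oplus>\<^bsub>?Q\<^esub> a \<odot>\<^bsub>?Q\<^esub> v" by (simp add: simps M.smult_r_distr)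
  next
    fix u v w assume "u \<in> (+>\<^bsub>M\<^esub>) N ` carrier M" "v \<in> (+>\<^bsub>M\<^esub>) N ` carrier M"
      "w \<in> (+>\<^bsub>M\<^esub>) N ` carrier M"
    then obtain x y t where "u = N +>\<^bsub>M\<^esub> x" "v = N +>\<^bsub>M\<^esub> y" "w = N +>\<^bsub>M\<^esub> t"
      "x \<in> carrier M" "y \<in> carrier M" "t \<in> carrier M" by blast
    then show "u \<oplus>\<^bsub>?Q\<^esub> v \<oplus>\<^bsub>?Q\<^esub> w = u \<oplus>\<^bsub>?Q\<^esub> (v \<oplus>\<^bsub>?Q\<^esub> w)"
      by (simp add: simps M.M.a_assoc)
  next
    fix u assume "u \<in> (+>\<^bsub>M\<^esub>) N ` carrier M"
    then obtain x where *: "u = N +>\<^bsub>M\<^esub> x" "x \<in> carrier M" by blast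
    then show "(N +>\<^bsub>M\<^esub> \<zero>\<^bsub>M\<^esub>) \<oplus>\<^bsub>?Q\<^esub> u = u" "\<one>\<^bsub>R\<^esub> \<odot>\<^bsub>?Q\<^esub> u = u"
      "\<zero>\<^bsub>R\<^esub> \<odot>\<^bsub>?Q\<^esub> u = N +>\<^bsub>M\<^esub> \<zero>\<^bsub>M\<^esub>" by (simp_all add: simps)
    fix a b assume "a \<in> carrier R" "b \<in> carrier R"
    with * show "a \<odot>\<^bsub>?Q\<^esub> u \<in> (+>\<^bsub>M\<^esub>) N ` carrier M"
      "(a \<oplus>\<^bsub>R\<^esub> b) \<odot>\<^bsub>?Q\<^esub> u = a \<odot>\<^bsub>?Q\<^esub> u \<oplus>\<^bsub>?Q\<^esub> b \<odot>\<^bsub>?Q\<^esub> u"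
      "(a \<otimes>\<^bsub>R\<^esub> b) \<odot>\<^bsub>?Q\<^esub> u = a \<odot>\<^bsub>?Q\<^esub> (b \<odot>\<^bsub>?Q\<^esub> u)"
      by (simp_all add: simps M.smult_l_distr M.smult_assoc1)
  qed
qed

lemma left_ideal_submodule:
  assumes "ring R" "a \<in> carrier R"
  shows "submodule (PIdl\<^bsub>R\<^esub> a) R (regular_lmod R)"
proof -
  interpret R: ring R by fact
  show ?thesis
  proof (rule left_module.submoduleI[OF left_module_regular[OF assms(1)]])
    show "\<zero>\<^bsub>regular_lmod R\<^esub> \<in> PIdl\<^bsub>R\<^esub> a"
      using assms by (auto simp: regular_lmod_def cgenideal_def intro!: exI[of _ "\<zero>\<^bsub>R\<^esub>"])
  next
    fix x y assume "x \<in> PIdl\<^bsub>R\<^esub> a" "y \<in> PIdl\<^bsub>R\<^esub> a"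
    then obtain r s where "x = r \<otimes>\<^bsub>R\<^esub> a" "y = s \<otimes>\<^bsub>R\<^esub> a" "r \<in> carrier R" "s \<in> carrier R"
      by (auto simp: cgenideal_def)
    then show "x \<oplus>\<^bsub>regular_lmod R\<^esub> y \<in> PIdl\<^bsub>R\<^esub> a"
      using assms by (auto simp: regular_lmod_def cgenideal_def R.l_distr intro!: exI[of _ "r \<oplus>\<^bsub>R\<^esub> s"])
  next
    fix r x assume "r \<in> carrier R" "x \<in> PIdl\<^bsub>R\<^esub> a"
    then show "r \<odot>\<^bsub>regular_lmod R\<^esub> x \<in> PIdl\<^bsub>R\<^esub> a"
      using assms by (auto simp: regular_lmod_def cgenideal_def) (metis R.m_assoc R.m_closed)
  qed (use assms in \<open>auto simp: regular_lmod_def cgenideal_def\<close>)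
qed

lemma zero_submodule: "left_module R M \<Longrightarrow> submodule {\<zero>\<^bsub>M\<^esub>} R M"
proof -
  assume "left_module R M"
  then interpret M: left_module R M .
  show ?thesis by (rule M.submoduleI) auto
qed

text \<open>
  A test module isomorphic to \<open>R\<close> is needed whose carrier type is \<open>'r set\<close>. The quotient
  \<open>R/0\<close> serves: its elements are the singletons.
\<close>

lemma injective_imp_baer:
  fixes R :: "('r, 's) ring_scheme"
  assumes "injective_lmod TYPE('r set) R E"
  shows "baer R E"
  unfolding baer_def
proof (intro allI impI)
  fix I g
  assume I: "submodule I R (regular_lmod R)" and g: "g \<in> lmod_hom R (regular_lmod R\<lparr>carrier := I\<rparr>) E"
  have E: "left_module R E" using assms by (simp add: injective_lmod_def)
  interpret E: left_module R E by fact
  let ?B = "quot_lmod (regular_lmod R) {\<zero>\<^bsub>regular_lmod R\<^esub>}"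
  let ?A = "?B\<lparr>carrier := (\<lambda>r. {r}) ` I\<rparr>"
  have reg: "left_module R (regular_lmod R)" by (rule left_module_regular[OF E.R.ring_axioms])
  note z = zero_submodule[OF reg]
  have sub: "r \<in> carrier R" if "r \<in> I" for r
    using subgroup.subset[OF submodule.axioms(1)[OF I]] that by (auto simp: regular_lmod_def)
  have sing: "{\<zero>\<^bsub>regular_lmod R\<^esub>} +>\<^bsub>regular_lmod R\<^esub> r = {r}" if "r \<in> carrier R" for r
    using that by (simp add: a_r_coset_def' regular_lmod_def)
  have carr: "carrier ?B = (\<lambda>r. {r}) ` carrier R"
    unfolding quot_lmod_carrier using sing by (auto simp: regular_lmod_def)
  have add: "{r} \<oplus>\<^bsub>?B\<^esub> {s} = {r \<oplus>\<^bsub>R\<^esub> s}" if "r \<in> carrier R" "s \<in> carrier R" for r s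
    using quot_lmod_add[OF reg z, of r s] that sing by (simp add: regular_lmod_def)
  have smult: "r \<odot>\<^bsub>?B\<^esub> {s} = {r \<otimes>\<^bsub>R\<^esub> s}" if "r \<in> carrier R" "s \<in> carrier R" for r s
    using quot_lmod_smult[OF reg z, of s r] that sing by (simp add: regular_lmod_def)
  have zero: "\<zero>\<^bsub>?B\<^esub> = {\<zero>\<^bsub>R\<^esub>}" by (simp add: quot_lmod_def regular_lmod_def)
  have B: "left_module R ?B" by (rule left_module_quot[OF reg z])
  have Icl: "\<zero>\<^bsub>R\<^esub> \<in> I" "\<And>r s. \<lbrakk>r \<in> I; s \<in> I\<rbrakk> \<Longrightarrow> r \<oplus>\<^bsub>R\<^esub> s \<in> I"
      "\<And>r s. \<lbrakk>r \<in> carrier R; s \<in> I\<rbrakk> \<Longrightarrow> r \<otimes>\<^bsub>R\<^esub> s \<in> I"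
    using subgroup.one_closed[OF submodule.axioms(1)[OF I]] subgroup.m_closed[OF submodule.axioms(1)[OF I]]
      submodule.smult_closed[OF I] by (simp_all add: regular_lmod_def)
  have gD: "\<And>r. r \<in> I \<Longrightarrow> g r \<in> carrier E"
    "\<And>r s. \<lbrakk>r \<in> I; s \<in> I\<rbrakk> \<Longrightarrow> g (r \<oplus>\<^bsub>R\<^esub> s) = g r \<oplus>\<^bsub>E\<^esub> g s"
    "\<And>r s. \<lbrakk>r \<in> carrier R; s \<in> I\<rbrakk> \<Longrightarrow> g (r \<otimes>\<^bsub>R\<^esub> s) = r \<odot>\<^bsub>E\<^esub> g s"
    using lmod_homD[OF g] by (auto simp: regular_lmod_def)
  have sA: "submodule ((\<lambda>r. {r}) ` I) R ?B"
    by (rule left_module.submoduleI[OF B]) (auto simp: carr add smult zero sub Icl)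
  have A: "left_module R ?A" by (rule left_module.submodule_restrict[OF B sA])
  have "(\<lambda>x. x) \<in> lmod_hom R ?A ?B"
    by (rule lmod_homI) (auto simp: carr sub)
  moreover have "(\<lambda>x. g (the_elem x)) \<in> lmod_hom R ?A E"
    using gD by (intro lmod_homI) (auto simp: add smult sub)
  ultimately obtain h where h: "h \<in> lmod_hom R ?B E" "\<forall>x\<in>carrier ?A. h x = g (the_elem x)"
    using assms[unfolded injective_lmod_def] A B inj_on_id2[of "carrier ?A"] by blast
  have "g r = r \<odot>\<^bsub>E\<^esub> h {\<one>\<^bsub>R\<^esub>}" if "r \<in> I" for r
    using lmod_homD(3)[OF h(1), of r "{\<one>\<^bsub>R\<^esub>}"] h(2) that sub by (auto simp: carr smult)
  moreover have "h {\<one>\<^bsub>R\<^esub>} \<in> carrier E" using lmod_homD(1)[OF h(1)] carr by auto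
  ultimately show "\<exists>d\<in>carrier E. \<forall>r\<in>I. g r = r \<odot>\<^bsub>E\<^esub> d" by blast
qed

section \<open>Direct limits\<close>

locale directed_system =
  fixes R :: "('r, 's) ring_scheme" and I :: "'i::linorder set"
    and M :: "'i \<Rightarrow> ('r, 'a, 'm) module_scheme" and \<psi> :: "'i \<Rightarrow> 'i \<Rightarrow> 'a \<Rightarrow> 'a"
  assumes nonempty: "I \<noteq> {}"
    and modules: "i \<in> I \<Longrightarrow> left_module R (M i)"
    and homs: "\<lbrakk>i \<in> I; j \<in> I; i \<le> j\<rbrakk> \<Longrightarrow> \<psi> i j \<in> lmod_hom R (M i) (M j)"
    and ident: "\<lbrakk>i \<in> I; x \<in> carrier (M i)\<rbrakk> \<Longrightarrow> \<psi> i i x = x"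
    and comp: "\<lbrakk>i \<in> I; j \<in> I; l \<in> I; i \<le> j; j \<le> l; x \<in> carrier (M i)\<rbrakk> \<Longrightarrow> \<psi> j l (\<psi> i j x) = \<psi> i l x"
begin

abbreviation "rel \<equiv> dirlim_rel I M \<psi>"
abbreviation "limit \<equiv> dirlim_lmod I M \<psi>"

definition incl :: "'i \<Rightarrow> 'a \<Rightarrow> ('i \<times> 'a) set"
  where "incl i x = rel `` {(i, x)}"

lemma rel_mono:
  assumes "i \<in> I" "j \<in> I" "l \<in> I" "l' \<in> I" "i \<le> l" "j \<le> l" "l \<le> l'"
    and "x \<in> carrier (M i)" "y \<in> carrier (M j)" "\<psi> i l x = \<psi> j l y"
  shows "\<psi> i l' x = \<psi> j l' y"
  using assms comp[of i l l' x] comp[of j l l' y] by simp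

lemma equiv_rel: "equiv (SIGMA i:I. carrier (M i)) rel"
proof (rule equivI)
  show "rel \<subseteq> (SIGMA i:I. carrier (M i)) \<times> (SIGMA i:I. carrier (M i))"
    by (auto simp: dirlim_rel_def)
  show "refl_on (SIGMA i:I. carrier (M i)) rel"
    by (auto simp: dirlim_rel_def refl_on_def)
  show "sym rel" by (auto simp: dirlim_rel_def sym_def)
  show "trans rel"
  proof (rule transI)
    fix p q r assume "(p, q) \<in> rel" "(q, r) \<in> rel"
    then obtain i x j y k z l l' where *: "p = (i, x)" "q = (j, y)" "r = (k, z)"
      "i \<in> I" "j \<in> I" "k \<in> I" "x \<in> carrier (M i)" "y \<in> carrier (M j)" "z \<in> carrier (M k)"
      "l \<in> I" "i \<le> l" "j \<le> l" "\<psi> i l x = \<psi> j l y" "l' \<in> I" "j \<le> l'" "k \<le> l'" "\<psi> j l' y = \<psi> k l' z"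
      by (auto simp: dirlim_rel_def)
    let ?m = "max l l'"
    have m: "?m \<in> I" using * by (simp add: max_def)
    have "\<psi> i ?m x = \<psi> j ?m y" using * m by (intro rel_mono[of i j l ?m]) auto
    also have "\<dots> = \<psi> k ?m z" using * m by (intro rel_mono[of j k l' ?m]) auto
    finally have "\<exists>l\<in>I. i \<le> l \<and> k \<le> l \<and> \<psi> i l x = \<psi> k l z"
      using * m by (intro bexI[of _ ?m]) (auto simp: le_max_iff_disj)
    with * show "(p, r) \<in> rel" by (simp add: dirlim_rel_def)
  qed
qed

lemma incl_eq_iff:
  assumes "i \<in> I" "j \<in> I" "x \<in> carrier (M i)" "y \<in> carrier (M j)"
  shows "incl i x = incl j y \<longleftrightarrow> (\<exists>l\<in>I. i \<le> l \<and> j \<le> l \<and> \<psi> i l x = \<psi> j l y)"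
  unfolding incl_def using eq_equiv_class_iff[OF equiv_rel, of "(i, x)" "(j, y)"] assms
  by (simp add: dirlim_rel_def)

lemma psi_closed: "\<lbrakk>i \<in> I; j \<in> I; i \<le> j; x \<in> carrier (M i)\<rbrakk> \<Longrightarrow> \<psi> i j x \<in> carrier (M j)"
  by (rule lmod_homD(1)[OF homs])

lemma incl_psi:
  assumes "i \<in> I" "j \<in> I" "i \<le> j" "x \<in> carrier (M i)"
  shows "incl j (\<psi> i j x) = incl i x"
  using assms psi_closed by (subst incl_eq_iff) (auto simp: ident intro!: bexI[of _ j])

lemma limit_carrier: "carrier limit = {incl i x | i x. i \<in> I \<and> x \<in> carrier (M i)}"
  by (auto simp: dirlim_lmod_def quotient_def incl_def)

lemma incl_closed: "\<lbrakk>i \<in> I; x \<in> carrier (M i)\<rbrakk> \<Longrightarrow> incl i x \<in> carrier limit"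
  by (auto simp: limit_carrier)

lemma incl_zero:
  assumes "i \<in> I" shows "incl i \<zero>\<^bsub>M i\<^esub> = \<zero>\<^bsub>limit\<^esub>"
proof -
  have z: "\<psi> i j \<zero>\<^bsub>M i\<^esub> = \<zero>\<^bsub>M j\<^esub>" if "i \<in> I" "j \<in> I" "i \<le> j" for i j
    using lmod_hom_zero[OF modules modules homs] that by blast
  have zc: "\<zero>\<^bsub>M i\<^esub> \<in> carrier (M i)" if "i \<in> I" for i
    using abelian_monoid.zero_closed[OF abelian_group.axioms(1)[OF left_module.axioms(2)[OF modules[OF that]]]] .
  have "incl i \<zero>\<^bsub>M i\<^esub> = {(j, x). j \<in> I \<and> x \<in> carrier (M j) \<and> (\<exists>l\<in>I. j \<le> l \<and> \<psi> j l x = \<zero>\<^bsub>M l\<^esub>)}"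
    (is "_ = ?Z")
  proof (intro equalityI subsetI)
    fix p assume "p \<in> incl i \<zero>\<^bsub>M i\<^esub>"
    then show "p \<in> ?Z" using assms z by (auto simp: incl_def dirlim_rel_def)
  next
    fix p assume "p \<in> ?Z"
    then obtain j x l where p: "p = (j, x)" "j \<in> I" "x \<in> carrier (M j)" "l \<in> I" "j \<le> l" "\<psi> j l x = \<zero>\<^bsub>M l\<^esub>" by auto
    let ?m = "max l i"
    have m: "?m \<in> I" using p assms by (simp add: max_def)
    have "\<psi> j ?m x = \<psi> l ?m (\<psi> j l x)" using p m by (intro comp[symmetric]) auto
    also have "\<dots> = \<psi> i ?m \<zero>\<^bsub>M i\<^esub>" using p m z assms by simp
    finally show "p \<in> ?Z \<Longrightarrow> p \<in> incl i \<zero>\<^bsub>M i\<^esub>"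
      using p m assms zc by (auto simp: incl_def dirlim_rel_def le_max_iff_disj intro!: bexI[of _ ?m])
  qed
  then show ?thesis by (simp add: dirlim_lmod_def)
qed

text \<open>
  The sum of two classes may be formed at any common upper bound of the two indices, so that it
  does not depend on the representatives.
\<close>

lemma add_at:
  assumes "i \<in> I" "j \<in> I" "l \<in> I" "i \<le> l" "j \<le> l" "x \<in> carrier (M i)" "y \<in> carrier (M j)"
  shows "incl (max i j) (\<psi> i (max i j) x \<oplus>\<^bsub>M (max i j)\<^esub> \<psi> j (max i j) y)
    = incl l (\<psi> i l x \<oplus>\<^bsub>M l\<^esub> \<psi> j l y)"
proof -
  let ?m = "max i j"
  have m: "?m \<in> I" "?m \<le> l" using assms by (auto simp: max_def)
  have c: "\<psi> i ?m x \<in> carrier (M ?m)" "\<psi> j ?m y \<in> carrier (M ?m)"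
    using assms m by (auto intro!: psi_closed)
  interpret Mm: left_module R "M ?m" by (rule modules[OF m(1)])
  have "incl ?m (\<psi> i ?m x \<oplus>\<^bsub>M ?m\<^esub> \<psi> j ?m y) = incl l (\<psi> ?m l (\<psi> i ?m x \<oplus>\<^bsub>M ?m\<^esub> \<psi> j ?m y))"
    using m assms c by (intro incl_psi[symmetric]) auto
  also have "\<psi> ?m l (\<psi> i ?m x \<oplus>\<^bsub>M ?m\<^esub> \<psi> j ?m y) = \<psi> ?m l (\<psi> i ?m x) \<oplus>\<^bsub>M l\<^esub> \<psi> ?m l (\<psi> j ?m y)"
    using m assms c by (intro lmod_homD(2)[OF homs]) auto
  also have "\<dots> = \<psi> i l x \<oplus>\<^bsub>M l\<^esub> \<psi> j l y" using m assms comp[of i ?m l x] comp[of j ?m l y] by simp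
  finally show ?thesis .
qed

lemma incl_add:
  assumes "i \<in> I" "x \<in> carrier (M i)" "y \<in> carrier (M i)"
  shows "incl i x \<oplus>\<^bsub>limit\<^esub> incl i y = incl i (x \<oplus>\<^bsub>M i\<^esub> y)"
proof -
  have *: "incl (max j k) (\<psi> j (max j k) u \<oplus>\<^bsub>M (max j k)\<^esub> \<psi> k (max j k) v) = incl i (x \<oplus>\<^bsub>M i\<^esub> y)"
    if ju: "(j, u) \<in> incl i x" and kv: "(k, v) \<in> incl i y" for j u k v
  proof -
    from ju obtain l where l: "j \<in> I" "u \<in> carrier (M j)" "l \<in> I" "i \<le> l" "j \<le> l" "\<psi> i l x = \<psi> j l u"
      by (auto simp: incl_def dirlim_rel_def)
    from kv obtain l' where l': "k \<in> I" "v \<in> carrier (M k)" "l' \<in> I" "i \<le> l'" "k \<le> l'" "\<psi> i l' y = \<psi> k l' v"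
      by (auto simp: incl_def dirlim_rel_def)
    let ?m = "max l l'"
    have m: "?m \<in> I" "l \<le> ?m" "l' \<le> ?m" using l l' by (auto simp: max_def)
    have "\<psi> i ?m x = \<psi> j ?m u" using assms l m by (intro rel_mono[of i j l ?m]) auto
    moreover have "\<psi> i ?m y = \<psi> k ?m v" using assms l' m by (intro rel_mono[of i k l' ?m]) auto
    moreover have "incl (max j k) (\<psi> j (max j k) u \<oplus>\<^bsub>M (max j k)\<^esub> \<psi> k (max j k) v)
      = incl ?m (\<psi> j ?m u \<oplus>\<^bsub>M ?m\<^esub> \<psi> k ?m v)"
      using l l' m by (intro add_at) (auto simp: le_max_iff_disj)
    moreover have "incl (max i i) (\<psi> i (max i i) x \<oplus>\<^bsub>M (max i i)\<^esub> \<psi> i (max i i) y)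
      = incl ?m (\<psi> i ?m x \<oplus>\<^bsub>M ?m\<^esub> \<psi> i ?m y)"
      using assms l l' m by (intro add_at) (auto simp: le_max_iff_disj)
    ultimately show ?thesis using assms by (simp add: ident)
  qed
  have self: "(i, z) \<in> incl i z" if "z \<in> carrier (M i)" for z
    using equiv_class_self[OF equiv_rel, of "(i, z)"] assms that by (auto simp: incl_def)
  have "incl i x \<oplus>\<^bsub>limit\<^esub> incl i y = (\<Union>(j, u)\<in>incl i x. \<Union>(k, v)\<in>incl i y.
       incl (max j k) (\<psi> j (max j k) u \<oplus>\<^bsub>M (max j k)\<^esub> \<psi> k (max j k) v))"
    by (simp add: dirlim_lmod_def incl_def)
  also have "\<dots> = incl i (x \<oplus>\<^bsub>M i\<^esub> y)"
  proof (rule SUP_eq_const)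
    show "incl i x \<noteq> {}" using self[OF assms(2)] by auto
    fix p assume p: "p \<in> incl i x"
    show "(case p of (j, u) \<Rightarrow> \<Union>(k, v)\<in>incl i y.
       incl (max j k) (\<psi> j (max j k) u \<oplus>\<^bsub>M (max j k)\<^esub> \<psi> k (max j k) v)) = incl i (x \<oplus>\<^bsub>M i\<^esub> y)"
      unfolding split_beta
    proof (rule SUP_eq_const)
      show "incl i y \<noteq> {}" using self[OF assms(3)] by auto
      fix q assume "q \<in> incl i y"
      then show "incl (max (fst p) (fst q)) (\<psi> (fst p) (max (fst p) (fst q)) (snd p)
          \<oplus>\<^bsub>M (max (fst p) (fst q))\<^esub> \<psi> (fst q) (max (fst p) (fst q)) (snd q)) = incl i (x \<oplus>\<^bsub>M i\<^esub> y)"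
        using *[of "fst p" "snd p" "fst q" "snd q"] p by simp
    qed
  qed
  finally show ?thesis .
qed

lemma incl_smult:
  assumes "i \<in> I" "x \<in> carrier (M i)" "r \<in> carrier R"
  shows "r \<odot>\<^bsub>limit\<^esub> incl i x = incl i (r \<odot>\<^bsub>M i\<^esub> x)"
proof -
  have *: "incl j (r \<odot>\<^bsub>M j\<^esub> u) = incl i (r \<odot>\<^bsub>M i\<^esub> x)" if "(j, u) \<in> incl i x" for j u
  proof -
    from that obtain l where l: "j \<in> I" "u \<in> carrier (M j)" "l \<in> I" "i \<le> l" "j \<le> l" "\<psi> i l x = \<psi> j l u"
      by (auto simp: incl_def dirlim_rel_def)
    have "\<psi> i l (r \<odot>\<^bsub>M i\<^esub> x) = \<psi> j l (r \<odot>\<^bsub>M j\<^esub> u)"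
      using l assms lmod_homD(3)[OF homs] by simp
    then show ?thesis using l assms left_module.smult_closed[OF modules] by (subst incl_eq_iff) auto
  qed
  have self: "(i, x) \<in> incl i x"
    using equiv_class_self[OF equiv_rel, of "(i, x)"] assms by (auto simp: incl_def)
  have "r \<odot>\<^bsub>limit\<^esub> incl i x = (\<Union>(j, u)\<in>incl i x. incl j (r \<odot>\<^bsub>M j\<^esub> u))"
    by (simp add: dirlim_lmod_def incl_def)
  also have "\<dots> = incl i (r \<odot>\<^bsub>M i\<^esub> x)"
  proof (rule SUP_eq_const)
    show "incl i x \<noteq> {}" using self by auto
    fix p assume "p \<in> incl i x"
    then show "(case p of (j, u) \<Rightarrow> incl j (r \<odot>\<^bsub>M j\<^esub> u)) = incl i (r \<odot>\<^bsub>M i\<^esub> x)"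
      using *[of "fst p" "snd p"] by (simp add: split_beta)
  qed
  finally show ?thesis .
qed

lemma common_index:
  assumes "u \<in> carrier limit" "v \<in> carrier limit"
  obtains i x y where "i \<in> I" "x \<in> carrier (M i)" "y \<in> carrier (M i)" "u = incl i x" "v = incl i y"
proof -
  obtain i x j y where *: "i \<in> I" "x \<in> carrier (M i)" "u = incl i x" "j \<in> I" "y \<in> carrier (M j)" "v = incl j y"
    using assms by (auto simp: limit_carrier)
  let ?m = "max i j"
  have m: "?m \<in> I" "i \<le> ?m" "j \<le> ?m" using * by (auto simp: max_def)
  show thesis
    by (rule that[of ?m "\<psi> i ?m x" "\<psi> j ?m y"]) (use * m in \<open>auto simp: incl_psi intro!: psi_closed\<close>)
qed

lemma common_index3:
  assumes "u \<in> carrier limit" "v \<in> carrier limit" "w \<in> carrier limit"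
  obtains i x y z where "i \<in> I" "x \<in> carrier (M i)" "y \<in> carrier (M i)" "z \<in> carrier (M i)"
    "u = incl i x" "v = incl i y" "w = incl i z"
proof -
  obtain i x y where *: "i \<in> I" "x \<in> carrier (M i)" "y \<in> carrier (M i)" "u = incl i x" "v = incl i y"
    using common_index[OF assms(1,2)] by blast
  obtain j z where **: "j \<in> I" "z \<in> carrier (M j)" "w = incl j z"
    using assms by (auto simp: limit_carrier)
  let ?m = "max i j"
  have m: "?m \<in> I" "i \<le> ?m" "j \<le> ?m" using * ** by (auto simp: max_def)
  show thesis
    by (rule that[of ?m "\<psi> i ?m x" "\<psi> i ?m y" "\<psi> j ?m z"]) (use * ** m in \<open>auto simp: incl_psi intro!: psi_closed\<close>)
qed

lemma left_module_limit: "left_module R limit"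
proof -
  obtain i0 where i0: "i0 \<in> I" using nonempty by auto
  have mon: "abelian_monoid (M i)" if "i \<in> I" for i
    using abelian_group.axioms(1)[OF left_module.axioms(2)[OF modules[OF that]]] .
  note simps = incl_add incl_smult incl_zero[symmetric] left_module.smult_closed[OF modules]
    abelian_monoid.a_closed[OF mon] abelian_monoid.zero_closed[OF mon]
  have R: "ring R" using left_module.axioms(1)[OF modules[OF i0]] .
  interpret R: ring R by (rule R)
  show ?thesis
  proof (rule left_moduleI[OF R])
    show "\<zero>\<^bsub>limit\<^esub> \<in> carrier limit"
      unfolding incl_zero[OF i0, symmetric] by (intro incl_closed i0 abelian_monoid.zero_closed mon)
  next
    fix u v assume "u \<in> carrier limit" "v \<in> carrier limit"
    then obtain i x y where *: "i \<in> I" "x \<in> carrier (M i)" "y \<in> carrier (M i)" "u = incl i x" "v = incl i y"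
      by (rule common_index)
    then show "u \<oplus>\<^bsub>limit\<^esub> v \<in> carrier limit" by (simp add: simps incl_closed)
    show "u \<oplus>\<^bsub>limit\<^esub> v = v \<oplus>\<^bsub>limit\<^esub> u" using * abelian_monoid.a_comm[OF mon, of i x y] by (simp add: simps)
    fix a assume "a \<in> carrier R"
    then show "a \<odot>\<^bsub>limit\<^esub> (u \<oplus>\<^bsub>limit\<^esub> v) = a \<odot>\<^bsub>limit\<^esub> u \<oplus>\<^bsub>limit\<^esub> a \<odot>\<^bsub>limit\<^esub> v"
      using * left_module.smult_r_distr[OF modules, of i a x y] by (simp add: simps)
  next
    fix u v w assume "u \<in> carrier limit" "v \<in> carrier limit" "w \<in> carrier limit"
    then obtain i x y z where *: "i \<in> I" "x \<in> carrier (M i)" "y \<in> carrier (M i)" "z \<in> carrier (M i)"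
      "u = incl i x" "v = incl i y" "w = incl i z"
      by (rule common_index3)
    then show "u \<oplus>\<^bsub>limit\<^esub> v \<oplus>\<^bsub>limit\<^esub> w = u \<oplus>\<^bsub>limit\<^esub> (v \<oplus>\<^bsub>limit\<^esub> w)"
      using abelian_monoid.a_assoc[OF mon, of i x y z] by (simp add: simps)
  next
    fix u assume "u \<in> carrier limit"
    then obtain i x where *: "i \<in> I" "x \<in> carrier (M i)" "u = incl i x" by (auto simp: limit_carrier)
    interpret Mi: left_module R "M i" by (rule modules[OF *(1)])
    have z: "\<zero>\<^bsub>limit\<^esub> = incl i \<zero>\<^bsub>M i\<^esub>" using incl_zero * by simp
    show "\<zero>\<^bsub>limit\<^esub> \<oplus>\<^bsub>limit\<^esub> u = u" "\<one>\<^bsub>R\<^esub> \<odot>\<^bsub>limit\<^esub> u = u" "\<zero>\<^bsub>R\<^esub> \<odot>\<^bsub>limit\<^esub> u = \<zero>\<^bsub>limit\<^esub>"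
      using * by (simp_all add: z incl_add incl_smult)
    fix a b assume ab: "a \<in> carrier R" "b \<in> carrier R"
    then show "a \<odot>\<^bsub>limit\<^esub> u \<in> carrier limit"
      "(a \<oplus>\<^bsub>R\<^esub> b) \<odot>\<^bsub>limit\<^esub> u = a \<odot>\<^bsub>limit\<^esub> u \<oplus>\<^bsub>limit\<^esub> b \<odot>\<^bsub>limit\<^esub> u"
      "(a \<otimes>\<^bsub>R\<^esub> b) \<odot>\<^bsub>limit\<^esub> u = a \<odot>\<^bsub>limit\<^esub> (b \<odot>\<^bsub>limit\<^esub> u)"
      using * by (simp_all add: incl_add incl_smult incl_closed Mi.smult_l_distr Mi.smult_assoc1)
  qed
qed

end

section \<open>The Toeplitz algebra as a ring type\<close>

lemma lpa_class_hom: "(lpa_class :: 'k::field free \<Rightarrow> _) \<in> ring_hom free_alg toeplitz_lpa"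
proof -
  have "(lpa_class :: 'k free \<Rightarrow> _) = (+>\<^bsub>free_alg\<^esub>) (toeplitz_ideal :: 'k free set)"
    by (rule ext) (simp add: lpa_class_def)
  show ?thesis
    unfolding \<open>lpa_class = _\<close> toeplitz_lpa_def by (rule ideal.rcos_ring_hom[OF ideal_toeplitz_ideal])
qed

lemma carrier_toeplitz_lpa: "carrier (toeplitz_lpa :: 'k::field free set ring) = range lpa_class"
  by (auto simp: toeplitz_lpa_def FactRing_def A_RCOSETS_def' lpa_class_def free_alg_def)

lemma lpa_class_eq_imp: "lpa_class p = lpa_class q \<Longrightarrow> p - q \<in> (toeplitz_ideal :: 'k::field free set)"
proof -
  interpret ideal toeplitz_ideal "free_alg :: 'k free ring" by (rule ideal_toeplitz_ideal)
  assume "lpa_class p = lpa_class q"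
  then have "p \<in> lpa_class q"
    using a_rcos_self[of p] by (simp add: lpa_class_def free_alg_def)
  then obtain h where "h \<in> toeplitz_ideal" "p = h + q"
    by (auto simp: lpa_class_def a_r_coset_def' free_alg_def)
  then show ?thesis by simp
qed

lemma lpa_class_ideal: "p \<in> (toeplitz_ideal :: 'k::field free set) \<Longrightarrow> lpa_class p = lpa_class 0"
proof -
  interpret ideal toeplitz_ideal "free_alg :: 'k free ring" by (rule ideal_toeplitz_ideal)
  assume "p \<in> toeplitz_ideal"
  moreover have "0 \<in> (toeplitz_ideal :: 'k free set)"
    using additive_subgroup.zero_closed[OF is_additive_subgroup] by (simp only: free_alg_def ring.simps)
  ultimately have "lpa_class p = toeplitz_ideal" "lpa_class (0 :: 'k free) = toeplitz_ideal"
    using a_rcos_const[of p] a_rcos_const[of 0] unfolding lpa_class_def by simp_all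
  then show ?thesis by simp
qed

text \<open>
  A copy of the algebra as an instance of the class \<^class>\<open>ring_1\<close>, where ring identities can be
  calculated without membership conditions.
\<close>

typedef (overloaded) 'k toep = "carrier (toeplitz_lpa :: 'k::field free set ring)"
  morphisms cls of_cls
  using carrier_toeplitz_lpa by auto

setup_lifting type_definition_toep

instantiation toep :: (field) ring_1
begin
lift_definition zero_toep :: "'a toep" is "\<zero>\<^bsub>toeplitz_lpa\<^esub>"
  by (rule ring.ring_simprules[OF ring_toeplitz_lpa])
lift_definition one_toep :: "'a toep" is "\<one>\<^bsub>toeplitz_lpa\<^esub>"
  by (rule ring.ring_simprules[OF ring_toeplitz_lpa])
lift_definition plus_toep :: "'a toep \<Rightarrow> 'a toep \<Rightarrow> 'a toep" is "(\<oplus>\<^bsub>toeplitz_lpa\<^esub>)"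
  by (rule ring.ring_simprules[OF ring_toeplitz_lpa])
lift_definition times_toep :: "'a toep \<Rightarrow> 'a toep \<Rightarrow> 'a toep" is "(\<otimes>\<^bsub>toeplitz_lpa\<^esub>)"
  by (rule ring.ring_simprules[OF ring_toeplitz_lpa])
lift_definition uminus_toep :: "'a toep \<Rightarrow> 'a toep" is "\<lambda>x. \<ominus>\<^bsub>toeplitz_lpa\<^esub> x"
  by (rule ring.ring_simprules[OF ring_toeplitz_lpa])
lift_definition minus_toep :: "'a toep \<Rightarrow> 'a toep \<Rightarrow> 'a toep" is "\<lambda>x y. x \<ominus>\<^bsub>toeplitz_lpa\<^esub> y"
  by (rule ring.ring_simprules[OF ring_toeplitz_lpa])
instance
proof
  interpret ring "toeplitz_lpa :: 'a free set ring" by (rule ring_toeplitz_lpa)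
  fix a b c :: "'a toep"
  show "a + b + c = a + (b + c)" by transfer (rule a_assoc)
  show "a + b = b + a" by transfer (rule a_comm)
  show "0 + a = a" by transfer (rule l_zero)
  show "- a + a = 0" by transfer (rule l_neg)
  show "a - b = a + - b" by transfer (rule minus_eq)
  show "a * b * c = a * (b * c)" by transfer (rule m_assoc)
  show "1 * a = a" by transfer (rule l_one)
  show "a * 1 = a" by transfer (rule r_one)
  show "(a + b) * c = a * c + b * c" by transfer (rule l_distr)
  show "a * (b + c) = a * b + a * c" by transfer (rule r_distr)
  show "(0::'a toep) \<noteq> 1"
  proof
    assume "(0::'a toep) = 1"
    then have "\<zero>\<^bsub>toeplitz_lpa\<^esub> = (\<one>\<^bsub>toeplitz_lpa\<^esub> :: 'a free set)" by transfer
    moreover have "\<one>\<^bsub>toeplitz_lpa\<^esub> = (lpa_class 1 :: 'a free set)"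
      using ring_hom_one[OF lpa_class_hom[where 'k = 'a]] by (simp add: free_alg_def)
    moreover have "\<zero>\<^bsub>toeplitz_lpa\<^esub> = (lpa_class 0 :: 'a free set)"
      using ring_hom_zero[OF lpa_class_hom[where 'k = 'a] ring_free_alg ring_toeplitz_lpa] by (simp add: free_alg_def)
    ultimately have "free_act (1 :: 'a free) (\<lambda>_. 1) = free_act 0 (\<lambda>_. 1)"
      by (metis Y_mod_smult)
    then show False by (metis free_act_one free_act_zero one_neq_zero)
  qed
qed
end

lemma cls_closed [simp]: "cls r \<in> carrier toeplitz_lpa"
  by (rule cls)

lemma cls_surj: "x \<in> carrier toeplitz_lpa \<Longrightarrow> \<exists>r. x = cls r"
  using of_cls_inverse by metis

lemmas cls_simps = plus_toep.rep_eq times_toep.rep_eq zero_toep.rep_eq one_toep.rep_eq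
  uminus_toep.rep_eq minus_toep.rep_eq

definition toep_of :: "'k::field free \<Rightarrow> 'k toep"
  where "toep_of p = of_cls (lpa_class p)"

lemma cls_toep_of: "cls (toep_of p) = lpa_class p"
  by (simp add: toep_of_def of_cls_inverse carrier_toeplitz_lpa)

lemma toep_of_eq_iff: "toep_of p = toep_of q \<longleftrightarrow> lpa_class p = lpa_class q"
  by (metis cls_inject cls_toep_of)

lemma toep_of_surj: "\<exists>p. r = toep_of p"
  using cls[of r] unfolding carrier_toeplitz_lpa by (metis cls_inject cls_toep_of imageE)

lemma toep_of_add: "toep_of (p + q) = toep_of p + toep_of q"
  using ring_hom_add[OF lpa_class_hom, of p q]
  by (simp add: cls_inject[symmetric] cls_simps cls_toep_of free_alg_def)

lemma toep_of_mult: "toep_of (p * q) = toep_of p * toep_of q"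
  using ring_hom_mult[OF lpa_class_hom, of p q]
  by (simp add: cls_inject[symmetric] cls_simps cls_toep_of free_alg_def)

lemma toep_of_one: "toep_of 1 = 1"
  using ring_hom_one[OF lpa_class_hom]
  by (simp add: cls_inject[symmetric] cls_simps cls_toep_of free_alg_def)

lemma toep_of_zero: "toep_of 0 = 0"
  using toep_of_add[of 0 0] by simp

lemma toep_of_diff: "toep_of (p - q) = toep_of p - toep_of q"
  using toep_of_add[of "p - q" q] by (simp add: algebra_simps)

definition scal :: "'k::field \<Rightarrow> 'k toep"
  where "scal a = toep_of (Poly_Mapping.single [] a)"

lemma scal_add: "scal (a + b) = scal a + scal b"
  by (simp add: scal_def single_add toep_of_add)

lemma scal_mult: "scal (a * b) = scal a * scal b"
  by (simp add: scal_def toep_of_mult[symmetric] mult_single plus_list_def)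

lemma scal_zero [simp]: "scal 0 = 0"
  by (simp add: scal_def toep_of_zero)

lemma scal_one [simp]: "scal 1 = 1"
  unfolding scal_def by (metis single_one zero_list_def toep_of_one)

lemma scal_uminus: "scal (- a) = - scal a"
  using scal_add[of a "- a"] by (simp add: eq_neg_iff_add_eq_0 add.commute)

lemma scal_central: "r * scal a = scal a * r"
proof -
  have "p * Poly_Mapping.single [] a = Poly_Mapping.single [] a * p" for p :: "'a free"
    by (induction p rule: free_induct) (simp_all add: mult_single plus_list_def distrib_left distrib_right mult.commute)
  then show ?thesis
    using toep_of_surj[of r] by (auto simp: scal_def toep_of_mult[symmetric])
qed

lemma scal_left_commute: "r * (scal a * s) = scal a * (r * s)"
  by (metis scal_central mult.assoc)

lemma scal_commute: "scal a * scal b = scal b * scal a"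
  by (rule scal_central)

text \<open>
  The elements \<open>X = c\<^sup>* + d\<^sup>*\<close> and \<open>Y = c + d\<close> satisfy \<open>X Y = 1\<close> and \<open>w = 1 - Y X\<close>, and
  together with the scalars they generate the algebra. A left module is therefore a vector space
  with two operators \<open>X\<close> and \<open>Y\<close> such that \<open>X Y = 1\<close>.
\<close>

definition XX :: "'k::field toep" where "XX = toep_of (gen gen_cs + gen gen_ds)"
definition YY :: "'k::field toep" where "YY = toep_of (gen gen_c + gen gen_d)"
definition WW :: "'k::field toep" where "WW = toep_of (gen gen_w)"
definition CC :: "'k::field toep" where "CC = toep_of (gen gen_c)"

lemma toep_of_rel: "p \<in> toeplitz_rels \<Longrightarrow> toep_of p = 0"
proof -
  interpret ring "free_alg :: 'a free ring" by (rule ring_free_alg)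
  assume "p \<in> toeplitz_rels"
  then have "p \<in> toeplitz_ideal" using genideal_self[of toeplitz_rels] by (auto simp: free_alg_def)
  then show ?thesis using lpa_class_ideal toep_of_eq_iff toep_of_zero by metis
qed

context
  fixes v w c d cs ds :: "'k::field toep"
  defines "v \<equiv> toep_of (gen gen_v)" and "w \<equiv> toep_of (gen gen_w)" and "c \<equiv> toep_of (gen gen_c)"
    and "d \<equiv> toep_of (gen gen_d)" and "cs \<equiv> toep_of (gen gen_cs)" and "ds \<equiv> toep_of (gen gen_ds)"
begin

lemma toep_relations:
  "v * v = v" "w * w = w" "v * w = 0" "w * v = 0" "v + w = 1"
  "v * c = c" "c * v = c" "v * cs = cs" "cs * v = cs"
  "v * d = d" "d * w = d" "w * ds = ds" "ds * v = ds"
  "cs * c = v" "ds * d = w" "cs * d = 0" "ds * c = 0" "c * cs + d * ds = v"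
proof -
  have "\<forall>p\<in>toeplitz_rels. toep_of p = (0 :: 'k toep)" using toep_of_rel by blast
  then show "v * v = v" "w * w = w" "v * w = 0" "w * v = 0" "v + w = 1"
    "v * c = c" "c * v = c" "v * cs = cs" "cs * v = cs"
    "v * d = d" "d * w = d" "w * ds = ds" "ds * v = ds"
    "cs * c = v" "ds * d = w" "cs * d = 0" "ds * c = 0" "c * cs + d * ds = v"
    unfolding toeplitz_rels_def Let_def ball_simps toep_of_diff toep_of_add toep_of_mult toep_of_one
      v_def[symmetric] w_def[symmetric] c_def[symmetric] d_def[symmetric] cs_def[symmetric] ds_def[symmetric]
    by simp_all
qed

lemma toep_products:
  "c * ds = 0" "d * cs = 0" "d * v = 0" "v * ds = 0" "w * c = 0" "w * cs = 0" "w * d = 0"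
proof -
  have *: "x * y = 0" if "x * e = x" "f * y = y" "e * f = 0" for x y e f :: "'k toep"
  proof -
    have "x * y = (x * e) * (f * y)" using that by simp
    also have "\<dots> = x * (e * f) * y" by (simp only: mult.assoc)
    finally show ?thesis using that by simp
  qed
  show "c * ds = 0" by (rule *[of c v w ds]) (simp_all add: toep_relations)
  show "d * cs = 0" by (rule *[of d w v cs]) (simp_all add: toep_relations)
  show "d * v = 0" by (rule *[of d w v v]) (simp_all add: toep_relations)
  show "v * ds = 0" by (rule *[of v v w ds]) (simp_all add: toep_relations)
  show "w * c = 0" by (rule *[of w w v c]) (simp_all add: toep_relations)
  show "w * cs = 0" by (rule *[of w w v cs]) (simp_all add: toep_relations)
  show "w * d = 0" by (rule *[of w w v d]) (simp_all add: toep_relations)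
qed

lemma XX_YY: "XX * YY = (1 :: 'k toep)"
  using toep_relations by (simp add: XX_def YY_def toep_of_add c_def[symmetric] d_def[symmetric]
    cs_def[symmetric] ds_def[symmetric] algebra_simps)

lemma gen_v_eq: "v = YY * XX"
  using toep_relations toep_products by (simp add: XX_def YY_def toep_of_add c_def[symmetric] d_def[symmetric]
    cs_def[symmetric] ds_def[symmetric] algebra_simps)

lemma gen_w_eq: "w = 1 - YY * XX"
  using gen_v_eq toep_relations(5) by (metis add_diff_cancel_left')

lemma gen_c_eq: "c = YY * v"
  using toep_relations toep_products by (simp add: YY_def toep_of_add c_def[symmetric] d_def[symmetric] algebra_simps)

lemma gen_d_eq: "d = YY * w"
proof -
  have "c * w = 0" using toep_relations by (metis mult.assoc mult_zero_right)
  then show ?thesis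
    using toep_relations by (simp add: YY_def toep_of_add c_def[symmetric] d_def[symmetric] algebra_simps)
qed

lemma gen_cs_eq: "cs = v * XX"
  using toep_relations toep_products by (simp add: XX_def toep_of_add cs_def[symmetric] ds_def[symmetric] algebra_simps)

lemma gen_ds_eq: "ds = w * XX"
  using toep_relations toep_products by (simp add: XX_def toep_of_add cs_def[symmetric] ds_def[symmetric] algebra_simps)

end

lemma WW_eq: "WW = 1 - YY * XX"
  unfolding WW_def by (rule gen_w_eq)

lemma CC_eq: "CC = YY * (1 - WW)"
  unfolding CC_def gen_c_eq gen_v_eq by (simp add: WW_eq)

lemma XX_WW: "XX * WW = 0"
  by (simp add: WW_eq algebra_simps mult.assoc[symmetric] XX_YY)

lemma WW_YY: "WW * YY = 0"
  by (simp add: WW_eq algebra_simps mult.assoc XX_YY)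

lemma WW_WW: "WW * WW = WW"
  unfolding WW_def by (rule toep_relations(2))

lemma XX_YY_mult: "XX * (YY * r) = r"
  by (metis XX_YY mult.assoc mult_1)

lemma XX_YY_power: "XX ^ n * YY ^ n = (1 :: 'k::field toep)"
proof (induction n)
  case (Suc n)
  have "XX ^ Suc n * YY ^ Suc n = XX ^ n * (XX * (YY * YY ^ n) :: 'k toep)"
    by (simp only: power_Suc2[of XX n] power_Suc[of YY n] mult.assoc)
  then show ?case using Suc by (simp only: XX_YY_mult)
qed simp

text \<open>
  All six generators are products of \<open>X\<close>, \<open>Y\<close>, \<open>Y X\<close> and \<open>1 - Y X\<close>.
\<close>

lemma toep_induct [case_names const add scale X Y]:
  assumes "\<And>a. P (scal a)" and "\<And>r s. P r \<Longrightarrow> P s \<Longrightarrow> P (r + s)"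
    and scale: "\<And>a r. P r \<Longrightarrow> P (scal a * r)"
    and X: "\<And>r. P r \<Longrightarrow> P (XX * r)" and Y: "\<And>r. P r \<Longrightarrow> P (YY * r)"
  shows "P (r :: 'k::field toep)"
proof -
  have v: "P (YY * XX * r)" if "P r" for r using X Y that by (simp add: mult.assoc)
  have w: "P ((1 - YY * XX) * r)" if "P r" for r
    using assms(2)[OF that scale[OF v[OF that], of "-1"]] by (simp add: algebra_simps scal_uminus)
  have g: "P (toep_of (gen g) * r)" if "P r" for g r
    using that by (cases g)
      (auto simp only: gen_v_eq gen_w_eq gen_c_eq gen_d_eq gen_cs_eq gen_ds_eq mult.assoc[of YY "YY * XX" r]
        mult.assoc[of YY "1 - YY * XX" r] mult.assoc[of "YY * XX" XX r] mult.assoc[of "1 - YY * XX" XX r]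
        intro!: v w X Y)
  have "P (toep_of p)" for p
  proof (induction p rule: free_induct)
    case (single u k)
    show ?case
    proof (induction u)
      case Nil
      then show ?case using assms(1) by (simp add: scal_def)
    next
      case (Cons a u)
      have "Poly_Mapping.single (a # u) k = gen a * Poly_Mapping.single u k"
        by (simp add: mult_single plus_list_def)
      with g[OF Cons] show ?case by (simp add: toep_of_mult)
    qed
  qed (simp add: toep_of_add assms(2))
  then show ?thesis using toep_of_surj[of r] by auto
qed

section \<open>Polynomials in an element of the algebra\<close>

text \<open>
  The value \<open>p(z)\<close>, by Horner's rule.
\<close>

definition poly_at :: "'k::field toep \<Rightarrow> 'k poly \<Rightarrow> 'k toep"
  where "poly_at z p = fold_coeffs (\<lambda>a b. scal a + z * b) p 0"

lemma poly_at_0 [simp]: "poly_at z 0 = 0"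
  by (simp add: poly_at_def)

lemma poly_at_pCons [simp]: "poly_at z (pCons a p) = scal a + z * poly_at z p"
  by (cases "p = 0 \<and> a = 0") (auto simp: poly_at_def)

lemma poly_at_1 [simp]: "poly_at z 1 = 1"
  by (simp add: one_pCons)

lemma poly_at_add: "poly_at z (p + q) = poly_at z p + poly_at z q"
  by (induction p q rule: poly_induct2) (simp_all add: scal_add algebra_simps)

lemma poly_at_smult: "poly_at z (Polynomial.smult a p) = scal a * poly_at z p"
  by (induction p) (simp_all add: scal_mult algebra_simps scal_left_commute scal_commute)

lemma poly_at_mult: "poly_at z (p * q) = poly_at z p * poly_at z q"
  by (induction p) (simp_all add: poly_at_add poly_at_smult algebra_simps)

lemma poly_at_uminus: "poly_at z (- p) = - poly_at z p"
  using poly_at_add[of z p "- p"] by (simp add: eq_neg_iff_add_eq_0 add.commute)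

lemma poly_at_monom: "poly_at z (monom a n) = scal a * z ^ n"
  by (induction n) (simp_all add: monom_0 monom_Suc scal_left_commute)

lemma poly_at_commute: "poly_at z p * poly_at z q = poly_at z q * poly_at z p"
  by (metis poly_at_mult mult.commute)

lemma poly_at_eq_sum: "degree p \<le> n \<Longrightarrow> poly_at z p = (\<Sum>i\<le>n. scal (coeff p i) * z ^ i)"
proof (induction p arbitrary: n)
  case (pCons a p)
  show ?case
  proof (cases n)
    case 0
    with pCons show ?thesis by (simp split: if_splits)
  next
    case (Suc m)
    with pCons have "degree p \<le> m" by (cases "p = 0") auto
    with pCons have "poly_at z p = (\<Sum>i\<le>m. scal (coeff p i) * z ^ i)" by blast
    then show ?thesis
      unfolding Suc sum.atMost_Suc_shift by (simp add: sum_distrib_left scal_left_commute)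
  qed
qed simp

text \<open>
  Enough factors \<open>X\<close> on the left cancel every \<open>Y\<close> in \<open>r\<close>. This is what reduces questions on left
  ideals of the algebra to ideals of \<open>K[x]\<close>.
\<close>

lemma XX_power_mult_poly: "\<exists>n q. XX ^ n * r = poly_at XX q"
proof (induction r rule: toep_induct)
  case (const a)
  have "XX ^ 0 * scal a = poly_at XX [:a:]" by simp
  then show ?case by blast
next
  case (add r s)
  then obtain n p m q where *: "XX ^ n * r = poly_at XX p" "XX ^ m * s = poly_at XX q" by blast
  have "XX ^ (n + m) * (r + s) = XX ^ m * (XX ^ n * r) + XX ^ n * (XX ^ m * s)"
    by (simp add: algebra_simps power_add[symmetric] mult.assoc[symmetric])
  also have "\<dots> = poly_at XX (monom 1 m * p + monom 1 n * q)"
    by (simp add: * poly_at_add poly_at_mult poly_at_monom)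
  finally show ?case by blast
next
  case (scale a r)
  then obtain n p where "XX ^ n * r = poly_at XX p" by blast
  then have "XX ^ n * (scal a * r) = poly_at XX (Polynomial.smult a p)" by (simp add: poly_at_smult scal_left_commute)
  then show ?case by blast
next
  case (X r)
  then obtain n p where "XX ^ n * r = poly_at XX p" by blast
  then have "XX ^ n * (XX * r) = poly_at XX (pCons 0 p)"
    by (metis add_0 scal_zero mult.assoc poly_at_pCons power_commutes)
  then show ?case by blast
next
  case (Y r)
  then obtain n p where "XX ^ n * r = poly_at XX p" by blast
  then have "XX ^ Suc n * (YY * r) = poly_at XX p"
    by (simp only: power_Suc2 mult.assoc XX_YY_mult)
  then show ?case by blast
qed

text \<open>
  As \<open>X\<^sup>i = X\<^sup>N Y\<^sup>N\<^sup>-\<^sup>i\<close> for \<open>i \<le> N\<close>, a polynomial in \<open>X\<close> is a power of \<open>X\<close> times a polynomial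
  in \<open>Y\<close> with reversed coefficients. The bound on the degree keeps the induction going: it shows that the new leading term does
  not cancel.
\<close>

lemma poly_XX_to_YY:
  "\<exists>N q. degree q \<le> N \<and> (p \<noteq> 0 \<longrightarrow> q \<noteq> 0) \<and> poly_at XX p = XX ^ N * poly_at YY q"
proof (induction p)
  case 0
  show ?case by (intro exI[of _ 0]) simp
next
  case (pCons a p)
  then obtain N q where *: "degree q \<le> N" "p \<noteq> 0 \<longrightarrow> q \<noteq> 0" "poly_at XX p = XX ^ N * poly_at YY q" by blast
  let ?q = "monom a (Suc N) + q"
  have "coeff ?q (Suc N) = a" using * by (simp add: coeff_eq_0)
  have nz: "?q \<noteq> 0" if "pCons a p \<noteq> 0"
  proof (cases "a = 0")
    case True
    with that * show ?thesis by simp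
  next
    case False
    with \<open>coeff ?q (Suc N) = a\<close> show ?thesis by (metis coeff_0)
  qed
  have "poly_at XX (pCons a p) = scal a * (XX ^ Suc N * YY ^ Suc N) + XX ^ Suc N * poly_at YY q"
    by (simp only: poly_at_pCons * XX_YY_power mult_1_right) (simp only: power_Suc mult.assoc)
  also have "\<dots> = XX ^ Suc N * poly_at YY ?q"
    by (simp only: poly_at_add poly_at_monom distrib_left scal_left_commute)
  finally have "poly_at XX (pCons a p) = XX ^ Suc N * poly_at YY ?q" .
  moreover have "degree ?q \<le> Suc N" using * by (intro degree_add_le) (auto intro: degree_monom_le)
  ultimately show ?case using nz by blast
qed

lemma XX_power_WW: "XX ^ Suc n * WW = 0"
  by (simp add: power_Suc2 mult.assoc XX_WW del: power_Suc)

text \<open>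
  The right ideal \<open>wR\<close> is \<open>w K[X]\<close>, because \<open>w Y = 0\<close>.
\<close>

lemma WW_mult_poly: "\<exists>q. WW * (XX ^ i * r) = WW * poly_at XX q"
proof (induction r arbitrary: i rule: toep_induct)
  case (const a)
  have "WW * (XX ^ i * scal a) = WW * poly_at XX (monom a i)" by (simp add: poly_at_monom scal_central)
  then show ?case by blast
next
  case (add r s)
  then obtain p q where "WW * (XX ^ i * r) = WW * poly_at XX p" "WW * (XX ^ i * s) = WW * poly_at XX q" by metis
  then have "WW * (XX ^ i * (r + s)) = WW * poly_at XX (p + q)" by (simp add: algebra_simps poly_at_add)
  then show ?case by blast
next
  case (scale a r)
  then obtain p where "WW * (XX ^ i * r) = WW * poly_at XX p" by metis
  then have "WW * (XX ^ i * (scal a * r)) = WW * poly_at XX (Polynomial.smult a p)" by (simp add: scal_left_commute poly_at_smult)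
  then show ?case by blast
next
  case (X r)
  from X[of "Suc i"] show ?case by (simp only: power_Suc2 mult.assoc)
next
  case (Y r)
  show ?case
  proof (cases i)
    case 0
    then have "WW * (XX ^ i * (YY * r)) = WW * poly_at XX 0"
      by (simp add: mult.assoc[symmetric] WW_YY)
    then show ?thesis by blast
  next
    case (Suc j)
    then show ?thesis using Y[of j] by (simp only: power_Suc2 mult.assoc XX_YY_mult)
  qed
qed

text \<open>
  The left ideal \<open>Rw\<close> is \<open>K[Y] w\<close>, because \<open>X w = 0\<close>.
\<close>

lemma mult_WW_poly: "\<exists>q. r * WW = poly_at YY q * WW"
proof (induction r rule: toep_induct)
  case (const a)
  have "scal a * WW = poly_at YY [:a:] * WW" by simp
  then show ?case by blast
next
  case (add r s)
  then obtain p q where "r * WW = poly_at YY p * WW" "s * WW = poly_at YY q * WW" by blast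
  then have "(r + s) * WW = poly_at YY (p + q) * WW" by (simp add: algebra_simps poly_at_add)
  then show ?case by blast
next
  case (scale a r)
  then obtain p where "r * WW = poly_at YY p * WW" by blast
  then have "scal a * r * WW = poly_at YY (Polynomial.smult a p) * WW" by (simp add: mult.assoc poly_at_smult)
  then show ?case by blast
next
  case (X r)
  then obtain p where p: "r * WW = poly_at YY p * WW" by blast
  obtain a q where "p = pCons a q" by (metis pCons_cases)
  then have "XX * r * WW = poly_at YY q * WW"
    using p by (simp add: algebra_simps XX_YY_mult scal_left_commute XX_WW mult.assoc)
  then show ?case by blast
next
  case (Y r)
  then obtain p where "r * WW = poly_at YY p * WW" by blast
  then have "YY * r * WW = poly_at YY (pCons 0 p) * WW" by (simp add: mult.assoc)
  then show ?case by blast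
qed

text \<open>
  On \<open>Rw = K[Y] w\<close> the operator \<open>X\<close> is the backward shift, so a power of it recovers the leading
  coefficient. This is why \<open>Rw\<close> is simple.
\<close>

lemma XX_power_poly_WW: "degree q \<le> n \<Longrightarrow> XX ^ n * (poly_at YY q * WW) = scal (coeff q n) * WW"
proof (induction q arbitrary: n)
  case (pCons a q)
  show ?case
  proof (cases n)
    case 0
    with pCons show ?thesis by (simp split: if_splits)
  next
    case (Suc m)
    with pCons have "degree q \<le> m" by (cases "q = 0") auto
    have "XX ^ Suc m * (poly_at YY (pCons a q) * WW)
        = scal a * (XX ^ Suc m * WW) + XX ^ m * (XX * (YY * (poly_at YY q * WW)))"
      by (simp only: poly_at_pCons distrib_left distrib_right scal_left_commute power_Suc2 mult.assoc)
    also have "\<dots> = scal (coeff q m) * WW"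
      using pCons.IH[OF \<open>degree q \<le> m\<close>] by (simp only: XX_power_WW XX_YY_mult mult_zero_right add_0)
    finally show ?thesis using Suc by simp
  qed
qed simp

lemma cls_power: "cls (r ^ n) = cls r [^]\<^bsub>toeplitz_lpa\<^esub> n"
proof -
  interpret ring "toeplitz_lpa :: 'a free set ring" by (rule ring_toeplitz_lpa)
  show ?thesis
  proof (induction n)
    case (Suc n)
    then show ?case by (simp only: power_Suc2 cls_simps nat_pow_Suc)
  qed (simp add: cls_simps)
qed

lemma cls_sum: "finite A \<Longrightarrow> cls (sum f A) = (\<Oplus>\<^bsub>toeplitz_lpa\<^esub>i\<in>A. cls (f i))"
proof -
  interpret ring "toeplitz_lpa :: 'b free set ring" by (rule ring_toeplitz_lpa)
  show "finite A \<Longrightarrow> ?thesis"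
    by (induction A rule: finite_induct) (simp_all add: cls_simps finsum_insert)
qed

lemma poly_c_eq: "poly_c g = cls (poly_at CC g)"
  by (simp add: poly_c_def poly_at_eq_sum[OF order_refl] cls_sum cls_simps cls_power CC_def scal_def cls_toep_of)

section \<open>A commutative model modulo a polynomial\<close>

text \<open>
  If \<open>u x = 1\<close> modulo \<open>F\<close>, then \<open>v \<mapsto> 1\<close>, \<open>c \<mapsto> x\<close>, \<open>c\<^sup>* \<mapsto> u\<close>, \<open>w, d, d\<^sup>* \<mapsto> 0\<close> respects the
  relations modulo \<open>F\<close>. The resulting map from the algebra to \<open>K[x]/(F)\<close> shows that no unexpected
  polynomial in \<open>c\<close> lies in \<open>R F(c)\<close>.
\<close>

fun gen_eval :: "'k::field poly \<Rightarrow> gen \<Rightarrow> 'k poly" where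
  "gen_eval u gen_v = 1"
| "gen_eval u gen_w = 0"
| "gen_eval u gen_c = [:0, 1:]"
| "gen_eval u gen_d = 0"
| "gen_eval u gen_cs = u"
| "gen_eval u gen_ds = 0"

definition free_eval :: "'k::field poly \<Rightarrow> 'k free \<Rightarrow> 'k poly"
  where "free_eval u p =
    (\<Sum>w\<in>Poly_Mapping.keys p. Polynomial.smult (Poly_Mapping.lookup p w) (prod_list (map (gen_eval u) w)))"

lemma free_eval_superset:
  assumes "finite A" "Poly_Mapping.keys p \<subseteq> A"
  shows "free_eval u p = (\<Sum>w\<in>A. Polynomial.smult (Poly_Mapping.lookup p w) (prod_list (map (gen_eval u) w)))"
  unfolding free_eval_def using assms
  by (intro sum.mono_neutral_left) (auto simp: Poly_Mapping.in_keys_iff)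

lemma free_eval_add: "free_eval u (p + q) = free_eval u p + free_eval u q"
proof -
  let ?A = "Poly_Mapping.keys p \<union> Poly_Mapping.keys q"
  have "Poly_Mapping.keys (p + q) \<subseteq> ?A" by (rule Poly_Mapping.keys_add)
  then show ?thesis
    by (simp add: free_eval_superset[of ?A] lookup_add sum.distrib smult_add_left)
qed

lemma free_eval_zero: "free_eval u 0 = 0"
  by (simp add: free_eval_def)

lemma free_eval_uminus: "free_eval u (- p) = - free_eval u p"
  using free_eval_add[of u p "- p"] by (simp add: free_eval_zero eq_neg_iff_add_eq_0 add.commute)

lemma free_eval_diff: "free_eval u (p - q) = free_eval u p - free_eval u q"
  using free_eval_add[of u p "- q"] by (simp add: free_eval_uminus)

lemma free_eval_single: "free_eval u (Poly_Mapping.single w k) = Polynomial.smult k (prod_list (map (gen_eval u) w))"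
  by (simp add: free_eval_def)

lemma free_eval_one: "free_eval u 1 = 1"
proof -
  have "Poly_Mapping.single [] 1 = (1 :: 'a free)" by (metis single_one zero_list_def)
  then show ?thesis using free_eval_single[of u "[]" 1] by simp
qed

lemma free_eval_mult: "free_eval u (p * q) = free_eval u p * free_eval u q"
proof -
  have left: "free_eval u (Poly_Mapping.single w k * q) = free_eval u (Poly_Mapping.single w k) * free_eval u q" for w k
    by (induction q rule: free_induct)
      (simp_all add: mult_single plus_list_def free_eval_single free_eval_add distrib_left smult_add_right mult.commute)
  show ?thesis
    by (induction p rule: free_induct) (simp_all add: left free_eval_add distrib_right)
qed

lemma free_eval_ideal:
  assumes u: "F dvd u * [:0, 1:] - 1" and "p \<in> toeplitz_ideal"
  shows "F dvd free_eval u p"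
proof -
  let ?I = "{p :: 'a free. F dvd free_eval u p}"
  interpret ring "free_alg :: 'a free ring" by (rule ring_free_alg)
  have fa: "carrier (free_alg :: 'a free ring) = UNIV" "p \<oplus>\<^bsub>free_alg\<^esub> q = p + q" for p q :: "'a free"
    by (simp_all add: free_alg_def)
  have neg: "\<ominus>\<^bsub>free_alg\<^esub> p = - p" for p :: "'a free"
    by (rule minus_equality) (simp_all add: free_alg_def)
  have "ideal ?I (free_alg :: 'a free ring)"
  proof (rule idealI[OF ring_free_alg])
    show "subgroup ?I (add_monoid (free_alg :: 'a free ring))"
    proof (rule add.subgroupI)
      have "0 \<in> ?I" by (simp add: free_eval_zero)
      then show "?I \<noteq> {}" by blast
    qed (auto simp: fa neg free_eval_uminus free_eval_add)
  next
    fix a x :: "'a free"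
    assume "a \<in> ?I"
    then show "x \<otimes>\<^bsub>free_alg\<^esub> a \<in> ?I" "a \<otimes>\<^bsub>free_alg\<^esub> x \<in> ?I"
      by (auto simp: free_alg_def free_eval_mult)
  qed
  moreover have "toeplitz_rels \<subseteq> ?I"
    using u by (auto simp: toeplitz_rels_def Let_def free_eval_diff free_eval_add free_eval_mult
      free_eval_single free_eval_one mult.commute one_pCons)
  ultimately have "toeplitz_ideal \<subseteq> ?I" by (rule genideal_minimal)
  then show ?thesis using assms by auto
qed

lemma poly_at_CC_mult_dvd:
  assumes "poly F 0 \<noteq> 0" "r * poly_at CC F = poly_at CC p"
  shows "F dvd p"
proof -
  obtain a h where F: "F = pCons a h" by (metis pCons_cases)
  with assms have a: "a \<noteq> 0" by simp
  \<comment> \<open>the inverse of \<open>x\<close> modulo \<open>F = a + x h\<close>\<close>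
  define u where "u = Polynomial.smult (- inverse a) h"
  have "u * [:0, 1:] - 1 = Polynomial.smult (- inverse a) F"
    using a by (simp add: F u_def one_pCons)
  then have u: "F dvd u * [:0, 1:] - 1" by (simp add: dvd_smult)
  have lift: "\<exists>P. toep_of P = poly_at CC q \<and> free_eval u P = q" for q :: "'a poly"
  proof (induction q)
    case 0
    show ?case using toep_of_zero free_eval_zero by auto
  next
    case (pCons b q)
    then obtain P where "toep_of P = poly_at CC q" "free_eval u P = q" by blast
    then have "toep_of (Poly_Mapping.single [] b + gen gen_c * P) = poly_at CC (pCons b q)"
      "free_eval u (Poly_Mapping.single [] b + gen gen_c * P) = pCons b q"
      by (simp_all add: toep_of_add toep_of_mult scal_def CC_def free_eval_add free_eval_mult free_eval_single)
    then show ?case by blast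
  qed
  obtain R PF P where "r = toep_of R" "toep_of PF = poly_at CC F" "free_eval u PF = F"
    "toep_of P = poly_at CC p" "free_eval u P = p"
    using toep_of_surj lift by metis
  then have "toep_of (R * PF) = toep_of P" using assms by (simp add: toep_of_mult)
  then have "F dvd free_eval u (R * PF - P)"
    using free_eval_ideal[OF u] lpa_class_eq_imp by (metis toep_of_eq_iff)
  then have "F dvd free_eval u R * F - p"
    using \<open>free_eval u PF = F\<close> \<open>free_eval u P = p\<close> by (simp add: free_eval_diff free_eval_mult)
  then show ?thesis by (metis dvd_diff_right_iff dvd_triv_right dvd_add_right_iff diff_conv_add_uminus dvd_minus_iff)
qed

section \<open>Elements killed by the ideal \<open>RwR\<close>\<close>

definition act :: "('k::field free set, 'a, 'm) module_scheme \<Rightarrow> 'k toep \<Rightarrow> 'a \<Rightarrow> 'a"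
  where "act M r m = cls r \<odot>\<^bsub>M\<^esub> m"

lemma hom_act:
  "h \<in> lmod_hom toeplitz_lpa M N \<Longrightarrow> m \<in> carrier M \<Longrightarrow> h (act M r m) = act N r (h m)"
  by (simp add: act_def lmod_homD(3))

lemma hom_actI:
  assumes "\<And>x. x \<in> carrier M \<Longrightarrow> h x \<in> carrier N"
    and "\<And>x y. \<lbrakk>x \<in> carrier M; y \<in> carrier M\<rbrakk> \<Longrightarrow> h (x \<oplus>\<^bsub>M\<^esub> y) = h x \<oplus>\<^bsub>N\<^esub> h y"
    and "\<And>r x. x \<in> carrier M \<Longrightarrow> h (act M r x) = act N r (h x)"
  shows "h \<in> lmod_hom toeplitz_lpa M N"
  using assms cls_surj by (intro lmod_homI) (auto simp: act_def dest!: cls_surj)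

locale toep_module = left_module toeplitz_lpa M
  for M :: "('k::field free set, 'a, 'm) module_scheme"
begin

lemma act_closed [simp, intro]: "m \<in> carrier M \<Longrightarrow> act M r m \<in> carrier M"
  by (simp add: act_def)

lemma act_add: "m \<in> carrier M \<Longrightarrow> act M (r + s) m = act M r m \<oplus>\<^bsub>M\<^esub> act M s m"
  by (simp add: act_def cls_simps smult_l_distr)

lemma act_add_right: "m \<in> carrier M \<Longrightarrow> n \<in> carrier M \<Longrightarrow> act M r (m \<oplus>\<^bsub>M\<^esub> n) = act M r m \<oplus>\<^bsub>M\<^esub> act M r n"
  by (simp add: act_def smult_r_distr)

lemma act_mult: "m \<in> carrier M \<Longrightarrow> act M (r * s) m = act M r (act M s m)"
  by (simp add: act_def cls_simps smult_assoc1)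

lemma act_1 [simp]: "m \<in> carrier M \<Longrightarrow> act M 1 m = m"
  by (simp add: act_def cls_simps)

lemma act_0 [simp]: "m \<in> carrier M \<Longrightarrow> act M 0 m = \<zero>\<^bsub>M\<^esub>"
  by (simp add: act_def cls_simps)

lemma act_zero [simp]: "act M r \<zero>\<^bsub>M\<^esub> = \<zero>\<^bsub>M\<^esub>"
  by (simp add: act_def)

lemma act_uminus: "m \<in> carrier M \<Longrightarrow> act M (- r) m = \<ominus>\<^bsub>M\<^esub> act M r m"
  by (simp add: act_def cls_simps smult_l_minus)

lemma act_diff_eq_zero:
  assumes "m \<in> carrier M" shows "act M (r - s) m = \<zero>\<^bsub>M\<^esub> \<longleftrightarrow> act M r m = act M s m"
proof
  assume "act M (r - s) m = \<zero>\<^bsub>M\<^esub>"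
  then show "act M r m = act M s m" using act_add[OF assms, of "r - s" s] assms by simp
next
  assume "act M r m = act M s m"
  then show "act M (r - s) m = \<zero>\<^bsub>M\<^esub>"
    using act_add[OF assms, of r "- s"] assms by (simp add: act_uminus M.r_neg)
qed

text \<open>
  The elements killed by \<open>wR = w K[X]\<close>. The submodule that such an element generates is killed by the
  ideal \<open>RwR\<close>, and on it \<open>X\<close> and \<open>Y\<close> are inverse to each other: it is a module over the Laurent
  polynomials \<open>K[x, x\<^sup>-\<^sup>1]\<close>.
\<close>

definition W_free :: "'a \<Rightarrow> bool"
  where "W_free m \<longleftrightarrow> (\<forall>j. act M (WW * XX ^ j) m = \<zero>\<^bsub>M\<^esub>)"

lemma W_free_mult:
  assumes "m \<in> carrier M" "W_free m"
  shows "act M (WW * r) m = \<zero>\<^bsub>M\<^esub>"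
proof -
  have *: "act M (WW * (XX ^ i * poly_at XX q)) m = \<zero>\<^bsub>M\<^esub>" for i q
  proof (induction q arbitrary: i)
    case (pCons a q)
    have "WW * (XX ^ i * poly_at XX (pCons a q)) = scal a * (WW * XX ^ i) + WW * (XX ^ Suc i * poly_at XX q)"
      by (simp only: poly_at_pCons distrib_left power_Suc2 mult.assoc scal_left_commute scal_central[of "XX ^ i"])
    then show ?case using pCons.IH[of "Suc i"] assms
      by (simp add: act_add act_mult[of m "scal a"] W_free_def del: power_Suc)
  qed (use assms in simp)
  obtain q where "WW * (XX ^ 0 * r) = WW * poly_at XX q" using WW_mult_poly by blast
  then show ?thesis using *[of 0 q] by simp
qed

lemma W_free_act:
  assumes "m \<in> carrier M" "W_free m" shows "W_free (act M r m)"
  unfolding W_free_def using W_free_mult[OF assms, of "XX ^ _ * r"] assms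
  by (simp add: act_mult[symmetric] mult.assoc)

lemma W_free_YX:
  assumes "m \<in> carrier M" "W_free m" shows "act M YY (act M XX m) = m"
proof -
  have "act M (1 - YY * XX) m = \<zero>\<^bsub>M\<^esub>"
    using W_free_mult[OF assms, of 1] by (simp add: WW_eq)
  then show ?thesis using assms by (simp add: act_diff_eq_zero act_mult)
qed

lemma W_free_YX_power:
  assumes "m \<in> carrier M" "W_free m" shows "act M (YY ^ n) (act M (XX ^ n) m) = m"
proof (induction n)
  case (Suc n)
  have "act M (YY ^ Suc n) (act M (XX ^ Suc n) m) = act M (YY ^ n) (act M YY (act M XX (act M (XX ^ n) m)))"
    using assms by (simp only: power_Suc2[of YY] power_Suc[of XX] act_mult act_closed)
  also have "\<dots> = m" using assms Suc by (simp add: W_free_YX W_free_act)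
  finally show ?case .
qed (use assms in simp)

lemma W_free_X_power_inj:
  assumes "m \<in> carrier M" "W_free m" "act M (XX ^ n) m = \<zero>\<^bsub>M\<^esub>" shows "m = \<zero>\<^bsub>M\<^esub>"
  using W_free_YX_power[OF assms(1,2), of n] assms by simp

text \<open>
  As \<open>c = Y (1 - w)\<close>, the elements \<open>c\<close> and \<open>Y\<close> act alike where \<open>w\<close> acts as zero.
\<close>

lemma W_free_CC:
  assumes "m \<in> carrier M" "W_free m" shows "act M CC m = act M YY m"
proof -
  have "act M (CC - YY) m = act M (- YY) (act M (WW * 1) m)"
    using assms by (simp add: CC_eq act_mult[symmetric] algebra_simps)
  then show ?thesis using W_free_mult[OF assms, of 1] assms by (simp add: act_diff_eq_zero)
qed

lemma W_free_poly_at_CC: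
  assumes "m \<in> carrier M" "W_free m" shows "act M (poly_at CC p) m = act M (poly_at YY p) m"
proof (induction p)
  case (pCons a p)
  have "act M (CC * poly_at CC p) m = act M (YY * poly_at YY p) m"
    using assms pCons by (simp add: act_mult W_free_CC W_free_act)
  then show ?case using assms by (simp add: act_add)
qed simp

text \<open>
  Right multiplication by \<open>c\<close> shifts the basis \<open>w, w X, w X\<^sup>2, \<dots>\<close> of \<open>wR\<close> down by one place, except
  that it sends both \<open>w\<close> and \<open>w X\<close> to \<open>0\<close>.
\<close>

lemma WW_XX_CC_0: "WW * XX ^ 0 * CC = 0"
  by (simp add: CC_eq mult.assoc[symmetric] WW_YY)

lemma WW_XX_CC_1: "WW * XX ^ Suc 0 * CC = 0"
  by (simp add: CC_eq mult.assoc XX_YY_mult) (simp add: algebra_simps WW_WW)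

lemma WW_XX_CC_Suc: "WW * XX ^ Suc (Suc j) * CC = WW * XX ^ Suc j"
proof -
  have "WW * XX ^ Suc (Suc j) * CC = WW * XX ^ Suc j * (XX * (YY * (1 - WW)))"
    by (simp only: CC_eq power_Suc2[of XX "Suc j"] mult.assoc)
  also have "\<dots> = WW * XX ^ Suc j - WW * (XX ^ Suc j * WW)"
    by (simp only: XX_YY_mult) (simp only: right_diff_distrib mult_1_right mult.assoc)
  finally show ?thesis by (simp only: XX_power_WW mult_zero_right diff_zero)
qed

lemma W_killed_mult_CC:
  assumes "m \<in> carrier M" "\<And>i. i < j \<Longrightarrow> act M (WW * XX ^ i * poly_at CC p) m = \<zero>\<^bsub>M\<^esub>"
  shows "act M (WW * XX ^ j * (CC * poly_at CC p)) m = \<zero>\<^bsub>M\<^esub>"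
proof -
  have e: "WW * XX ^ k * (CC * s) = WW * XX ^ k * CC * s" for k s by (simp only: mult.assoc)
  consider "j = 0" | "j = Suc 0" | i where "j = Suc (Suc i)" by (metis not0_implies_Suc)
  then show ?thesis
  proof cases
    case 1
    then show ?thesis using assms(1) by (simp only: e WW_XX_CC_0 mult_zero_left act_0)
  next
    case 2
    then show ?thesis using assms(1) by (simp only: e WW_XX_CC_1 mult_zero_left act_0)
  next
    case 3
    then show ?thesis using assms(2)[of "Suc i"] by (simp only: e WW_XX_CC_Suc lessI)
  qed
qed

lemma W_killed_poly_at_CC:
  assumes "m \<in> carrier M" "\<And>i. i \<le> j \<Longrightarrow> act M (WW * XX ^ i) m = \<zero>\<^bsub>M\<^esub>"
  shows "act M (WW * XX ^ j * poly_at CC p) m = \<zero>\<^bsub>M\<^esub>"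
  using assms(2)
proof (induction p arbitrary: j)
  case (pCons a p)
  have "act M (WW * XX ^ j * (CC * poly_at CC p)) m = \<zero>\<^bsub>M\<^esub>"
    by (rule W_killed_mult_CC[OF assms(1)]) (use pCons in auto)
  moreover have "WW * XX ^ j * poly_at CC (pCons a p) = scal a * (WW * XX ^ j) + WW * XX ^ j * (CC * poly_at CC p)"
    by (simp only: poly_at_pCons distrib_left scal_central)
  ultimately show ?case using pCons.prems[of j] assms(1) by (simp add: act_add act_mult[of m "scal a"])
qed (use assms in simp)

text \<open>
  By the shift above, \<open>w X\<^sup>j f(c)\<close> is \<open>f(0) w X\<^sup>j\<close> plus a combination of lower \<open>w X\<^sup>i\<close>. Since
  \<open>f(0) \<noteq> 0\<close>, the \<open>w X\<^sup>j\<close> kill \<open>m\<close> one after the other.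
\<close>

lemma W_free_of_killed:
  assumes m: "m \<in> carrier M" and f: "poly f 0 \<noteq> 0" "act M (poly_at CC f) m = \<zero>\<^bsub>M\<^esub>"
  shows "W_free m"
  unfolding W_free_def
proof
  fix j
  obtain a h where fh: "f = pCons a h" by (metis pCons_cases)
  with f have a: "a \<noteq> 0" by simp
  show "act M (WW * XX ^ j) m = \<zero>\<^bsub>M\<^esub>"
  proof (induction j rule: less_induct)
    case (less j)
    have "act M (WW * XX ^ j * (CC * poly_at CC h)) m = \<zero>\<^bsub>M\<^esub>"
      by (rule W_killed_mult_CC[OF m], rule W_killed_poly_at_CC[OF m]) (use less in auto)
    moreover have "WW * XX ^ j * poly_at CC f = scal a * (WW * XX ^ j) + WW * XX ^ j * (CC * poly_at CC h)"
      by (simp only: fh poly_at_pCons distrib_left scal_central)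
    moreover have "act M (WW * XX ^ j * poly_at CC f) m = \<zero>\<^bsub>M\<^esub>" using m f by (simp add: act_mult)
    ultimately have "act M (scal a * (WW * XX ^ j)) m = \<zero>\<^bsub>M\<^esub>" using m by (simp add: act_add)
    then have "act M (scal (inverse a) * (scal a * (WW * XX ^ j))) m = \<zero>\<^bsub>M\<^esub>"
      using m by (simp add: act_mult[of m "scal (inverse a)"])
    then show ?case using a by (simp add: mult.assoc[symmetric] scal_mult[symmetric])
  qed
qed

text \<open>
  Applying \<open>X\<close> to \<open>F(Y) m = 0\<close> expresses \<open>X m\<close> as a polynomial in \<open>Y\<close> applied to \<open>m\<close>, because
  \<open>F(0) \<noteq> 0\<close>.
\<close>

lemma cyclic_polynomial:
  assumes m: "m \<in> carrier M" and F: "poly F 0 \<noteq> 0" "act M (poly_at YY F) m = \<zero>\<^bsub>M\<^esub>"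
  shows "\<exists>p. act M r m = act M (poly_at YY p) m"
proof (induction r rule: toep_induct)
  case (const a)
  show ?case by (rule exI[of _ "[:a:]"]) simp
next
  case (add r s)
  then obtain p q where "act M r m = act M (poly_at YY p) m" "act M s m = act M (poly_at YY q) m" by blast
  then show ?case using m by (intro exI[of _ "p + q"]) (simp add: poly_at_add act_add)
next
  case (scale a r)
  then obtain p where "act M r m = act M (poly_at YY p) m" by blast
  then show ?case using m by (intro exI[of _ "Polynomial.smult a p"]) (simp add: poly_at_smult act_mult)
next
  case (Y r)
  then obtain p where "act M r m = act M (poly_at YY p) m" by blast
  then show ?case using m by (intro exI[of _ "pCons 0 p"]) (simp add: act_mult)
next
  case (X r)
  obtain a h where F': "F = pCons a h" by (metis pCons_cases)
  with F have a: "a \<noteq> 0" by simp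
  from X obtain p where p: "act M r m = act M (poly_at YY p) m" by blast
  obtain b q where p': "p = pCons b q" by (metis pCons_cases)
  have X: "XX * poly_at YY (pCons c g) = scal c * XX + poly_at YY g" for c and g :: "'k poly"
    by (simp add: distrib_left scal_central XX_YY_mult)
  have "act M (XX * poly_at YY F) m = \<zero>\<^bsub>M\<^esub>" using m F by (simp add: act_mult)
  then have "act M (scal a * XX - poly_at YY (- h)) m = \<zero>\<^bsub>M\<^esub>" by (simp add: F' X poly_at_uminus del: poly_at_pCons)
  then have "act M (scal a * XX) m = act M (poly_at YY (- h)) m" using m by (simp add: act_diff_eq_zero)
  then have "act M (scal (b * inverse a)) (act M (scal a * XX) m) = act M (scal (b * inverse a)) (act M (poly_at YY (- h)) m)" by simp
  then have "act M (scal b * XX) m = act M (poly_at YY (Polynomial.smult (b * inverse a) (- h))) m"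
    using m a by (simp add: act_mult[symmetric] poly_at_smult mult.assoc[symmetric] scal_mult[symmetric] mult.assoc[of b] del: smult_minus_right)
  moreover have "act M (XX * r) m = act M (scal b * XX + poly_at YY q) m"
    using m p by (simp only: p' X[symmetric] act_mult)
  ultimately have "act M (XX * r) m = act M (poly_at YY (Polynomial.smult (b * inverse a) (- h) + q)) m"
    using m by (simp add: act_add poly_at_add del: smult_minus_right)
  then show ?case by blast
qed

end

lemma toep_moduleI: "left_module toeplitz_lpa M \<Longrightarrow> toep_module M"
  by (simp add: toep_module_def)

section \<open>The modules \<open>R/Rf\<^sup>n(c)\<close> and their limit\<close>

definition M_el :: "'k::field poly \<Rightarrow> nat \<Rightarrow> 'k toep \<Rightarrow> 'k free set set"
  where "M_el f n r = PIdl\<^bsub>toeplitz_lpa\<^esub> (poly_c (f ^ n)) +>\<^bsub>toeplitz_lpa\<^esub> cls r"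

lemma regular_coset: "N +>\<^bsub>regular_lmod R\<^esub> x = N +>\<^bsub>R\<^esub> x"
  by (simp add: a_r_coset_def' regular_lmod_def)

lemma left_module_toep_regular: "left_module toeplitz_lpa (regular_lmod (toeplitz_lpa :: 'k::field free set ring))"
  by (rule left_module_regular[OF ring_toeplitz_lpa])

lemma M_submodule: "submodule (PIdl\<^bsub>toeplitz_lpa\<^esub> (poly_c g)) toeplitz_lpa (regular_lmod toeplitz_lpa)"
  unfolding poly_c_eq by (rule left_ideal_submodule[OF ring_toeplitz_lpa]) simp

lemma left_module_M: "left_module toeplitz_lpa (M_mod f n)"
  unfolding M_mod_def by (rule left_module_quot[OF left_module_toep_regular M_submodule])

lemma M_carrier: "carrier (M_mod f n) = range (M_el f n)"
proof -
  have "carrier (regular_lmod toeplitz_lpa) = range (cls :: 'a toep \<Rightarrow> _)"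
    using cls_surj by (auto simp: regular_lmod_def)
  then show ?thesis
    by (auto simp: M_mod_def quot_lmod_carrier regular_coset M_el_def)
qed

lemma M_el_closed [simp]: "M_el f n r \<in> carrier (M_mod f n)"
  by (simp add: M_carrier)

lemma M_el_add: "M_el f n r \<oplus>\<^bsub>M_mod f n\<^esub> M_el f n s = M_el f n (r + s)"
  using quot_lmod_add[OF left_module_toep_regular M_submodule, of "cls r" "cls s" "f ^ n"]
  by (simp add: M_mod_def M_el_def regular_coset cls_simps) (simp add: regular_lmod_def)

lemma M_el_act: "act (M_mod f n) s (M_el f n r) = M_el f n (s * r)"
  using quot_lmod_smult[OF left_module_toep_regular M_submodule, of "cls r" "cls s" "f ^ n"]
  by (simp add: act_def M_mod_def M_el_def regular_coset cls_simps) (simp add: regular_lmod_def)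

lemma M_el_zero: "\<zero>\<^bsub>M_mod f n\<^esub> = M_el f n 0"
proof -
  interpret toep_module "M_mod f n" by (rule toep_moduleI[OF left_module_M])
  show ?thesis using act_0[of "M_el f n 0"] by (simp add: M_el_act)
qed

lemma M_el_eq_iff: "M_el f n r = M_el f n s \<longleftrightarrow> (\<exists>t. r - s = t * poly_at CC (f ^ n))"
proof -
  interpret ring "toeplitz_lpa :: 'a free set ring" by (rule ring_toeplitz_lpa)
  interpret reg: left_module "toeplitz_lpa :: 'a free set ring" "regular_lmod toeplitz_lpa"
    by (rule left_module_toep_regular)
  have "\<ominus>\<^bsub>regular_lmod toeplitz_lpa\<^esub> cls s = \<ominus>\<^bsub>toeplitz_lpa\<^esub> cls s"
    by (rule reg.M.minus_equality) (simp_all add: regular_lmod_def l_neg)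
  then have "M_el f n r = M_el f n s \<longleftrightarrow> cls (r - s) \<in> PIdl\<^bsub>toeplitz_lpa\<^esub> (poly_c (f ^ n))"
    using coset_eq_iff[OF left_module_toep_regular M_submodule, of "cls r" "cls s" "f ^ n"]
    by (simp add: M_el_def regular_coset a_minus_def cls_simps) (simp add: regular_lmod_def)
  also have "\<dots> \<longleftrightarrow> (\<exists>t. cls (r - s) = cls (t * poly_at CC (f ^ n)))"
    by (auto simp: cgenideal_def poly_c_eq cls_simps(2)) (use cls_surj in blast)
  finally show ?thesis by (simp add: cls_inject)
qed

lemma M_map_el:
  assumes "i \<le> l" shows "M_map f i l (M_el f i r) = M_el f l (r * poly_at CC (f ^ (l - i)))"
proof -
  have "M_el f l (s * poly_at CC (f ^ (l - i))) = M_el f l (r * poly_at CC (f ^ (l - i)))"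
    if s: "cls s \<in> M_el f i r" for s
  proof -
    from s obtain t where "cls s = cls (t * poly_at CC (f ^ i)) \<oplus>\<^bsub>toeplitz_lpa\<^esub> cls r"
      by (auto simp: M_el_def a_r_coset_def' cgenideal_def poly_c_eq cls_simps(2) dest!: cls_surj)
    then have "s = t * poly_at CC (f ^ i) + r" by (simp only: cls_simps(1)[symmetric] cls_inject)
    then have "s * poly_at CC (f ^ (l - i)) - r * poly_at CC (f ^ (l - i)) = t * poly_at CC (f ^ l)"
      using assms by (simp add: distrib_right mult.assoc poly_at_mult[symmetric] power_add[symmetric])
    then show ?thesis unfolding M_el_eq_iff by blast
  qed
  moreover have "\<exists>s. x = cls s" if "x \<in> M_el f i r" for x
  proof -
    interpret ring "toeplitz_lpa :: 'a free set ring" by (rule ring_toeplitz_lpa)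
    from that have "x \<in> carrier toeplitz_lpa"
      by (auto simp: M_el_def a_r_coset_def' cgenideal_def poly_c_eq)
    then show ?thesis by (rule cls_surj)
  qed
  moreover have "cls r \<in> M_el f i r"
  proof -
    have "cls 0 \<in> PIdl\<^bsub>toeplitz_lpa\<^esub> (poly_c (f ^ i))"
      unfolding cgenideal_def poly_c_eq by (rule CollectI, rule exI[of _ "cls 0"]) (simp add: cls_simps(2)[symmetric])
    moreover have "cls r = cls 0 \<oplus>\<^bsub>toeplitz_lpa\<^esub> cls r" by (simp add: cls_simps(1)[symmetric])
    ultimately show ?thesis unfolding M_el_def a_r_coset_def' by blast
  qed
  moreover have "M_map f i l (M_el f i r) = (\<Union>x\<in>M_el f i r.
      PIdl\<^bsub>toeplitz_lpa\<^esub> (poly_c (f ^ l)) +>\<^bsub>toeplitz_lpa\<^esub> (x \<otimes>\<^bsub>toeplitz_lpa\<^esub> poly_c (f ^ (l - i))))"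
    by (simp add: M_map_def)
  moreover have "PIdl\<^bsub>toeplitz_lpa\<^esub> (poly_c (f ^ l)) +>\<^bsub>toeplitz_lpa\<^esub> (cls s \<otimes>\<^bsub>toeplitz_lpa\<^esub> poly_c (f ^ (l - i)))
      = M_el f l (s * poly_at CC (f ^ (l - i)))" for s
    by (simp add: M_el_def poly_c_eq cls_simps(2))
  ultimately show ?thesis
    by (metis (no_types, lifting) SUP_eq_const empty_iff)
qed

lemma directed_system_M: "directed_system toeplitz_lpa {1..} (M_mod f) (M_map f)"
proof (rule directed_system.intro)
  show "{1..} \<noteq> ({} :: nat set)" by auto
  fix i :: nat
  show "left_module toeplitz_lpa (M_mod f i)" by (rule left_module_M)
  show "M_map f i j \<in> lmod_hom toeplitz_lpa (M_mod f i) (M_mod f j)" if "i \<le> j" for j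
    by (rule hom_actI) (use that in \<open>auto simp: M_carrier M_map_el M_el_add M_el_act distrib_right mult.assoc\<close>)
  show "M_map f i i x = x" if "x \<in> carrier (M_mod f i)" for x
    using that by (auto simp: M_carrier M_map_el)
  show "M_map f j l (M_map f i j x) = M_map f i l x" if "i \<le> j" "j \<le> l" "x \<in> carrier (M_mod f i)" for j l x
    using that by (auto simp: M_carrier M_map_el mult.assoc poly_at_mult[symmetric] power_add[symmetric])
qed

text \<open>
  The image of \<open>1 + R f\<^sup>n(c)\<close> in the limit, for \<open>n \<ge> 1\<close>. One may think of it as the fraction
  \<open>1/f\<^sup>n\<close> modulo \<open>K[x, x\<^sup>-\<^sup>1]\<close>.
\<close>

definition U_gen :: "'k::field poly \<Rightarrow> nat \<Rightarrow> (nat \<times> 'k free set set) set"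
  where "U_gen f n = directed_system.incl {1..} (M_mod f) (M_map f) n (M_el f n 1)"

context
  fixes f :: "'k::field poly"
begin

interpretation D: directed_system toeplitz_lpa "{1..}" "M_mod f" "M_map f"
  by (rule directed_system_M)

lemma left_module_U: "left_module toeplitz_lpa (U_mod f)"
  unfolding U_mod_def by (rule D.left_module_limit)

lemma U_gen_act: "1 \<le> n \<Longrightarrow> act (U_mod f) r (U_gen f n) = D.incl n (M_el f n r)"
  using M_el_act[of f n r 1] by (simp add: act_def U_gen_def U_mod_def D.incl_smult del: One_nat_def)

lemma U_gen_closed: "1 \<le> n \<Longrightarrow> U_gen f n \<in> carrier (U_mod f)"
  by (simp add: U_gen_def U_mod_def D.incl_closed del: One_nat_def)

lemma U_carrier:
  assumes "u \<in> carrier (U_mod f)" obtains n r where "1 \<le> n" "u = act (U_mod f) r (U_gen f n)"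
proof -
  from assms obtain n x where "n \<in> {1..}" "x \<in> carrier (M_mod f n)" "u = D.incl n x"
    by (auto simp: U_mod_def D.limit_carrier simp del: One_nat_def)
  then show thesis using that U_gen_act by (auto simp: M_carrier simp del: One_nat_def)
qed

lemma U_gen_Suc: "1 \<le> n \<Longrightarrow> act (U_mod f) (poly_at CC f) (U_gen f (Suc n)) = U_gen f n"
  using D.incl_psi[of n "Suc n" "M_el f n 1"] by (simp add: U_gen_act) (simp add: U_gen_def M_map_el)

lemma U_zero: "1 \<le> n \<Longrightarrow> \<zero>\<^bsub>U_mod f\<^esub> = D.incl n (M_el f n 0)"
  using D.incl_zero[of n] by (simp add: M_el_zero U_mod_def)

lemma U_gen_1: "act (U_mod f) (poly_at CC f) (U_gen f 1) = \<zero>\<^bsub>U_mod f\<^esub>"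
proof -
  have "M_el f 1 (poly_at CC f) = M_el f 1 0" unfolding M_el_eq_iff by (rule exI[of _ 1]) simp
  then show ?thesis by (simp add: U_gen_act U_zero[of 1])
qed

text \<open>
  Otherwise \<open>f\<^sup>l\<^sup>-\<^sup>1(c) \<in> R f\<^sup>l(c)\<close> for some \<open>l \<ge> 1\<close>, and the commutative model gives
  \<open>f\<^sup>l | f\<^sup>l\<^sup>-\<^sup>1\<close>.
\<close>

lemma U_gen_1_nonzero:
  assumes "f \<in> irred_polys" shows "U_gen f 1 \<noteq> \<zero>\<^bsub>U_mod f\<^esub>"
proof
  assume "U_gen f 1 = \<zero>\<^bsub>U_mod f\<^esub>"
  then have "D.incl 1 (M_el f 1 1) = D.incl 1 (M_el f 1 0)" by (simp add: U_gen_def U_zero[of 1])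
  then obtain l where l: "1 \<le> l" "M_map f 1 l (M_el f 1 1) = M_map f 1 l (M_el f 1 0)"
    by (subst (asm) D.incl_eq_iff) auto
  then have "M_el f l (poly_at CC (f ^ (l - 1))) = M_el f l 0" by (simp add: M_map_el)
  then obtain t where t: "t * poly_at CC (f ^ l) = poly_at CC (f ^ (l - 1))" unfolding M_el_eq_iff by auto
  have f: "f \<noteq> 0" "\<not> f dvd 1" "poly f 0 \<noteq> 0"
    using assms by (auto simp: irred_polys_def irreducible_def)
  have "poly (f ^ l) 0 \<noteq> 0" using f by (simp add: poly_power)
  from poly_at_CC_mult_dvd[OF this t] have "f ^ (l - 1) * f dvd f ^ (l - 1) * 1"
    using l by (simp add: power_Suc2[symmetric] del: power_Suc)
  then show False using f by (simp add: dvd_mult_cancel_left)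
qed

end

section \<open>Comaximal polynomials\<close>

text \<open>
  A nonzero element of least degree divides all others.
\<close>

lemma poly_ideal_principal:
  fixes J :: "'k::field poly set"
  assumes "0 \<in> J" "\<And>p q. p \<in> J \<Longrightarrow> q \<in> J \<Longrightarrow> p + q \<in> J" "\<And>p q. q \<in> J \<Longrightarrow> p * q \<in> J"
  obtains g where "g \<in> J" "\<And>p. p \<in> J \<Longrightarrow> g dvd p"
proof (cases "J \<subseteq> {0}")
  case True
  then show thesis using that[of 0] assms(1) by auto
next
  case False
  then have "\<exists>p. p \<in> J \<and> p \<noteq> 0" by auto
  then obtain g where g: "g \<in> J" "g \<noteq> 0" and min: "\<And>p. p \<in> J \<Longrightarrow> p \<noteq> 0 \<Longrightarrow> degree g \<le> degree p"
    using ex_has_least_nat[of "\<lambda>p. p \<in> J \<and> p \<noteq> 0" _ degree] by metis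
  have "g dvd p" if "p \<in> J" for p
  proof -
    have "p mod g = p + (- (p div g)) * g" by (simp add: minus_div_mult_eq_mod[symmetric])
    then have "p mod g \<in> J" using assms(2)[OF that assms(3)[OF g(1)]] by metis
    then have "p mod g = 0" using min[of "p mod g"] degree_mod_less'[of g p] g(2) by force
    then show ?thesis by (simp add: mod_eq_0_iff_dvd)
  qed
  then show thesis using that g by blast
qed

definition comaximal :: "'k::field poly \<Rightarrow> 'k poly \<Rightarrow> bool"
  where "comaximal p q \<longleftrightarrow> (\<exists>a b. a * p + b * q = 1)"

lemma comaximal_mult:
  assumes "comaximal p q" "comaximal p r" shows "comaximal p (q * r)"
proof -
  obtain a b c d where *: "a * p + b * q = 1" "c * p + d * r = 1"
    using assms unfolding comaximal_def by blast
  have "(a * c * p + a * d * r + b * q * c) * p + (b * d) * (q * r) = (a * p + b * q) * (c * p + d * r)"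
    by (simp add: algebra_simps)
  then show ?thesis unfolding comaximal_def * by (metis mult_1_right)
qed

lemma comaximal_1: "comaximal p 1"
  unfolding comaximal_def by (rule exI[of _ 0], rule exI[of _ 1]) simp

lemma comaximal_commute: "comaximal p q \<longleftrightarrow> comaximal q p"
  unfolding comaximal_def by (metis add.commute)

lemma comaximal_power: "comaximal p q \<Longrightarrow> comaximal p (q ^ n)"
  by (induction n) (simp_all add: comaximal_1 comaximal_mult)

lemma comaximal_prod: "(\<And>i. i \<in> A \<Longrightarrow> comaximal p (q i)) \<Longrightarrow> comaximal p (prod q A)"
  by (induction A rule: infinite_finite_induct) (simp_all add: comaximal_1 comaximal_mult)

lemma comaximal_irreducible:
  assumes f: "irreducible f" and "\<not> f dvd p" shows "comaximal p f"
proof -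
  let ?J = "{a * p + b * f | a b. True}"
  obtain g where g: "g \<in> ?J" and dv: "\<And>q. q \<in> ?J \<Longrightarrow> g dvd q"
  proof (rule poly_ideal_principal[of ?J])
    show "0 \<in> ?J" by (rule CollectI, rule exI[of _ 0], rule exI[of _ 0]) simp
  next
    fix q r assume "q \<in> ?J" "r \<in> ?J"
    then obtain a b c d where "q = a * p + b * f" "r = c * p + d * f" by blast
    then have "q + r = (a + c) * p + (b + d) * f" by (simp add: algebra_simps)
    then show "q + r \<in> ?J" by blast
  next
    fix q r assume "r \<in> ?J"
    then obtain a b where "r = a * p + b * f" by blast
    then have "q * r = (q * a) * p + (q * b) * f" by (simp add: algebra_simps)
    then show "q * r \<in> ?J" by blast
  qed blast
  have "f = 0 * p + 1 * f" "p = 1 * p + 0 * f" by simp_all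
  then have "g dvd f" "g dvd p" using dv by blast+
  then have "g dvd 1" using f \<open>\<not> f dvd p\<close> irreducibleD'[OF f] dvd_trans by blast
  then obtain c where "1 = c * g" by (metis dvd_def mult.commute)
  moreover obtain a b where "g = a * p + b * f" using g by blast
  ultimately have "(c * a) * p + (c * b) * f = 1" by (simp add: algebra_simps)
  then show ?thesis unfolding comaximal_def by blast
qed

text \<open>
  Associated polynomials with the same nonzero constant term are equal.
\<close>

lemma irred_polys_comaximal:
  assumes "f \<in> irred_polys" "g \<in> irred_polys" "f \<noteq> g" shows "comaximal f g"
proof (rule comaximal_irreducible)
  show "irreducible g" using assms by (simp add: irred_polys_def)
  show "\<not> g dvd f"
  proof
    assume "g dvd f"
    then obtain h where h: "f = g * h" by (auto simp: dvd_def)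
    then have "is_unit h"
      using assms irreducibleD[of f g h] by (auto simp: irred_polys_def irreducible_def)
    then obtain c where c: "h = [:c:]" by (metis is_unit_polyE)
    have "poly f 0 = -1" "poly g 0 = -1" using assms by (auto simp: irred_polys_def)
    then have "c = 1" unfolding h c by simp
    then show False using assms h c by simp
  qed
qed

context toep_module
begin

lemma poly_at_act_commute:
  "m \<in> carrier M \<Longrightarrow> act M (poly_at YY p) (act M (poly_at YY q) m) = act M (poly_at YY q) (act M (poly_at YY p) m)"
  by (simp add: act_mult[symmetric] poly_at_commute[of _ p])

lemma comaximal_act:
  assumes m: "m \<in> carrier M" and ab: "a * p + b * q = 1" and q: "act M (poly_at YY q) m = \<zero>\<^bsub>M\<^esub>"
  shows "act M (poly_at YY a) (act M (poly_at YY p) m) = m"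
proof -
  have "act M (poly_at YY (a * p + b * q)) m = m" by (simp add: ab m)
  then show ?thesis using m q by (simp add: poly_at_add poly_at_mult act_add act_mult)
qed

end

section \<open>The structure of \<open>U\<^sup>f\<close>\<close>

locale U_module =
  fixes f :: "'k::field poly"
  assumes f: "f \<in> irred_polys"
begin

sublocale toep_module "U_mod f"
  by (rule toep_moduleI[OF left_module_U])

lemma f_props: "irreducible f" "poly f 0 = -1" "f \<noteq> 0" "poly f 0 \<noteq> 0"
  using f by (auto simp: irred_polys_def)

abbreviation "U \<equiv> U_mod f"
abbreviation "e \<equiv> U_gen f"

lemma gen_closed: "e (Suc n) \<in> carrier U"
  by (rule U_gen_closed) simp

lemma gen_W_free: "W_free (e (Suc n))"
proof -
  have k: "act U (poly_at CC (f ^ Suc n)) (e (Suc n)) = \<zero>\<^bsub>U\<^esub>"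
  proof (induction n)
    case 0
    then show ?case using U_gen_1[of f] by simp
  next
    case (Suc n)
    have "act U (poly_at CC (f ^ Suc (Suc n))) (e (Suc (Suc n))) = act U (poly_at CC (f ^ Suc n)) (act U (poly_at CC f) (e (Suc (Suc n))))"
      using U_gen_closed[of "Suc (Suc n)" f] by (simp add: power_Suc2[of f "Suc n"] poly_at_mult act_mult del: power_Suc)
    also have "\<dots> = \<zero>\<^bsub>U\<^esub>" using U_gen_Suc[of "Suc n" f] Suc by simp
    finally show ?case .
  qed
  have "poly (f ^ Suc n) 0 \<noteq> 0" using f_props by (simp add: poly_power del: power_Suc)
  then show ?thesis by (rule W_free_of_killed[OF gen_closed _ k])
qed

lemma gen_Suc: "act U (poly_at YY f) (e (Suc (Suc n))) = e (Suc n)"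
  using U_gen_Suc[of "Suc n" f] W_free_poly_at_CC[OF gen_closed gen_W_free] by simp

lemma gen_1: "act U (poly_at YY f) (e (Suc 0)) = \<zero>\<^bsub>U\<^esub>"
  using U_gen_1[of f] W_free_poly_at_CC[OF gen_closed gen_W_free] by simp

lemma gen_power_zero: "act U (poly_at YY (f ^ Suc n)) (e (Suc n)) = \<zero>\<^bsub>U\<^esub>"
proof (induction n)
  case 0
  then show ?case using gen_1 by simp
next
  case (Suc n)
  have "act U (poly_at YY (f ^ Suc (Suc n))) (e (Suc (Suc n))) = act U (poly_at YY (f ^ Suc n)) (act U (poly_at YY f) (e (Suc (Suc n))))"
    using gen_closed by (simp only: power_Suc2[of f "Suc n"] poly_at_mult act_mult)
  then show ?case using gen_Suc Suc by simp
qed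

lemma gen_power: "act U (poly_at YY (f ^ n)) (e (Suc n)) = e (Suc 0)"
proof (induction n)
  case (Suc n)
  have "act U (poly_at YY (f ^ Suc n)) (e (Suc (Suc n))) = act U (poly_at YY (f ^ n)) (act U (poly_at YY f) (e (Suc (Suc n))))"
    using gen_closed by (simp only: power_Suc2[of f n] poly_at_mult act_mult)
  then show ?case using gen_Suc Suc by simp
qed (use gen_closed in simp)

lemma gen_nonzero: "e (Suc 0) \<noteq> \<zero>\<^bsub>U\<^esub>"
  using U_gen_1_nonzero[OF f] by simp

lemma elem_poly:
  assumes "u \<in> carrier U" obtains n p where "u = act U (poly_at YY p) (e (Suc n))"
proof -
  from assms obtain n r where "1 \<le> n" "u = act U r (e n)" by (rule U_carrier)
  then obtain k where k: "u = act U r (e (Suc k))" by (cases n) auto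
  have "poly (f ^ Suc k) 0 \<noteq> 0" using f_props by (simp add: poly_power del: power_Suc)
  from cyclic_polynomial[OF gen_closed this gen_power_zero] k that show thesis by metis
qed

lemma W_free_U: "u \<in> carrier U \<Longrightarrow> W_free u"
  by (erule elem_poly) (simp add: W_free_act gen_closed gen_W_free)

lemma killed_by_power:
  assumes "u \<in> carrier U" obtains n where "act U (poly_at YY (f ^ n)) u = \<zero>\<^bsub>U\<^esub>"
proof -
  from assms obtain n p where u: "u = act U (poly_at YY p) (e (Suc n))" by (rule elem_poly)
  have "act U (poly_at YY (f ^ Suc n)) u = \<zero>\<^bsub>U\<^esub>"
    unfolding u by (subst poly_at_act_commute[OF gen_closed]) (simp only: gen_power_zero act_zero)
  then show thesis by (rule that)
qed

text \<open>
  An element \<open>u\<close> killed by \<open>f\<^sup>n(Y)\<close> is divisible by every \<open>q(Y)\<close> with \<open>q\<close> prime to \<open>f\<close>, by a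
  Bezout relation; and it is divisible by \<open>f(Y)\<close> because each generator is \<open>f(Y)\<close> times the next.
\<close>

lemma divisible:
  assumes "q \<noteq> 0" "u \<in> carrier U" shows "\<exists>x\<in>carrier U. act U (poly_at YY q) x = u"
  using assms
proof (induction "degree q" arbitrary: q u rule: less_induct)
  case less
  show ?case
  proof (cases "f dvd q")
    case False
    obtain n where n: "act U (poly_at YY (f ^ n)) u = \<zero>\<^bsub>U\<^esub>" using less.prems by (rule_tac killed_by_power)
    have "comaximal q (f ^ n)"
      using comaximal_irreducible[OF f_props(1) False] by (rule comaximal_power)
    then obtain a b where "a * q + b * f ^ n = 1" unfolding comaximal_def by blast
    from comaximal_act[OF less.prems(2) this n] have "act U (poly_at YY q) (act U (poly_at YY a) u) = u"
      using poly_at_act_commute less.prems by simp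
    then show ?thesis using less.prems by blast
  next
    case True
    then obtain g where q: "q = f * g" by (auto simp: dvd_def)
    then have g: "g \<noteq> 0" using less.prems by auto
    have "degree f \<noteq> 0"
      using f_props(1,3) is_unit_iff_degree by (auto simp: irreducible_def)
    then have deg: "degree g < degree q" using q g f_props(3) by (simp add: degree_mult_eq)
    obtain n p where u: "u = act U (poly_at YY p) (e (Suc n))" using less.prems by (rule_tac elem_poly)
    have "act U (poly_at YY f) (act U (poly_at YY p) (e (Suc (Suc n)))) = u"
      by (subst poly_at_act_commute[OF gen_closed]) (simp add: gen_Suc u)
    moreover obtain x where "x \<in> carrier U" "act U (poly_at YY g) x = act U (poly_at YY p) (e (Suc (Suc n)))"
      using less.hyps[OF deg g] gen_closed by blast
    ultimately show ?thesis by (intro bexI[of _ x]) (simp_all add: q poly_at_mult act_mult)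
  qed
qed

text \<open>
  Write \<open>u = p(Y) e\<^sub>n\<close>. Common factors \<open>f\<close> of \<open>p\<close> lower \<open>n\<close>; when none is left, \<open>p(Y)\<close> is invertible on
  \<open>e\<^sub>n\<close>, and a power of \<open>f(Y)\<close> leads from \<open>e\<^sub>n\<close> to \<open>e\<^sub>1\<close>.
\<close>

lemma essential:
  assumes "u \<in> carrier U" "u \<noteq> \<zero>\<^bsub>U\<^esub>" shows "\<exists>a. act U (poly_at YY a) u = e (Suc 0)"
proof -
  have "act U (poly_at YY p) (e (Suc n)) \<noteq> \<zero>\<^bsub>U\<^esub> \<Longrightarrow> \<exists>a. act U (poly_at YY a) (act U (poly_at YY p) (e (Suc n))) = e (Suc 0)" for p n
  proof (induction n arbitrary: p)
    case 0
    have "\<not> f dvd p"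
    proof
      assume "f dvd p"
      then obtain q where "p = q * f" by (metis dvd_def mult.commute)
      then show False using 0 gen_closed gen_1 by (simp add: poly_at_mult act_mult)
    qed
    then obtain a b where "a * p + b * f = 1" using comaximal_irreducible[OF f_props(1)] unfolding comaximal_def by blast
    from comaximal_act[OF gen_closed this gen_1] show ?case by blast
  next
    case (Suc n)
    show ?case
    proof (cases "f dvd p")
      case True
      then obtain q where "p = q * f" by (metis dvd_def mult.commute)
      then have "act U (poly_at YY p) (e (Suc (Suc n))) = act U (poly_at YY q) (e (Suc n))"
        using gen_closed gen_Suc by (simp add: poly_at_mult act_mult)
      then show ?thesis using Suc by metis
    next
      case False
      then have "comaximal p (f ^ Suc (Suc n))"
        using comaximal_irreducible[OF f_props(1)] comaximal_power by blast
      then obtain a b where "a * p + b * f ^ Suc (Suc n) = 1" unfolding comaximal_def by blast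
      from comaximal_act[OF gen_closed this gen_power_zero]
      have "act U (poly_at YY (f ^ Suc n * a)) (act U (poly_at YY p) (e (Suc (Suc n)))) = e (Suc 0)"
        using gen_closed gen_power[of "Suc n"] by (simp only: poly_at_mult[of _ "f ^ Suc n" a] act_mult act_closed)
      then show ?thesis by blast
    qed
  qed
  moreover obtain n p where "u = act U (poly_at YY p) (e (Suc n))" using assms(1) by (rule elem_poly)
  ultimately show ?thesis using assms by blast
qed

end

section \<open>Injectivity of the sum of the \<open>U\<^sup>f\<close>\<close>

abbreviation D_mod :: "('k::field free set, 'k poly \<Rightarrow> (nat \<times> 'k free set set) set) module"
  where "D_mod \<equiv> sum_lmod irred_polys U_mod"

lemma left_module_D: "left_module toeplitz_lpa D_mod"
  by (rule left_module_sum[OF ring_toeplitz_lpa left_module_U])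

lemma D_carrier: "x \<in> carrier D_mod \<longleftrightarrow> x \<in> extensional irred_polys \<and>
    (\<forall>f\<in>irred_polys. x f \<in> carrier (U_mod f)) \<and> finite {f \<in> irred_polys. x f \<noteq> \<zero>\<^bsub>U_mod f\<^esub>}"
  by (auto simp: sum_lmod_def PiE_iff)

lemma D_act: "act D_mod r x = (\<lambda>f\<in>irred_polys. act (U_mod f) r (x f))"
  by (simp add: act_def sum_lmod_def prod_lmod_def)

lemma D_zero: "\<zero>\<^bsub>D_mod\<^esub> = (\<lambda>f\<in>irred_polys. \<zero>\<^bsub>U_mod f\<^esub>)"
  by (simp add: sum_lmod_def prod_lmod_def)

lemma D_add: "x \<oplus>\<^bsub>D_mod\<^esub> y = (\<lambda>f\<in>irred_polys. x f \<oplus>\<^bsub>U_mod f\<^esub> y f)"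
  by (simp add: sum_lmod_def prod_lmod_def)

interpretation D: toep_module D_mod
  by (rule toep_moduleI[OF left_module_D])

lemma D_W_free: assumes "x \<in> carrier D_mod" shows "D.W_free x"
proof -
  have "act (U_mod f) (WW * XX ^ j) (x f) = \<zero>\<^bsub>U_mod f\<^esub>" if "f \<in> irred_polys" for f j
  proof -
    interpret U_module f using that by unfold_locales
    show ?thesis using W_free_U[of "x f"] assms that by (simp add: D_carrier W_free_def)
  qed
  then show ?thesis by (auto simp: D.W_free_def D_act D_zero intro!: restrict_ext)
qed

text \<open>
  Where a coordinate of \<open>x\<close> vanishes, that of \<open>y\<close> is chosen to be zero, which keeps the support finite.
\<close>

lemma D_divisible:
  assumes "q \<noteq> 0" "x \<in> carrier D_mod" shows "\<exists>y\<in>carrier D_mod. act D_mod (poly_at YY q) y = x"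
proof -
  have "\<exists>y. y \<in> carrier (U_mod f) \<and> act (U_mod f) (poly_at YY q) y = x f \<and> (x f = \<zero>\<^bsub>U_mod f\<^esub> \<longrightarrow> y = \<zero>\<^bsub>U_mod f\<^esub>)"
    if "f \<in> irred_polys" for f
  proof -
    interpret U_module f using that by unfold_locales
    show ?thesis
    proof (cases "x f = \<zero>\<^bsub>U_mod f\<^esub>")
      case True
      then show ?thesis by (intro exI[of _ "\<zero>\<^bsub>U_mod f\<^esub>"]) simp
    next
      case False
      then show ?thesis using divisible[OF assms(1), of "x f"] assms(2) that by (auto simp: D_carrier)
    qed
  qed
  then obtain y where y: "\<And>f. f \<in> irred_polys \<Longrightarrow> y f \<in> carrier (U_mod f)"
    "\<And>f. f \<in> irred_polys \<Longrightarrow> act (U_mod f) (poly_at YY q) (y f) = x f"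
    "\<And>f. f \<in> irred_polys \<Longrightarrow> x f = \<zero>\<^bsub>U_mod f\<^esub> \<Longrightarrow> y f = \<zero>\<^bsub>U_mod f\<^esub>" by metis
  have "finite {f \<in> irred_polys. restrict y irred_polys f \<noteq> \<zero>\<^bsub>U_mod f\<^esub>}"
    by (rule finite_subset[of _ "{f \<in> irred_polys. x f \<noteq> \<zero>\<^bsub>U_mod f\<^esub>}"])
       (use y(3) assms(2) in \<open>auto simp: D_carrier\<close>)
  then have "restrict y irred_polys \<in> carrier D_mod" using y(1) by (simp add: D_carrier)
  moreover have "act D_mod (poly_at YY q) (restrict y irred_polys) = x"
  proof (rule ext)
    show "act D_mod (poly_at YY q) (restrict y irred_polys) f = x f" for f
      using y(2) assms(2) by (cases "f \<in> irred_polys") (auto simp: D_act D_carrier extensional_def)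
  qed
  ultimately show ?thesis by blast
qed

lemma D_divisible_XX:
  assumes "q \<noteq> 0" "x \<in> carrier D_mod" shows "\<exists>y\<in>carrier D_mod. act D_mod (poly_at XX q) y = x"
proof -
  obtain N p where p: "p \<noteq> 0" "poly_at XX q = XX ^ N * poly_at YY p" using poly_XX_to_YY[of q] assms(1) by blast
  have "act D_mod (YY ^ N) x \<in> carrier D_mod" using assms by simp
  then obtain y where y: "y \<in> carrier D_mod" "act D_mod (poly_at YY p) y = act D_mod (YY ^ N) x"
    using D_divisible[OF p(1)] by blast
  then have "act D_mod (poly_at XX q) y = act D_mod (XX ^ N * YY ^ N) x"
    using assms by (simp only: p(2) D.act_mult)
  then show ?thesis using y assms by (intro bexI[of _ y]) (simp_all add: XX_YY_power)
qed

lemma toep_baerI: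
  assumes "left_module toeplitz_lpa (N :: ('k::field free set, 'b, 'n) module_scheme)"
    and ex: "\<And>(I :: 'k toep set) (g :: 'k toep \<Rightarrow> 'b). \<lbrakk>0 \<in> I; \<And>r s. r \<in> I \<Longrightarrow> s \<in> I \<Longrightarrow> r + s \<in> I; \<And>r s. s \<in> I \<Longrightarrow> r * s \<in> I;
        \<And>r. r \<in> I \<Longrightarrow> g r \<in> carrier N; \<And>r s. r \<in> I \<Longrightarrow> s \<in> I \<Longrightarrow> g (r + s) = g r \<oplus>\<^bsub>N\<^esub> g s;
        \<And>r s. s \<in> I \<Longrightarrow> g (r * s) = act N r (g s)\<rbrakk>
        \<Longrightarrow> \<exists>d\<in>carrier N. \<forall>r\<in>I. g r = act N r d"
  shows "baer toeplitz_lpa N"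
  unfolding baer_def
proof (intro allI impI)
  fix I g
  assume I: "submodule I toeplitz_lpa (regular_lmod (toeplitz_lpa :: 'k free set ring))"
    and g: "g \<in> lmod_hom toeplitz_lpa (regular_lmod toeplitz_lpa\<lparr>carrier := I\<rparr>) N"
  have sub: "I \<subseteq> carrier toeplitz_lpa"
    using subgroup.subset[OF submodule.axioms(1)[OF I]] by (simp add: regular_lmod_def)
  have cl: "\<zero>\<^bsub>toeplitz_lpa\<^esub> \<in> I" "\<And>r s. \<lbrakk>r \<in> I; s \<in> I\<rbrakk> \<Longrightarrow> r \<oplus>\<^bsub>toeplitz_lpa\<^esub> s \<in> I"
      "\<And>r s. \<lbrakk>r \<in> carrier toeplitz_lpa; s \<in> I\<rbrakk> \<Longrightarrow> r \<otimes>\<^bsub>toeplitz_lpa\<^esub> s \<in> I"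
    using subgroup.one_closed[OF submodule.axioms(1)[OF I]] subgroup.m_closed[OF submodule.axioms(1)[OF I]]
      submodule.smult_closed[OF I] by (simp_all add: regular_lmod_def)
  have gD: "\<And>r. r \<in> I \<Longrightarrow> g r \<in> carrier N"
    "\<And>r s. \<lbrakk>r \<in> I; s \<in> I\<rbrakk> \<Longrightarrow> g (r \<oplus>\<^bsub>toeplitz_lpa\<^esub> s) = g r \<oplus>\<^bsub>N\<^esub> g s"
    "\<And>r s. \<lbrakk>r \<in> carrier toeplitz_lpa; s \<in> I\<rbrakk> \<Longrightarrow> g (r \<otimes>\<^bsub>toeplitz_lpa\<^esub> s) = r \<odot>\<^bsub>N\<^esub> g s"
    using lmod_homD[OF g] by (auto simp: regular_lmod_def)
  have "\<exists>d\<in>carrier N. \<forall>r\<in>{r. cls r \<in> I}. g (cls r) = act N r d"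
    by (rule ex) (simp_all add: cls_simps cl gD act_def)
  then obtain d where d: "d \<in> carrier N" "\<And>r. cls r \<in> I \<Longrightarrow> g (cls r) = act N r d" by blast
  have "g r = r \<odot>\<^bsub>N\<^esub> d" if "r \<in> I" for r
  proof -
    obtain s where "r = cls s" using cls_surj \<open>r \<in> I\<close> sub by blast
    then show ?thesis using d(2)[of s] \<open>r \<in> I\<close> by (simp add: act_def)
  qed
  then show "\<exists>d\<in>carrier N. \<forall>r\<in>I. g r = r \<odot>\<^bsub>N\<^esub> d" using d(1) by blast
qed

text \<open>
  The algebra is not left noetherian, so injectivity of a direct sum of injective modules is not
  automatic. Here \<open>X\<close> is injective on the module, and every \<open>r\<close> in the left ideal \<open>I\<close> has a multiple
  \<open>X\<^sup>n r = q(X)\<close>, so a homomorphism on \<open>I\<close> is determined on the ideal of all \<open>q\<close> with \<open>q(X) \<in> I\<close>. That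
  ideal is generated by one \<open>p\<close>, and divisibility by \<open>p(X)\<close> provides the element representing the
  homomorphism.
\<close>

lemma baer_D: "baer toeplitz_lpa (D_mod :: ('k::field free set, _) module)"
proof (rule toep_baerI[OF left_module_D])
  fix I and g :: "'k toep \<Rightarrow> _"
  assume I: "0 \<in> I" "\<And>r s. r \<in> I \<Longrightarrow> s \<in> I \<Longrightarrow> r + s \<in> I" "\<And>r s. s \<in> I \<Longrightarrow> r * s \<in> I"
    and g: "\<And>r. r \<in> I \<Longrightarrow> g r \<in> carrier D_mod" "\<And>r s. r \<in> I \<Longrightarrow> s \<in> I \<Longrightarrow> g (r + s) = g r \<oplus>\<^bsub>D_mod\<^esub> g s"
      "\<And>r s. s \<in> I \<Longrightarrow> g (r * s) = act D_mod r (g s)"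
  let ?J = "{q. poly_at XX q \<in> I}"
  obtain p where p: "p \<in> ?J" and dv: "\<And>q. q \<in> ?J \<Longrightarrow> p dvd q"
    by (rule poly_ideal_principal[of ?J]) (auto simp: I poly_at_add poly_at_mult)
  have g0: "g 0 = \<zero>\<^bsub>D_mod\<^esub>" using g(3)[OF I(1), of 0] g(1)[OF I(1)] by simp
  have "\<exists>d\<in>carrier D_mod. act D_mod (poly_at XX p) d = g (poly_at XX p)"
  proof (cases "p = 0")
    case True
    then show ?thesis using g0 by (intro bexI[of _ "\<zero>\<^bsub>D_mod\<^esub>"]) auto
  next
    case False
    then show ?thesis using D_divisible_XX p g(1) by blast
  qed
  then obtain d where d: "d \<in> carrier D_mod" "act D_mod (poly_at XX p) d = g (poly_at XX p)" by blast
  have "g r = act D_mod r d" if r: "r \<in> I" for r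
  proof -
    obtain n q where q: "XX ^ n * r = poly_at XX q" using XX_power_mult_poly by blast
    then have "q \<in> ?J" using I(3)[OF r, of "XX ^ n"] by simp
    then obtain s where s: "q = s * p" using dv by (metis dvd_def mult.commute)
    have "act D_mod (XX ^ n) (g r) = g (poly_at XX q)" using g(3)[OF r, of "XX ^ n"] q by simp
    also have "\<dots> = act D_mod (XX ^ n) (act D_mod r d)"
      using g(3)[of "poly_at XX p" "poly_at XX s"] p d by (simp add: q[symmetric] D.act_mult[symmetric]) (simp add: q s poly_at_mult D.act_mult)
    finally have "act D_mod (YY ^ n) (act D_mod (XX ^ n) (g r)) = act D_mod (YY ^ n) (act D_mod (XX ^ n) (act D_mod r d))" by simp
    moreover have "act D_mod (YY ^ n) (act D_mod (XX ^ n) x) = x" if "x \<in> carrier D_mod" for x :: "'k poly \<Rightarrow> _"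
      using D.W_free_YX_power[OF that D_W_free[OF that]] .
    ultimately show ?thesis using g(1)[OF r] d(1) by (metis D.act_closed)
  qed
  then show "\<exists>d\<in>carrier D_mod. \<forall>r\<in>I. g r = act D_mod r d" using d by blast
qed

section \<open>Injectivity of the module of series\<close>

lemma Y_act: "act Y_mod (toep_of p) y = free_act p y"
  by (simp add: act_def cls_toep_of Y_mod_smult)

lemma Y_simps: "carrier Y_mod = UNIV" "x \<oplus>\<^bsub>Y_mod\<^esub> y = (\<lambda>s. x s + y s)" "\<zero>\<^bsub>Y_mod\<^esub> = (\<lambda>_. 0)"
  by (simp_all add: Y_mod_def)

lemma left_module_Y: "left_module toeplitz_lpa (Y_mod :: ('k::field free set, _) module)"
proof -
  have act: "\<exists>p. a = lpa_class p" if "a \<in> carrier toeplitz_lpa" for a :: "'k free set"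
    using that by (auto simp: carrier_toeplitz_lpa)
  have one: "\<one>\<^bsub>toeplitz_lpa\<^esub> = (lpa_class 1 :: 'k free set)"
    by (metis cls_toep_of one_toep.rep_eq toep_of_one)
  have zero: "\<zero>\<^bsub>toeplitz_lpa\<^esub> = (lpa_class 0 :: 'k free set)"
    by (metis cls_toep_of zero_toep.rep_eq toep_of_zero)
  have add: "lpa_class p \<oplus>\<^bsub>toeplitz_lpa\<^esub> lpa_class q = lpa_class (p + q)" for p q :: "'k free"
    by (metis cls_toep_of plus_toep.rep_eq toep_of_add)
  have mult: "lpa_class p \<otimes>\<^bsub>toeplitz_lpa\<^esub> lpa_class q = lpa_class (p * q)" for p q :: "'k free"
    by (metis cls_toep_of times_toep.rep_eq toep_of_mult)
  show ?thesis
    by (rule left_moduleI[OF ring_toeplitz_lpa])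
       (auto simp: Y_simps one zero add mult Y_mod_smult free_act_add free_act_mult free_act_add_right
         free_act_one free_act_zero add.assoc dest!: act)
qed

interpretation Y: toep_module Y_mod
  by (rule toep_moduleI[OF left_module_Y])

text \<open>
  The basis symbols \<open>w, d, cd, c\<^sup>2d, \<dots>\<close> as one sequence. In these coordinates \<open>X\<close> is the backward
  shift, and \<open>w\<close> is the projection to coordinate \<open>0\<close>.
\<close>

fun ysym_at :: "nat \<Rightarrow> ysym" where
  "ysym_at 0 = Yw"
| "ysym_at (Suc n) = Ycd n"

lemma ysym_at_surj: "\<exists>n. s = ysym_at n"
  by (cases s) (metis ysym_at.simps)+

lemma Y_scal: "act Y_mod (scal a) y = (\<lambda>s. a * y s)"
  by (rule ext) (simp add: scal_def Y_act free_act_single)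

lemma Y_XX: "act Y_mod XX y (ysym_at n) = y (ysym_at (Suc n))"
  by (cases n) (simp_all add: XX_def Y_act free_act_add free_act_single)

lemma Y_WW: "act Y_mod WW y = (\<lambda>s. if s = Yw then y Yw else 0)"
proof
  fix s show "act Y_mod WW y s = (if s = Yw then y Yw else 0)"
    by (cases s) (simp_all add: WW_def Y_act free_act_single)
qed

lemma Y_add: "act Y_mod (r + s) y t = act Y_mod r y t + act Y_mod s y t"
  using Y.act_add[of y r s] by (simp add: Y_simps)

lemma Y_mult: "act Y_mod (r * s) y = act Y_mod r (act Y_mod s y)"
  using Y.act_mult[of y r s] by (simp add: Y_simps)

lemma Y_XX_power: "act Y_mod (XX ^ n) y (ysym_at i) = y (ysym_at (n + i))"
proof (induction n arbitrary: i)
  case (Suc n)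
  have "act Y_mod (XX ^ Suc n) y (ysym_at i) = act Y_mod XX (act Y_mod (XX ^ n) y) (ysym_at i)"
    by (simp add: Y_mult)
  then show ?case using Suc[of "Suc i"] by (simp add: Y_XX)
qed (use Y.act_1 in \<open>simp add: Y_simps\<close>)

lemma Y_XX_poly:
  assumes add: "\<And>p q. \<Lambda> (p + q) = \<Lambda> p + \<Lambda> q" and scale: "\<And>a p. \<Lambda> (Polynomial.smult a p) = a * \<Lambda> p"
    and y: "\<And>n. y (ysym_at n) = \<Lambda> (monom 1 n)"
  shows "act Y_mod (poly_at XX q) y (ysym_at n) = \<Lambda> (monom 1 n * q)"
proof (induction q arbitrary: n)
  case 0
  have "\<Lambda> 0 = 0" using scale[of 0 0] by simp
  then show ?case using Y.act_0 by (simp add: Y_simps)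
next
  case (pCons a q)
  have "monom 1 n * pCons a q = Polynomial.smult a (monom 1 n) + monom 1 (Suc n) * q"
    by (simp add: monom_Suc mult_pCons_right)
  then show ?case using pCons.IH[of "Suc n"]
    by (simp add: Y_add Y_mult Y_scal Y_XX y add scale)
qed

lemma functional_extend:
  fixes W :: "'k::field poly set" and \<phi> :: "'k poly \<Rightarrow> 'k"
  assumes W: "0 \<in> W" "\<And>p q. p \<in> W \<Longrightarrow> q \<in> W \<Longrightarrow> p + q \<in> W" "\<And>a p. p \<in> W \<Longrightarrow> Polynomial.smult a p \<in> W"
    and \<phi>: "\<And>p q. p \<in> W \<Longrightarrow> q \<in> W \<Longrightarrow> \<phi> (p + q) = \<phi> p + \<phi> q" "\<And>a p. p \<in> W \<Longrightarrow> \<phi> (Polynomial.smult a p) = a * \<phi> p"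
  obtains \<Lambda> where "\<And>p q. \<Lambda> (p + q) = \<Lambda> p + \<Lambda> q" "\<And>a p. \<Lambda> (Polynomial.smult a p) = a * \<Lambda> p"
    "\<And>p. p \<in> W \<Longrightarrow> \<Lambda> p = \<phi> p"
proof -
  interpret V: vector_space_pair "Polynomial.smult :: 'k \<Rightarrow> 'k poly \<Rightarrow> 'k poly" "(*) :: 'k \<Rightarrow> 'k \<Rightarrow> 'k"
    by unfold_locales (simp_all add: algebra_simps smult_add_left smult_add_right)
  obtain B where B: "B \<subseteq> W" "V.vs1.independent B" "W \<subseteq> V.vs1.span B"
    by (rule V.vs1.maximal_independent_subset)
  obtain \<Lambda> where \<Lambda>: "Vector_Spaces.linear Polynomial.smult (*) \<Lambda>" "\<And>b. b \<in> B \<Longrightarrow> \<Lambda> b = \<phi> b"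
    using V.linear_independent_extend[OF B(2), of \<phi>] by blast
  have lin: "\<Lambda> (p + q) = \<Lambda> p + \<Lambda> q" "\<Lambda> (Polynomial.smult a p) = a * \<Lambda> p" for p q a
    using Vector_Spaces.linear.axioms(3)[OF \<Lambda>(1)] by (simp_all add: module_hom.add module_hom.scale)
  have "p \<in> W \<and> \<Lambda> p = \<phi> p" if "p \<in> V.vs1.span B" for p
    using that
  proof (induction rule: V.vs1.span_induct_alt)
    case base
    then show ?case using W(1) lin(2)[of 0 0] \<phi>(2)[OF W(1), of 0] by simp
  next
    case (step c x y)
    then show ?case using B(1) W(2,3) \<phi> \<Lambda>(2) lin by (simp add: subset_iff)
  qed
  then show thesis using that lin B(3) by blast
qed

text \<open>
  The \<open>i\<close>-th coordinate of \<open>y\<close> is the coordinate \<open>0\<close> of \<open>w X\<^sup>i y\<close>, so the module of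
  series is \<open>Hom\<^sub>K(wR, K)\<close>, and a homomorphism from \<open>I\<close> to it is the same as a linear functional on \<open>w I \<subseteq> wR = w K[X]\<close>. Extending the functional
  to all polynomials extends the homomorphism.
\<close>

lemma baer_Y: "baer toeplitz_lpa (Y_mod :: ('k::field free set, _) module)"
proof (rule toep_baerI[OF left_module_Y])
  fix I and g :: "'k toep \<Rightarrow> _"
  assume I: "0 \<in> I" "\<And>r s. r \<in> I \<Longrightarrow> s \<in> I \<Longrightarrow> r + s \<in> I" "\<And>r s. s \<in> I \<Longrightarrow> r * s \<in> I"
    and "\<And>r. r \<in> I \<Longrightarrow> g r \<in> carrier Y_mod" and g: "\<And>r s. r \<in> I \<Longrightarrow> s \<in> I \<Longrightarrow> g (r + s) = g r \<oplus>\<^bsub>Y_mod\<^esub> g s"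
      "\<And>r s. s \<in> I \<Longrightarrow> g (r * s) = act Y_mod r (g s)"
  let ?W = "{q. WW * poly_at XX q \<in> I}" and ?\<phi> = "\<lambda>q. g (WW * poly_at XX q) Yw"
  have sm: "WW * poly_at XX (Polynomial.smult a q) = scal a * (WW * poly_at XX q)" for a and q :: "'k poly"
    by (simp add: poly_at_smult scal_left_commute)
  obtain \<Lambda> where \<Lambda>: "\<And>p q. \<Lambda> (p + q) = \<Lambda> p + \<Lambda> q" "\<And>a p. \<Lambda> (Polynomial.smult a p) = a * \<Lambda> p"
    "\<And>p. p \<in> ?W \<Longrightarrow> \<Lambda> p = ?\<phi> p"
    by (rule functional_extend[of ?W ?\<phi>])
       (auto simp: I sm poly_at_add distrib_left g Y_scal Y_simps)
  define y where "y s = (case s of Yw \<Rightarrow> \<Lambda> (monom 1 0) | Ycd n \<Rightarrow> \<Lambda> (monom 1 (Suc n)))" for s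
  have y: "y (ysym_at n) = \<Lambda> (monom 1 n)" for n by (cases n) (simp_all add: y_def)
  have "g r = act Y_mod r y" if r: "r \<in> I" for r
  proof
    fix s
    obtain i where s: "s = ysym_at i" using ysym_at_surj by blast
    obtain q where q: "WW * (XX ^ i * r) = WW * poly_at XX q" using WW_mult_poly by blast
    \<comment> \<open>the coordinate at \<open>s\<close> is the coordinate \<open>0\<close> after applying \<open>w X\<^sup>i\<close>\<close>
    have coord: "act Y_mod (WW * (XX ^ i * r')) z Yw = act Y_mod r' z s" for r' and z :: "ysym \<Rightarrow> 'k"
      using Y_XX_power[of i "act Y_mod r' z" 0] by (simp add: Y_mult Y_WW s)
    have inI: "WW * (XX ^ i * r) \<in> I" using I(3) r by (simp add: mult.assoc[symmetric])
    have "g r s = act Y_mod (WW * (XX ^ i * 1)) (g r) Yw" using coord[of 1 "g r"] Y.act_1 by (simp add: Y_simps)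
    also have "\<dots> = g (WW * (XX ^ i * r)) Yw" using g(2)[OF r, of "WW * XX ^ i"] by (simp add: mult.assoc)
    also have "\<dots> = \<Lambda> q" using inI \<Lambda>(3)[of q] by (simp add: q)
    also have "\<dots> = act Y_mod (WW * poly_at XX q) y Yw"
      using Y_XX_poly[OF \<Lambda>(1,2) y, of q 0] by (simp add: Y_mult Y_WW)
    also have "\<dots> = act Y_mod r y s" by (simp only: q[symmetric] coord)
    finally show "g r s = act Y_mod r y s" .
  qed
  then show "\<exists>d\<in>carrier Y_mod. \<forall>r\<in>I. g r = act Y_mod r d" by (auto simp: Y_simps)
qed

text \<open>
  The series \<open>w\<close>, which generates the simple submodule of \<open>Y_mod\<close>.
\<close>

definition y_w :: "ysym \<Rightarrow> 'k::field"
  where "y_w s = (if s = Yw then 1 else 0)"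

lemma y_w_props: "y_w \<in> carrier Y_mod" "y_w \<noteq> \<zero>\<^bsub>Y_mod\<^esub>" "act Y_mod WW y_w = y_w"
  by (auto simp: Y_simps y_w_def fun_eq_iff Y_WW)

lemma Y_essential:
  assumes "y \<noteq> \<zero>\<^bsub>Y_mod\<^esub>" shows "\<exists>a i. act Y_mod (scal a * (WW * XX ^ i)) y = y_w"
proof -
  obtain s where "y s \<noteq> 0" using assms by (auto simp: Y_simps)
  then obtain i where i: "y (ysym_at i) \<noteq> 0" using ysym_at_surj by metis
  have "act Y_mod (scal (inverse (y (ysym_at i))) * (WW * XX ^ i)) y = y_w"
    using i Y_XX_power[of i y 0] by (auto simp: Y_mult Y_WW Y_scal y_w_def fun_eq_iff)
  then show ?thesis by blast
qed

section \<open>Every nonzero element is detected by a simple module\<close>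

text \<open>
  An element \<open>m \<noteq> 0\<close> with \<open>w m = m\<close> generates a copy of the simple module \<open>Rw\<close>: if \<open>r m = 0\<close> and
  \<open>r w = q(Y) w\<close>, then a power of \<open>X\<close> shows that the leading coefficient of \<open>q\<close> kills \<open>m\<close>. Hence
  \<open>q = 0\<close> and \<open>r w = 0\<close>.
\<close>

lemma W_fixed_annihilator:
  assumes "left_module toeplitz_lpa M" "left_module toeplitz_lpa N"
    and m: "m \<in> carrier M" "m \<noteq> \<zero>\<^bsub>M\<^esub>" "act M WW m = m" and n: "n \<in> carrier N" "act N WW n = n"
    and r: "act M r m = \<zero>\<^bsub>M\<^esub>"
  shows "act N r n = \<zero>\<^bsub>N\<^esub>"
proof -
  interpret M: toep_module M by (rule toep_moduleI) fact
  interpret N: toep_module N by (rule toep_moduleI) fact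
  obtain q where q: "r * WW = poly_at YY q * WW" using mult_WW_poly by blast
  have "act M (poly_at YY q * WW) m = \<zero>\<^bsub>M\<^esub>" using m r by (simp add: q[symmetric] M.act_mult)
  then have "act M (XX ^ degree q * (poly_at YY q * WW)) m = \<zero>\<^bsub>M\<^esub>" using m by (simp add: M.act_mult)
  then have "act M (scal (lead_coeff q)) m = \<zero>\<^bsub>M\<^esub>"
    unfolding XX_power_poly_WW[OF order_refl] using m by (simp add: M.act_mult)
  then have "act M (scal (inverse (lead_coeff q)) * scal (lead_coeff q)) m = \<zero>\<^bsub>M\<^esub>"
    using m by (simp add: M.act_mult)
  then have "q = 0" using m by (cases "q = 0") (simp_all add: scal_mult[symmetric])
  then have "act N (r * WW) n = \<zero>\<^bsub>N\<^esub>" using n by (simp add: q)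
  then show ?thesis using n by (simp add: N.act_mult)
qed

text \<open>
  On a module where \<open>X\<close> is injective, \<open>r\<close> can be replaced by \<open>X\<^sup>n r = X\<^sup>l p(Y)\<close>, and then by \<open>p(Y)\<close>. So
  annihilators need to be compared only for polynomials in \<open>Y\<close>.
\<close>

lemma W_free_annihilator:
  assumes "left_module toeplitz_lpa M" "left_module toeplitz_lpa N"
    and m: "m \<in> carrier M" "toep_module.W_free M m" and n: "n \<in> carrier N" "toep_module.W_free N n"
    and ann: "\<And>p. act M (poly_at YY p) m = \<zero>\<^bsub>M\<^esub> \<Longrightarrow> act N (poly_at YY p) n = \<zero>\<^bsub>N\<^esub>"
    and r: "act M r m = \<zero>\<^bsub>M\<^esub>"
  shows "act N r n = \<zero>\<^bsub>N\<^esub>"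
proof -
  interpret M: toep_module M by (rule toep_moduleI) fact
  interpret N: toep_module N by (rule toep_moduleI) fact
  obtain k q where "XX ^ k * r = poly_at XX q" using XX_power_mult_poly by blast
  moreover obtain l p where "poly_at XX q = XX ^ l * poly_at YY p" using poly_XX_to_YY by blast
  ultimately have e: "XX ^ k * r = XX ^ l * poly_at YY p" by simp
  have "act M (XX ^ l) (act M (poly_at YY p) m) = \<zero>\<^bsub>M\<^esub>"
    using m r by (simp add: M.act_mult[symmetric] e[symmetric]) (simp add: M.act_mult)
  then have "act M (poly_at YY p) m = \<zero>\<^bsub>M\<^esub>"
    using M.W_free_X_power_inj[OF _ M.W_free_act[OF m]] m by blast
  then have "act N (XX ^ k) (act N r n) = \<zero>\<^bsub>N\<^esub>"
    using ann n by (simp add: N.act_mult[symmetric] e) (simp add: N.act_mult)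
  then show ?thesis using N.W_free_X_power_inj[OF _ N.W_free_act[OF n]] n by blast
qed

context U_module
begin

lemma killed_gen_dvd:
  assumes "act U (poly_at YY p) (e (Suc 0)) = \<zero>\<^bsub>U\<^esub>" shows "f dvd p"
proof (rule ccontr)
  assume "\<not> f dvd p"
  then obtain a b where "a * p + b * f = 1" using comaximal_irreducible[OF f_props(1)] unfolding comaximal_def by blast
  from comaximal_act[OF gen_closed this gen_1] show False using assms gen_nonzero by simp
qed

lemma dvd_killed_gen: "f dvd p \<Longrightarrow> act U (poly_at YY p) (e (Suc 0)) = \<zero>\<^bsub>U\<^esub>"
  using gen_closed gen_1 by (auto simp: dvd_def poly_at_mult act_mult poly_at_act_commute)

end

lemma linear_in_irred_polys: "[:-1, 1:] \<in> (irred_polys :: 'k::field poly set)"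
  by (simp add: irred_polys_def irreducible_linear_field_poly)

text \<open>
  If no nonzero multiple of \<open>m\<close> is killed by a nonzero polynomial, any \<open>f\<close> will do. Otherwise take a
  polynomial \<open>p\<close> of least degree killing a nonzero multiple of \<open>m\<close>: a proper factor of \<open>p\<close> or a
  cancelled factor \<open>x\<close> would give a smaller one, so \<open>p\<close> is irreducible with \<open>p(0) \<noteq> 0\<close>, and it can be
  normalised to constant term \<open>- 1\<close>.
\<close>

lemma (in toep_module) irreducible_multiple:
  assumes m: "m \<in> carrier M" "m \<noteq> \<zero>\<^bsub>M\<^esub>"
  shows "\<exists>r f. act M r m \<noteq> \<zero>\<^bsub>M\<^esub> \<and> (\<forall>p. act M (poly_at YY p) (act M r m) = \<zero>\<^bsub>M\<^esub> \<longrightarrow> f dvd p)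
    \<and> f \<in> irred_polys"
proof (cases "\<exists>p r. p \<noteq> 0 \<and> act M r m \<noteq> \<zero>\<^bsub>M\<^esub> \<and> act M (poly_at YY p) (act M r m) = \<zero>\<^bsub>M\<^esub>")
  case False
  have "act M (poly_at YY p) (act M 1 m) = \<zero>\<^bsub>M\<^esub> \<longrightarrow> [:-1, 1:] dvd p" for p
  proof
    assume "act M (poly_at YY p) (act M 1 m) = \<zero>\<^bsub>M\<^esub>"
    moreover have "act M 1 m \<noteq> \<zero>\<^bsub>M\<^esub>" using m by simp
    ultimately have "p = 0" using False by blast
    then show "[:-1, 1:] dvd p" by simp
  qed
  moreover have "act M 1 m \<noteq> \<zero>\<^bsub>M\<^esub>" using m by simp
  ultimately show ?thesis using linear_in_irred_polys by metis
next
  case True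
  let ?P = "\<lambda>p. p \<noteq> 0 \<and> (\<exists>r. act M r m \<noteq> \<zero>\<^bsub>M\<^esub> \<and> act M (poly_at YY p) (act M r m) = \<zero>\<^bsub>M\<^esub>)"
  from True obtain p where p: "?P p" and min: "\<And>q. ?P q \<Longrightarrow> degree p \<le> degree q"
    using ex_has_least_nat[of ?P _ degree] by metis
  then obtain r where r: "act M r m \<noteq> \<zero>\<^bsub>M\<^esub>" "act M (poly_at YY p) (act M r m) = \<zero>\<^bsub>M\<^esub>" by blast
  let ?m = "act M r m"
  have mc: "?m \<in> carrier M" using m by simp
  have nz: "act M (poly_at YY q) ?m \<noteq> \<zero>\<^bsub>M\<^esub>" if "q \<noteq> 0" "degree q < degree p" for q
    using min[of q] that r by force
  have "\<not> is_unit p"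
  proof
    assume "is_unit p"
    then obtain q where "1 = p * q" by (auto simp: dvd_def)
    then have "act M (poly_at YY q) (act M (poly_at YY p) ?m) = ?m"
      using mc by (simp add: act_mult[symmetric] poly_at_mult[symmetric] mult.commute[of q])
    then show False using r by simp
  qed
  moreover have "is_unit a \<or> is_unit b" if ab: "p = a * b" for a b
  proof (rule ccontr)
    assume n: "\<not> (is_unit a \<or> is_unit b)"
    have "a \<noteq> 0" "b \<noteq> 0" using ab p by auto
    then have "degree a > 0" "degree b > 0" using n is_unit_iff_degree by blast+
    then have d: "degree a < degree p" "degree b < degree p"
      using \<open>a \<noteq> 0\<close> \<open>b \<noteq> 0\<close> by (simp_all add: ab degree_mult_eq)
    have "act M (poly_at YY a) (act M (poly_at YY b * r) m) = \<zero>\<^bsub>M\<^esub>"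
      using r m by (simp add: ab poly_at_mult act_mult)
    moreover have "act M (poly_at YY b * r) m \<noteq> \<zero>\<^bsub>M\<^esub>" using nz[OF \<open>b \<noteq> 0\<close> d(2)] m by (simp add: act_mult)
    ultimately show False using min[of a] \<open>a \<noteq> 0\<close> d(1) by force
  qed
  ultimately have irr: "irreducible p" using p by (auto intro: irreducibleI)
  have p0: "poly p 0 \<noteq> 0"
  proof
    assume "poly p 0 = 0"
    then obtain q where q: "p = pCons 0 q" by (cases p) simp
    then have "q \<noteq> 0" "degree q < degree p" using p by auto
    \<comment> \<open>\<open>X\<close> cancels the factor \<open>Y\<close> of \<open>p(Y) = Y q(Y)\<close>.\<close>
    have "act M XX (act M (poly_at YY p) ?m) = act M (poly_at YY q) ?m"
      using mc by (simp add: q act_mult[symmetric] XX_YY_mult)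
    then show False using nz[OF \<open>q \<noteq> 0\<close> \<open>degree q < degree p\<close>] r by simp
  qed
  \<comment> \<open>normalised to constant term \<open>- 1\<close>\<close>
  define f where "f = [:- inverse (poly p 0):] * p"
  have unit: "is_unit [:- inverse (poly p 0):]" using p0 by (simp add: is_unit_const_poly_iff dvd_field_iff)
  have "f \<in> irred_polys"
    using irr p0 unit by (simp add: irred_polys_def f_def irreducible_mult_unit_left del: mult_pCons_left)
  have dv: "p dvd q" if "act M (poly_at YY q) ?m = \<zero>\<^bsub>M\<^esub>" for q
  proof (rule ccontr)
    assume "\<not> p dvd q"
    then obtain a b where "a * q + b * p = 1" using comaximal_irreducible[OF irr] unfolding comaximal_def by blast
    from comaximal_act[OF mc this r(2)] show False using that r by simp
  qed
  have "f dvd p" using unit unfolding f_def by (simp add: mult_unit_dvd_iff' del: mult_pCons_left)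
  then have "\<forall>q. act M (poly_at YY q) ?m = \<zero>\<^bsub>M\<^esub> \<longrightarrow> f dvd q" using dv dvd_trans by blast
  then show ?thesis using r \<open>f \<in> irred_polys\<close> by blast
qed

text \<open>
  The generator of the simple submodule of \<open>U\<^sup>f\<close>, as an element of the direct sum.
\<close>

definition U_single :: "'k::field poly \<Rightarrow> 'k poly \<Rightarrow> (nat \<times> 'k free set set) set"
  where "U_single f = (\<lambda>g\<in>irred_polys. if g = f then U_gen f (Suc 0) else \<zero>\<^bsub>U_mod g\<^esub>)"

lemma U_single_props:
  assumes f: "f \<in> irred_polys"
  shows "U_single f \<in> carrier D_mod" "U_single f \<noteq> \<zero>\<^bsub>D_mod\<^esub>"
    "act (U_mod f) r (U_gen f (Suc 0)) = \<zero>\<^bsub>U_mod f\<^esub> \<Longrightarrow> act D_mod r (U_single f) = \<zero>\<^bsub>D_mod\<^esub>"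
proof -
  interpret U_module f by unfold_locales (rule f)
  have z: "\<zero>\<^bsub>U_mod g\<^esub> \<in> carrier (U_mod g)" "act (U_mod g) r \<zero>\<^bsub>U_mod g\<^esub> = \<zero>\<^bsub>U_mod g\<^esub>" for g :: "'a poly" and r
  proof -
    interpret G: toep_module "U_mod g" by (rule toep_moduleI[OF left_module_U])
    show "\<zero>\<^bsub>U_mod g\<^esub> \<in> carrier (U_mod g)" "act (U_mod g) r \<zero>\<^bsub>U_mod g\<^esub> = \<zero>\<^bsub>U_mod g\<^esub>" by auto
  qed
  have "{g \<in> irred_polys. U_single f g \<noteq> \<zero>\<^bsub>U_mod g\<^esub>} \<subseteq> {f}" by (auto simp: U_single_def)
  then have "finite {g \<in> irred_polys. U_single f g \<noteq> \<zero>\<^bsub>U_mod g\<^esub>}" by (rule finite_subset) simp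
  then show "U_single f \<in> carrier D_mod" using z gen_closed by (auto simp: D_carrier U_single_def)
  show "U_single f \<noteq> \<zero>\<^bsub>D_mod\<^esub>"
    using gen_nonzero f by (auto simp: D_zero U_single_def fun_eq_iff)
  show "act (U_mod f) r (U_gen f (Suc 0)) = \<zero>\<^bsub>U_mod f\<^esub> \<Longrightarrow> act D_mod r (U_single f) = \<zero>\<^bsub>D_mod\<^esub>"
    unfolding D_act D_zero
  proof (rule restrict_ext)
    fix g :: "'a poly"
    assume "act (U_mod f) r (U_gen f (Suc 0)) = \<zero>\<^bsub>U_mod f\<^esub>" "g \<in> irred_polys"
    then show "act (U_mod g) r (U_single f g) = \<zero>\<^bsub>U_mod g\<^esub>"
      by (cases "g = f") (simp_all add: U_single_def z)
  qed
qed

abbreviation C_mod :: "('k::field free set, (ysym \<Rightarrow> 'k) \<times> ('k poly \<Rightarrow> (nat \<times> 'k free set set) set)) module"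
  where "C_mod \<equiv> sum2_lmod Y_mod D_mod"

lemma C_simps: "carrier C_mod = carrier Y_mod \<times> carrier D_mod"
  "\<zero>\<^bsub>C_mod\<^esub> = (\<zero>\<^bsub>Y_mod\<^esub>, \<zero>\<^bsub>D_mod\<^esub>)" "act C_mod r (y, x) = (act Y_mod r y, act D_mod r x)"
  "(y, x) \<oplus>\<^bsub>C_mod\<^esub> (y', x') = (y \<oplus>\<^bsub>Y_mod\<^esub> y', x \<oplus>\<^bsub>D_mod\<^esub> x')"
  by (simp_all add: sum2_lmod_def act_def)

lemma left_module_C: "left_module toeplitz_lpa C_mod"
  by (rule left_module_sum2[OF left_module_Y left_module_D])

lemma baer_C: "baer toeplitz_lpa C_mod"
  by (rule baer_sum2[OF baer_Y baer_D])

lemma baer_act_hom: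
  assumes "left_module toeplitz_lpa M" "left_module toeplitz_lpa N" "baer toeplitz_lpa N" "m \<in> carrier M" "n \<in> carrier N"
    and "\<And>r. act M r m = \<zero>\<^bsub>M\<^esub> \<Longrightarrow> act N r n = \<zero>\<^bsub>N\<^esub>"
  obtains h where "h \<in> lmod_hom toeplitz_lpa M N" "h m = n"
proof (rule baer_hom_through[OF assms(1-5)])
  fix r assume "r \<in> carrier toeplitz_lpa" "r \<odot>\<^bsub>M\<^esub> m = \<zero>\<^bsub>M\<^esub>"
  then show "r \<odot>\<^bsub>N\<^esub> n = \<zero>\<^bsub>N\<^esub>" using assms(6) cls_surj[of r] by (auto simp: act_def)
qed (rule that)

text \<open>
  If some \<open>w X\<^sup>j m\<close> is nonzero, it generates a copy of \<open>Rw\<close>, which maps onto the simple submodule of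
  \<open>Y_mod\<close>. Otherwise a multiple of \<open>m\<close> maps onto the simple submodule of some \<open>U\<^sup>f\<close>. In both cases the map
  extends to the whole module by injectivity.
\<close>

lemma C_separates:
  fixes M :: "('k::field free set, 'a, 'm) module_scheme"
  assumes M: "left_module toeplitz_lpa M" and m: "m \<in> carrier M" "m \<noteq> \<zero>\<^bsub>M\<^esub>"
  shows "\<exists>h\<in>lmod_hom toeplitz_lpa M C_mod. h m \<noteq> \<zero>\<^bsub>C_mod\<^esub>"
proof -
  interpret M: toep_module M by (rule toep_moduleI) fact
  interpret C: toep_module "C_mod :: ('k free set, _) module" by (rule toep_moduleI[OF left_module_C])
  interpret D: toep_module "D_mod :: ('k free set, _) module" by (rule toep_moduleI[OF left_module_D])
  have reduce: ?thesis if n: "n \<in> carrier C_mod" "n \<noteq> \<zero>\<^bsub>C_mod\<^esub>"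
    and ann: "\<And>s. act M s (act M r m) = \<zero>\<^bsub>M\<^esub> \<Longrightarrow> act C_mod s n = \<zero>\<^bsub>C_mod\<^esub>" for r n
  proof -
    obtain h where h: "h \<in> lmod_hom toeplitz_lpa M C_mod" "h (act M r m) = n"
      using baer_act_hom[OF M left_module_C baer_C _ n(1) ann] m by blast
    then have "act C_mod r (h m) = n" using hom_act[OF h(1) m(1)] by simp
    then have "h m \<noteq> \<zero>\<^bsub>C_mod\<^esub>" using n(2) by auto
    then show ?thesis using h(1) by blast
  qed
  show ?thesis
  proof (cases "M.W_free m")
    case False
    then obtain j where j: "act M (WW * XX ^ j) m \<noteq> \<zero>\<^bsub>M\<^esub>" by (auto simp: M.W_free_def)
    have w: "act M WW (act M (WW * XX ^ j) m) = act M (WW * XX ^ j) m"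
      using m by (simp add: M.act_mult[symmetric] mult.assoc[symmetric] WW_WW)
    show ?thesis
    proof (rule reduce[of "(y_w, \<zero>\<^bsub>D_mod\<^esub>)"])
      show "(y_w, \<zero>\<^bsub>D_mod\<^esub>) \<in> carrier C_mod" "(y_w, \<zero>\<^bsub>D_mod\<^esub>) \<noteq> \<zero>\<^bsub>C_mod\<^esub>"
        using y_w_props by (auto simp: C_simps)
      show "act C_mod s (y_w, \<zero>\<^bsub>D_mod\<^esub>) = \<zero>\<^bsub>C_mod\<^esub>" if "act M s (act M (WW * XX ^ j) m) = \<zero>\<^bsub>M\<^esub>" for s
        using W_fixed_annihilator[OF M left_module_Y _ j w y_w_props(1,3) that] m by (simp add: C_simps)
    qed
  next
    case True
    obtain r f where rf: "act M r m \<noteq> \<zero>\<^bsub>M\<^esub>" "\<And>p. act M (poly_at YY p) (act M r m) = \<zero>\<^bsub>M\<^esub> \<Longrightarrow> f dvd p" "f \<in> irred_polys"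
      using M.irreducible_multiple[OF m] by blast
    interpret U: U_module f by unfold_locales (rule rf)
    show ?thesis
    proof (rule reduce[of "(\<zero>\<^bsub>Y_mod\<^esub>, U_single f)"])
      show "(\<zero>\<^bsub>Y_mod\<^esub>, U_single f) \<in> carrier C_mod" "(\<zero>\<^bsub>Y_mod\<^esub>, U_single f) \<noteq> \<zero>\<^bsub>C_mod\<^esub>"
        using U_single_props(1,2)[OF rf(3)] by (auto simp: C_simps)
      show "act C_mod s (\<zero>\<^bsub>Y_mod\<^esub>, U_single f) = \<zero>\<^bsub>C_mod\<^esub>" if "act M s (act M r m) = \<zero>\<^bsub>M\<^esub>" for s
      proof -
        have "act (U_mod f) s (U_gen f (Suc 0)) = \<zero>\<^bsub>U_mod f\<^esub>"
          using W_free_annihilator[OF M left_module_U _ M.W_free_act[OF m(1) True] U.gen_closed U.gen_W_free _ that]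
            m U.dvd_killed_gen rf(2) by blast
        then show ?thesis using U_single_props(3)[OF rf(3)] by (simp add: C_simps)
      qed
    qed
  qed
qed

section \<open>Cogenerators\<close>

lemma hom_inj_of_kernel:
  assumes "left_module R M" "left_module R N" "h \<in> lmod_hom R M N"
    and ker: "\<And>x. x \<in> carrier M \<Longrightarrow> x \<noteq> \<zero>\<^bsub>M\<^esub> \<Longrightarrow> h x \<noteq> \<zero>\<^bsub>N\<^esub>"
  shows "inj_on h (carrier M)"
proof (rule inj_onI)
  interpret M: left_module R M by fact
  interpret N: left_module R N by fact
  note h = lmod_homD[OF assms(3)]
  fix x y assume xy: "x \<in> carrier M" "y \<in> carrier M" "h x = h y"
  have "h (\<ominus>\<^bsub>M\<^esub> y) = \<ominus>\<^bsub>N\<^esub> h y"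
    using h(3)[of "\<ominus>\<^bsub>R\<^esub> \<one>\<^bsub>R\<^esub>" y] xy h(1) by (simp add: M.smult_minus_one N.smult_minus_one)
  then have "h (x \<oplus>\<^bsub>M\<^esub> \<ominus>\<^bsub>M\<^esub> y) = \<zero>\<^bsub>N\<^esub>"
    using h(2)[of x "\<ominus>\<^bsub>M\<^esub> y"] xy h(1) by (simp add: N.M.r_neg)
  then have "x \<oplus>\<^bsub>M\<^esub> \<ominus>\<^bsub>M\<^esub> y = \<zero>\<^bsub>M\<^esub>" using ker[of "x \<oplus>\<^bsub>M\<^esub> \<ominus>\<^bsub>M\<^esub> y"] xy by auto
  then show "x = y" using xy M.M.minus_equality[of x "\<ominus>\<^bsub>M\<^esub> y"] by simp
qed

text \<open>
  For each nonzero \<open>m\<close> one homomorphism that does not vanish at \<open>m\<close> is enough: together they are the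
  coordinates of an embedding into a power of \<open>C\<close> indexed by the nonzero elements.
\<close>

lemma cogenerator_of_separates:
  assumes C: "left_module R C"
    and sep: "\<And>(M :: ('r, 'u) module) m. left_module R M \<Longrightarrow> m \<in> carrier M \<Longrightarrow> m \<noteq> \<zero>\<^bsub>M\<^esub>
      \<Longrightarrow> \<exists>h\<in>lmod_hom R M C. h m \<noteq> \<zero>\<^bsub>C\<^esub>"
  shows "cogenerator_lmod TYPE('u) R (C :: ('r, 'a, 'm) module_scheme)"
  unfolding cogenerator_lmod_def
proof (intro conjI allI impI)
  fix M :: "('r, 'u) module"
  assume M: "left_module R M"
  interpret M: left_module R M by fact
  interpret C: left_module R C by fact
  define I where "I = carrier M - {\<zero>\<^bsub>M\<^esub>}"
  obtain h where h: "\<And>m. m \<in> I \<Longrightarrow> h m \<in> lmod_hom R M C \<and> h m m \<noteq> \<zero>\<^bsub>C\<^esub>"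
    using sep[OF M] unfolding I_def by (metis DiffE singletonI)
  let ?h = "\<lambda>x. \<lambda>m\<in>I. h m x"
  let ?P = "prod_lmod I (\<lambda>_. C)"
  have hom: "?h \<in> lmod_hom R M ?P"
  proof -
    have "h m x \<in> carrier C" "y \<in> carrier M \<Longrightarrow> h m (x \<oplus>\<^bsub>M\<^esub> y) = h m x \<oplus>\<^bsub>C\<^esub> h m y"
      "r \<in> carrier R \<Longrightarrow> h m (r \<odot>\<^bsub>M\<^esub> x) = r \<odot>\<^bsub>C\<^esub> h m x"
      if "m \<in> I" "x \<in> carrier M" for m x y r
      using lmod_homD[of "h m" R M C] h[of m] that by auto
    then show ?thesis by (intro lmod_homI) (auto simp: prod_lmod_def intro!: restrict_ext)
  qed
  have "inj_on ?h (carrier M)"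
  proof (rule inj_onI)
    fix x y assume xy: "x \<in> carrier M" "y \<in> carrier M" "?h x = ?h y"
    let ?d = "x \<oplus>\<^bsub>M\<^esub> \<ominus>\<^bsub>M\<^esub> y"
    show "x = y"
    proof (rule ccontr)
      assume "x \<noteq> y"
      then have d: "?d \<in> I" using xy M.M.minus_equality[of x "\<ominus>\<^bsub>M\<^esub> y"] by (auto simp: I_def)
      note hd = lmod_homD[OF conjunct1[OF h[OF d]]]
      have "h ?d x = h ?d y" using xy(3) d by (metis (no_types, lifting) restrict_apply')
      moreover have "h ?d (\<ominus>\<^bsub>M\<^esub> y) = \<ominus>\<^bsub>C\<^esub> h ?d y"
        using hd(3)[of "\<ominus>\<^bsub>R\<^esub> \<one>\<^bsub>R\<^esub>" y] xy hd(1) by (simp add: M.smult_minus_one C.smult_minus_one)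
      ultimately have "h ?d ?d = \<zero>\<^bsub>C\<^esub>" using hd(2)[of x "\<ominus>\<^bsub>M\<^esub> y"] xy hd(1) by (simp add: C.M.r_neg)
      then show False using h[OF d] by blast
    qed
  qed
  with hom show "\<exists>I :: 'u set. lmod_embeds R M (prod_lmod I (\<lambda>_. C))"
    unfolding lmod_embeds_def by blast
qed (rule C)

lemma cogenerator_separates:
  assumes E: "cogenerator_lmod TYPE('u) R E"
    and M: "left_module R (M :: ('r, 'u) module)" and m: "m \<in> carrier M" "m \<noteq> \<zero>\<^bsub>M\<^esub>"
  obtains h where "h \<in> lmod_hom R M E" "h m \<noteq> \<zero>\<^bsub>E\<^esub>"
proof -
  interpret M: left_module R M by fact
  have "left_module R E" using E by (simp add: cogenerator_lmod_def)
  then interpret E: left_module R E .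
  obtain I :: "'u set" and h where h: "h \<in> lmod_hom R M (prod_lmod I (\<lambda>_. E))" "inj_on h (carrier M)"
    using E M unfolding cogenerator_lmod_def lmod_embeds_def by blast
  note hd = lmod_homD[OF h(1)]
  have comp: "(\<lambda>x. h x i) \<in> lmod_hom R M E" if "i \<in> I" for i
    by (rule lmod_homI) (use hd that in \<open>auto simp: prod_lmod_def PiE_iff\<close>)
  have "\<exists>i\<in>I. h m i \<noteq> \<zero>\<^bsub>E\<^esub>"
  proof (rule ccontr)
    assume "\<not> ?thesis"
    then have "h m i = h \<zero>\<^bsub>M\<^esub> i" if "i \<in> I" for i
      using lmod_hom_zero[OF M \<open>left_module R E\<close> comp[OF that]] that by auto
    moreover have "h m \<in> extensional I" "h \<zero>\<^bsub>M\<^esub> \<in> extensional I"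
      using hd(1)[OF m(1)] hd(1)[of "\<zero>\<^bsub>M\<^esub>"] by (auto simp: prod_lmod_def PiE_iff)
    ultimately have "h m = h \<zero>\<^bsub>M\<^esub>" by (rule_tac extensionalityI) auto
    then show False using h(2) m by (auto dest: inj_onD)
  qed
  then show thesis using comp that by blast
qed

lemma M_el_0_eq_iff: "M_el 0 (Suc 0) r = M_el 0 (Suc 0) s \<longleftrightarrow> r = s"
  by (simp add: M_el_eq_iff)

section \<open>Minimality\<close>

text \<open>
  The universe \<^typ>\<open>'k free set set\<close> contains the quotients of the algebra, and so cogeneration in it
  places every simple module in \<open>E\<close>.
\<close>

locale injective_cogenerator =
  fixes E :: "('k::field free set, 'e) module"
  assumes E: "left_module toeplitz_lpa E" "baer toeplitz_lpa E"
    and cogen: "cogenerator_lmod TYPE('k free set set) toeplitz_lpa E"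
begin

sublocale toep_module E
  by (rule toep_moduleI) (rule E)

lemma W_fixed_element: obtains n where "n \<in> carrier E" "n \<noteq> \<zero>\<^bsub>E\<^esub>" "act E WW n = n"
proof -
  \<comment> \<open>\<open>R/R0\<close> is a copy of \<open>R\<close> in the right universe, and \<open>w \<noteq> 0\<close> in \<open>R\<close>.\<close>
  let ?M = "M_mod (0 :: 'k poly) (Suc 0)"
  have "(WW :: 'k toep) \<noteq> 0"
  proof
    assume "(WW :: 'k toep) = 0"
    then have "act Y_mod (WW :: 'k toep) y_w = \<zero>\<^bsub>Y_mod\<^esub>" using Y.act_0 by (simp add: Y_simps)
    moreover have "act Y_mod (WW :: 'k toep) y_w = y_w" by (rule y_w_props(3))
    moreover have "y_w \<noteq> (\<zero>\<^bsub>Y_mod\<^esub> :: ysym \<Rightarrow> 'k)" by (rule y_w_props(2))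
    ultimately show False by simp
  qed
  then have "M_el 0 (Suc 0) WW \<noteq> \<zero>\<^bsub>?M\<^esub>" by (simp add: M_el_zero M_el_0_eq_iff)
  then obtain h where h: "h \<in> lmod_hom toeplitz_lpa ?M E" "h (M_el 0 (Suc 0) WW) \<noteq> \<zero>\<^bsub>E\<^esub>"
    by (rule cogenerator_separates[OF cogen left_module_M M_el_closed])
  have "act E WW (h (M_el 0 (Suc 0) WW)) = h (M_el 0 (Suc 0) WW)"
    by (simp add: hom_act[OF h(1), symmetric] M_el_act WW_WW)
  then show thesis by (rule that[OF lmod_homD(1)[OF h(1) M_el_closed] h(2)])
qed

lemma irreducible_killed_element:
  assumes f: "f \<in> irred_polys"
  obtains n where "n \<in> carrier E" "n \<noteq> \<zero>\<^bsub>E\<^esub>" "W_free n" "act E (poly_at YY f) n = \<zero>\<^bsub>E\<^esub>"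
proof -
  let ?M = "M_mod f 1"
  have ne: "M_el f 1 1 \<noteq> M_el f 1 0"
  proof
    assume "M_el f 1 1 = M_el f 1 0"
    then obtain t where "t * poly_at CC f = poly_at CC 1" unfolding M_el_eq_iff by auto
    then have "f dvd 1" using f by (intro poly_at_CC_mult_dvd) (auto simp: irred_polys_def)
    then show False using f by (auto simp: irred_polys_def irreducible_def)
  qed
  obtain h where h: "h \<in> lmod_hom toeplitz_lpa ?M E" "h (M_el f 1 1) \<noteq> \<zero>\<^bsub>E\<^esub>"
    by (rule cogenerator_separates[OF cogen left_module_M M_el_closed ne[folded M_el_zero]])
  let ?n = "h (M_el f 1 1)"
  have n: "?n \<in> carrier E" using lmod_homD(1)[OF h(1)] by simp
  have "M_el f 1 (poly_at CC f) = M_el f 1 0" unfolding M_el_eq_iff by (rule exI[of _ 1]) simp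
  then have "act E (poly_at CC f) ?n = h (M_el f 1 0)"
    by (simp add: hom_act[OF h(1), symmetric] M_el_act)
  also have "\<dots> = \<zero>\<^bsub>E\<^esub>" using lmod_hom_zero[OF left_module_M E(1) h(1)] by (simp add: M_el_zero)
  finally have k: "act E (poly_at CC f) ?n = \<zero>\<^bsub>E\<^esub>" .
  have "W_free ?n" by (rule W_free_of_killed[OF n _ k]) (use f in \<open>auto simp: irred_polys_def\<close>)
  then show thesis using that n h(2) k W_free_poly_at_CC[OF n] by metis
qed

lemma hom_from_Y: obtains k where "k \<in> lmod_hom toeplitz_lpa Y_mod E" "k y_w \<noteq> \<zero>\<^bsub>E\<^esub>"
proof -
  obtain n where n: "n \<in> carrier E" "n \<noteq> \<zero>\<^bsub>E\<^esub>" "act E WW n = n" by (rule W_fixed_element)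
  obtain k where "k \<in> lmod_hom toeplitz_lpa Y_mod E" "k y_w = n"
    using baer_act_hom[OF left_module_Y E y_w_props(1) n(1)]
      W_fixed_annihilator[OF left_module_Y E(1) y_w_props n(1,3)] by blast
  then show thesis using that n by blast
qed

lemma hom_from_U:
  assumes f: "f \<in> irred_polys"
  shows "\<exists>k\<in>lmod_hom toeplitz_lpa (U_mod f) E. k (U_gen f (Suc 0)) \<noteq> \<zero>\<^bsub>E\<^esub>"
proof -
  interpret U: U_module f by unfold_locales (rule f)
  obtain n where n: "n \<in> carrier E" "n \<noteq> \<zero>\<^bsub>E\<^esub>" "W_free n" "act E (poly_at YY f) n = \<zero>\<^bsub>E\<^esub>"
    by (rule irreducible_killed_element[OF f])
  have "act E (poly_at YY p) n = \<zero>\<^bsub>E\<^esub>" if "act (U_mod f) (poly_at YY p) (U_gen f (Suc 0)) = \<zero>\<^bsub>U_mod f\<^esub>" for p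
  proof -
    have "f dvd p" by (rule U.killed_gen_dvd[OF that])
    then obtain q where "p = q * f" by (metis dvd_def mult.commute)
    then show ?thesis using n by (simp add: poly_at_mult act_mult)
  qed
  then obtain k where "k \<in> lmod_hom toeplitz_lpa (U_mod f) E" "k (U_gen f (Suc 0)) = n"
    using baer_act_hom[OF left_module_U E U.gen_closed n(1)]
      W_free_annihilator[OF left_module_U E(1) U.gen_closed U.gen_W_free n(1,3)] by blast
  then show ?thesis using n by blast
qed

lemma act_finsum:
  assumes "finite A" "\<And>i. i \<in> A \<Longrightarrow> x i \<in> carrier E"
  shows "act E r (\<Oplus>\<^bsub>E\<^esub>i\<in>A. x i) = (\<Oplus>\<^bsub>E\<^esub>i\<in>A. act E r (x i))"
  using assms by (induction A rule: finite_induct) (simp_all add: act_add_right M.finsum_insert Pi_iff)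

lemma finsum_superset:
  assumes "finite B" "A \<subseteq> B" "\<And>i. i \<in> B - A \<Longrightarrow> x i = \<zero>\<^bsub>E\<^esub>" "\<And>i. i \<in> B \<Longrightarrow> x i \<in> carrier E"
  shows "(\<Oplus>\<^bsub>E\<^esub>i\<in>A. x i) = (\<Oplus>\<^bsub>E\<^esub>i\<in>B. x i)"
  using M.add.finprod_mono_neutral_cong_left[of B A x x] assms by (simp add: finsum_def Pi_iff)

text \<open>
  Homomorphisms from the summands \<open>U\<^sup>f\<close> are added up. The sum of the values runs over the support of
  the argument; it may be taken over any larger finite set, and a common one is used for additivity.
\<close>

lemma hom_from_D:
  obtains k where "k \<in> lmod_hom toeplitz_lpa D_mod E" "\<And>f. f \<in> irred_polys \<Longrightarrow> k (U_single f) \<noteq> \<zero>\<^bsub>E\<^esub>"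
proof -
  obtain k where k: "\<And>f. f \<in> irred_polys \<Longrightarrow> k f \<in> lmod_hom toeplitz_lpa (U_mod f) E"
    "\<And>f. f \<in> irred_polys \<Longrightarrow> k f (U_gen f (Suc 0)) \<noteq> \<zero>\<^bsub>E\<^esub>"
    using hom_from_U by metis
  define supp where "supp x = {f \<in> irred_polys. x f \<noteq> \<zero>\<^bsub>U_mod f\<^esub>}" for x :: "'k poly \<Rightarrow> (nat \<times> 'k free set set) set"
  define h where "h x = (\<Oplus>\<^bsub>E\<^esub>f\<in>supp x. k f (x f))" for x
  have kc: "k f (x f) \<in> carrier E" if "x \<in> carrier D_mod" "f \<in> irred_polys" for x f
    using lmod_homD(1)[OF k(1)[OF that(2)]] that by (simp add: D_carrier)
  have k0: "k f \<zero>\<^bsub>U_mod f\<^esub> = \<zero>\<^bsub>E\<^esub>" if "f \<in> irred_polys" for f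
    by (rule lmod_hom_zero[OF left_module_U E(1) k(1)[OF that]])
  have h: "h x = (\<Oplus>\<^bsub>E\<^esub>f\<in>B. k f (x f))" if "x \<in> carrier D_mod" "finite B" "supp x \<subseteq> B" "B \<subseteq> irred_polys" for x B
    unfolding h_def by (rule finsum_superset) (use that kc k0 in \<open>auto simp: supp_def\<close>)
  have fin: "finite (supp x)" "supp x \<subseteq> irred_polys" if "x \<in> carrier D_mod" for x
    using that by (auto simp: supp_def D_carrier)
  interpret D: toep_module "D_mod :: ('k free set, _) module" by (rule toep_moduleI[OF left_module_D])
  have "h \<in> lmod_hom toeplitz_lpa D_mod E"
  proof (rule hom_actI)
    fix x :: "'k poly \<Rightarrow> (nat \<times> 'k free set set) set"
    assume x: "x \<in> carrier D_mod"
    then show "h x \<in> carrier E" unfolding h_def using kc fin(2) by (intro M.finsum_closed) (auto simp: Pi_iff)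
    fix r
    let ?B = "supp x \<union> supp (act D_mod r x)"
    have B: "finite ?B" "?B \<subseteq> irred_polys" using fin x by auto
    have "h (act D_mod r x) = (\<Oplus>\<^bsub>E\<^esub>f\<in>?B. k f (act D_mod r x f))" using x B by (intro h) auto
    also have "\<dots> = (\<Oplus>\<^bsub>E\<^esub>f\<in>?B. act E r (k f (x f)))"
    proof (rule M.finsum_cong')
      fix f assume "f \<in> ?B"
      then have f: "f \<in> irred_polys" using B by blast
      then show "k f (act D_mod r x f) = act E r (k f (x f))"
        using hom_act[OF k(1)[OF f], of "x f" r] x by (simp add: D_act D_carrier)
    qed (use kc x B in auto)
    also have "\<dots> = act E r (\<Oplus>\<^bsub>E\<^esub>f\<in>?B. k f (x f))" 
      by (rule act_finsum[OF B(1), symmetric]) (use kc[OF x] B(2) in blast)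
    also have "(\<Oplus>\<^bsub>E\<^esub>f\<in>?B. k f (x f)) = h x" using x B by (intro h[symmetric]) auto
    finally show "h (act D_mod r x) = act E r (h x)" .
  next
    fix x y :: "'k poly \<Rightarrow> (nat \<times> 'k free set set) set"
    assume xy: "x \<in> carrier D_mod" "y \<in> carrier D_mod"
    let ?z = "x \<oplus>\<^bsub>D_mod\<^esub> y" and ?B = "supp x \<union> supp y \<union> supp (x \<oplus>\<^bsub>D_mod\<^esub> y)"
    have B: "finite ?B" "?B \<subseteq> irred_polys" using fin xy by auto
    have "h ?z = (\<Oplus>\<^bsub>E\<^esub>f\<in>?B. k f (?z f))" using xy B by (intro h) auto
    also have "\<dots> = (\<Oplus>\<^bsub>E\<^esub>f\<in>?B. k f (x f) \<oplus>\<^bsub>E\<^esub> k f (y f))"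
    proof (rule M.finsum_cong')
      fix f assume "f \<in> ?B"
      then have f: "f \<in> irred_polys" using B by blast
      then show "k f (?z f) = k f (x f) \<oplus>\<^bsub>E\<^esub> k f (y f)"
        using lmod_homD(2)[OF k(1)[OF f], of "x f" "y f"] xy by (simp add: D_add D_carrier)
    qed (use kc xy B in auto)
    also have "\<dots> = (\<Oplus>\<^bsub>E\<^esub>f\<in>?B. k f (x f)) \<oplus>\<^bsub>E\<^esub> (\<Oplus>\<^bsub>E\<^esub>f\<in>?B. k f (y f))"
      using kc xy B by (intro M.finsum_addf) (auto simp: Pi_iff)
    also have "(\<Oplus>\<^bsub>E\<^esub>f\<in>?B. k f (x f)) = h x" using xy B by (intro h[symmetric]) auto
    also have "(\<Oplus>\<^bsub>E\<^esub>f\<in>?B. k f (y f)) = h y" using xy B by (intro h[symmetric]) auto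
    finally show "h ?z = h x \<oplus>\<^bsub>E\<^esub> h y" .
  qed
  moreover have "h (U_single f) \<noteq> \<zero>\<^bsub>E\<^esub>" if f: "f \<in> irred_polys" for f
  proof -
    have "supp (U_single f) \<subseteq> {f}" by (auto simp: supp_def U_single_def)
    then have "h (U_single f) = (\<Oplus>\<^bsub>E\<^esub>g\<in>{f}. k g (U_single f g))"
      using f U_single_props(1) by (intro h) auto
    also have "\<dots> = k f (U_single f f)" 
      using kc[OF U_single_props(1)[OF f] f] by (simp add: M.finsum_insert)
    finally show ?thesis using k(2)[OF f] f by (simp add: U_single_def)
  qed
  ultimately show thesis by (rule that)
qed

end

text \<open>
  All coordinates of \<open>x\<close> but one can be killed by a product of powers of the other irreducible
  polynomials. This product acts invertibly on the remaining coordinate, from which a further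
  multiple reaches the generator of the simple submodule.
\<close>

lemma D_essential:
  assumes x: "x \<in> carrier D_mod" "x \<noteq> \<zero>\<^bsub>D_mod\<^esub>"
  shows "\<exists>r. \<exists>f\<in>irred_polys. act D_mod r x = U_single f"
proof -
  have xc: "\<And>f. f \<in> irred_polys \<Longrightarrow> x f \<in> carrier (U_mod f)" "x \<in> extensional irred_polys"
    and fin: "finite {f \<in> irred_polys. x f \<noteq> \<zero>\<^bsub>U_mod f\<^esub>}" using x by (auto simp: D_carrier)
  have "\<exists>f\<in>irred_polys. x f \<noteq> \<zero>\<^bsub>U_mod f\<^esub>"
  proof (rule ccontr)
    assume "\<not> ?thesis"
    then have "x = \<zero>\<^bsub>D_mod\<^esub>" using xc(2) unfolding D_zero by (intro extensionalityI[of _ irred_polys]) auto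
    then show False using x by blast
  qed
  then obtain f where f: "f \<in> irred_polys" "x f \<noteq> \<zero>\<^bsub>U_mod f\<^esub>" by blast
  interpret U: U_module f by unfold_locales (rule f)
  have "\<exists>n. act (U_mod g) (poly_at YY (g ^ n)) (x g) = \<zero>\<^bsub>U_mod g\<^esub>" if g: "g \<in> irred_polys" for g
  proof -
    interpret G: U_module g by unfold_locales (rule g)
    show ?thesis using G.killed_by_power[OF xc(1)[OF g]] by blast
  qed
  then obtain n where n: "\<And>g. g \<in> irred_polys \<Longrightarrow> act (U_mod g) (poly_at YY (g ^ n g)) (x g) = \<zero>\<^bsub>U_mod g\<^esub>" by metis
  let ?A = "{g \<in> irred_polys. x g \<noteq> \<zero>\<^bsub>U_mod g\<^esub>} - {f}"
  \<comment> \<open>kills all coordinates of \<open>x\<close> except that at \<open>f\<close>\<close>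
  define q where "q = (\<Prod>g\<in>?A. g ^ n g)"
  have kill: "act (U_mod g) (poly_at YY (b * q)) (x g) = \<zero>\<^bsub>U_mod g\<^esub>" if g: "g \<in> irred_polys" "g \<noteq> f" for g b
  proof -
    interpret G: toep_module "U_mod g" by (rule toep_moduleI[OF left_module_U])
    show ?thesis
    proof (cases "x g = \<zero>\<^bsub>U_mod g\<^esub>")
      case False
      then have "g ^ n g dvd q" unfolding q_def using fin g by (intro dvd_prodI) auto
      then obtain s where "q = s * g ^ n g" by (metis dvd_def mult.commute)
      then show ?thesis using n[OF g(1)] xc(1)[OF g(1)] by (simp add: poly_at_mult G.act_mult)
    qed simp
  qed
  have "comaximal (f ^ n f) q"
    unfolding q_def
  proof (rule comaximal_prod)
    fix g assume "g \<in> ?A"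
    then have "comaximal f g" using irred_polys_comaximal f(1) by auto
    then show "comaximal (f ^ n f) (g ^ n g)" by (metis comaximal_commute comaximal_power)
  qed
  then obtain a b where "a * q + b * f ^ n f = 1" unfolding comaximal_def by (metis add.commute)
  from U.comaximal_act[OF xc(1)[OF f(1)] this n[OF f(1)]]
  have "act (U_mod f) (poly_at YY q) (x f) \<noteq> \<zero>\<^bsub>U_mod f\<^esub>" using f(2) by auto
  then obtain b where b: "act (U_mod f) (poly_at YY b) (act (U_mod f) (poly_at YY q) (x f)) = U_gen f (Suc 0)"
    using U.essential[of "act (U_mod f) (poly_at YY q) (x f)"] xc(1)[OF f(1)] by blast
  have "act D_mod (poly_at YY (b * q)) x = U_single f"
    unfolding D_act U_single_def
  proof (rule restrict_ext)
    fix g :: "'a poly" assume g: "g \<in> irred_polys"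
    show "act (U_mod g) (poly_at YY (b * q)) (x g) = (if g = f then U_gen f (Suc 0) else \<zero>\<^bsub>U_mod g\<^esub>)"
      using kill[OF g] b xc(1)[OF f(1)] by (cases "g = f") (simp_all add: poly_at_mult U.act_mult)
  qed
  then show ?thesis using f(1) by blast
qed

text \<open>
  The simple submodules of the summands meet every nonzero submodule of the sum. So a homomorphism
  that does not vanish on any of their generators is injective.
\<close>

lemma C_minimal:
  fixes E :: "('k::field free set, 'e) module"
  assumes "injective_lmod TYPE('k free set set) toeplitz_lpa E" "cogenerator_lmod TYPE('k free set set) toeplitz_lpa E"
  shows "lmod_embeds toeplitz_lpa C_mod E"
proof -
  have "left_module toeplitz_lpa E" using assms(1) by (simp add: injective_lmod_def)
  then interpret injective_cogenerator E
    by (intro injective_cogenerator.intro injective_imp_baer assms)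
  interpret C: toep_module "C_mod :: ('k free set, _) module" by (rule toep_moduleI[OF left_module_C])
  interpret D: toep_module "D_mod :: ('k free set, _) module" by (rule toep_moduleI[OF left_module_D])
  obtain k where k: "k \<in> lmod_hom toeplitz_lpa Y_mod E" "k y_w \<noteq> \<zero>\<^bsub>E\<^esub>" by (rule hom_from_Y)
  obtain l where l: "l \<in> lmod_hom toeplitz_lpa D_mod E" "\<And>f. f \<in> irred_polys \<Longrightarrow> l (U_single f) \<noteq> \<zero>\<^bsub>E\<^esub>"
    by (rule hom_from_D) blast
  note kd = lmod_homD[OF k(1)] and ld = lmod_homD[OF l(1)]
  let ?h = "\<lambda>(y, x). k y \<oplus>\<^bsub>E\<^esub> l x"
  have hom: "?h \<in> lmod_hom toeplitz_lpa C_mod E"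
  proof (rule hom_actI)
    fix u v :: "(ysym \<Rightarrow> 'k) \<times> ('k poly \<Rightarrow> (nat \<times> 'k free set set) set)"
    assume "u \<in> carrier C_mod" "v \<in> carrier C_mod"
    then obtain y x y' x' where *: "u = (y, x)" "v = (y', x')" "y \<in> carrier Y_mod" "y' \<in> carrier Y_mod"
      "x \<in> carrier D_mod" "x' \<in> carrier D_mod" by (auto simp: C_simps)
    then show "?h (u \<oplus>\<^bsub>C_mod\<^esub> v) = ?h u \<oplus>\<^bsub>E\<^esub> ?h v"
      by (simp add: C_simps kd ld M.a_ac)
  next
    fix r and u :: "(ysym \<Rightarrow> 'k) \<times> ('k poly \<Rightarrow> (nat \<times> 'k free set set) set)"
    assume "u \<in> carrier C_mod"
    then obtain y x where "u = (y, x)" "y \<in> carrier Y_mod" "x \<in> carrier D_mod" by (auto simp: C_simps)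
    then show "?h (act C_mod r u) = act E r (?h u)" "?h u \<in> carrier E"
      by (simp_all add: C_simps hom_act[OF k(1)] hom_act[OF l(1)] act_add_right kd ld)
  qed
  have k0: "k \<zero>\<^bsub>Y_mod\<^esub> = \<zero>\<^bsub>E\<^esub>" by (rule lmod_hom_zero[OF left_module_Y E(1) k(1)])
  have l0: "l \<zero>\<^bsub>D_mod\<^esub> = \<zero>\<^bsub>E\<^esub>" by (rule lmod_hom_zero[OF left_module_D E(1) l(1)])
  have "inj_on ?h (carrier C_mod)"
  proof (rule hom_inj_of_kernel[OF left_module_C E(1) hom])
    fix u :: "(ysym \<Rightarrow> 'k) \<times> ('k poly \<Rightarrow> (nat \<times> 'k free set set) set)"
    assume u: "u \<in> carrier C_mod" "u \<noteq> \<zero>\<^bsub>C_mod\<^esub>"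
    then obtain y x where yx: "u = (y, x)" "y \<in> carrier Y_mod" "x \<in> carrier D_mod" by (auto simp: C_simps)
    have "\<exists>r. ?h (act C_mod r u) \<noteq> \<zero>\<^bsub>E\<^esub>"
    proof (cases "y = \<zero>\<^bsub>Y_mod\<^esub>")
      case False
      then obtain a i where r: "act Y_mod (scal a * (WW * XX ^ i)) y = y_w" using Y_essential by blast
      have "act D_mod (scal a * (WW * XX ^ i)) x = \<zero>\<^bsub>D_mod\<^esub>"
        using D_W_free[OF yx(3)] yx(3) D.act_mult[OF yx(3), of "scal a" "WW * XX ^ i"] by (simp add: D.W_free_def)
      then have "?h (act C_mod (scal a * (WW * XX ^ i)) u) = k y_w"
        using r l0 kd(1)[OF y_w_props(1)] by (simp add: yx C_simps)
      then show ?thesis using k(2) by metis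
    next
      case True
      then have "x \<noteq> \<zero>\<^bsub>D_mod\<^esub>" using u yx by (auto simp: C_simps)
      then obtain r f where r: "f \<in> irred_polys" "act D_mod r x = U_single f" using D_essential[OF yx(3)] by blast
      have "?h (act C_mod r u) = l (U_single f)"
        using True r k0 ld(1)[OF U_single_props(1)[OF r(1)]] Y.act_zero by (simp add: yx C_simps)
      then show ?thesis using l(2)[OF r(1)] by metis
    qed
    then obtain r where "?h (act C_mod r u) \<noteq> \<zero>\<^bsub>E\<^esub>" by blast
    then have "act E r (?h u) \<noteq> \<zero>\<^bsub>E\<^esub>" using hom_act[OF hom u(1)] by simp
    then show "?h u \<noteq> \<zero>\<^bsub>E\<^esub>" by (metis act_zero)
  qed
  with hom show ?thesis unfolding lmod_embeds_def by blast
qed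

theorem theorem31:
  shows "minimal_injective_cogenerator TYPE('u) TYPE('e)
    (toeplitz_lpa :: 'k::field free set ring)
    (sum2_lmod Y_mod (sum_lmod irred_polys U_mod))"
  unfolding minimal_injective_cogenerator_def
proof (intro conjI allI impI)
  show "injective_lmod TYPE('u) (toeplitz_lpa :: 'k free set ring) C_mod"
    by (rule baer_imp_injective[OF left_module_C baer_C])
  show "cogenerator_lmod TYPE('u) (toeplitz_lpa :: 'k free set ring) C_mod"
    by (rule cogenerator_of_separates[OF left_module_C C_separates])
qed (rule C_minimal)

end
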